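(* Let $h>w>0$ be fixed integers. Provided the integer $k$ is sufficiently large (larger than some constant depending only on $h$ and $w$), there exists a sharp threshold function $f(\bar n)$ for the hypergraph property $\mathcal{T}$ in $\mathcal{M}_{\bar n,\bar m,h}$ and $\mathcal{G}_{\bar n,\bar m,h}$.
   Context: Models. $\mathcal{G}_{\bar n,\bar m,h}$ is the uniform probability space of all simple hypergraphs on $[\bar n]$ with $\bar m$ hyperedges, all of size $h$. $\mathcal{M}_{\bar n,\bar m,h}$ is the random multihypergraph on $[\bar n]$ with $\bar m$ hyperedges, each a multiset of $h$ vertices chosen independently and uniformly at random from $[\bar n]$. Degrees and sizes are counted with multiplicity. Core. A vertex is light if its degree is at most $k$. Starting from $H$, repeatedly choose a light vertex $v$, delete it, and replace each hyperedge incident to $v$ by the hyperedge with (all occurrences of) $v$ removed; a hyperedge whose size falls to $h-w$ or below is deleted. When no light vertex remains, the resulting multihypergraph $\widehat H$ (possibly empty) is the $(w,k+1)$-core of $H$. Density and property $\mathcal T$. For a multihypergraph $G$ on $n\ge1$ vertices with $m_{h-j}$ hyperedges of size $h-j$ for $0\le j\le w-1$ and no others, its $w$-density is $\kappa(G)=\frac1n\sum_{j=0}^{w-1}(w-j)m_{h-j}$; for the empty hypergraph put $\kappa=0$. $H$ has property $\mathcal{T}$ if $\kappa(\widehat H)\le k$. Sharp threshold. A property $\mathcal P$ has sharp threshold function $f(\bar n)$ in $\mathcal{M}_{\bar n,\bar m,h}$ if for every constant $\epsilon>0$, as $\bar n\to\infty$, $\mathbf P(\mathcal{M}_{\bar n,\bar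 m,h}\in\mathcal P)\to1$ when $\bar m\le(1-\epsilon)f(\bar n)$ and $\to0$ when $\bar m\ge(1+\epsilon)f(\bar n)$; similarly for $\mathcal{G}_{\bar n,\bar m,h}$. *)

theory Defs
  imports "HOL-Probability.Probability" "HOL-Library.Multiset"
begin

record 'a multihypergraph =
  verts :: "'a set"
  edges :: "'a multiset multiset"

definition vdegree :: "'a multihypergraph \<Rightarrow> 'a \<Rightarrow> nat" where
  "vdegree H v = (\<Sum>e\<in>#edges H. count e v)"

definition light :: "nat \<Rightarrow> 'a multihypergraph \<Rightarrow> 'a \<Rightarrow> bool" where
  "light k H v \<longleftrightarrow> v \<in> verts H \<and> vdegree H v \<le> k"

definition delete_vertex :: "nat \<Rightarrow> nat \<Rightarrow> 'a \<Rightarrow> 'a multihypergraph \<Rightarrow> 'a multihypergraph" where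
  "delete_vertex h w v H =
     \<lparr> verts = verts H - {v},
       edges = filter_mset (\<lambda>e. v \<notin># e) (edges H)
             + filter_mset (\<lambda>e. h - w < size e)
                 (image_mset (filter_mset (\<lambda>u. u \<noteq> v)) (filter_mset (\<lambda>e. v \<in># e) (edges H))) \<rparr>"

definition peel_step :: "nat \<Rightarrow> nat \<Rightarrow> nat \<Rightarrow> 'a multihypergraph \<Rightarrow> 'a multihypergraph \<Rightarrow> bool" where
  "peel_step h w k H H' \<longleftrightarrow> (\<exists>v. light k H v \<and> H' = delete_vertex h w v H)"

definition is_core :: "nat \<Rightarrow> nat \<Rightarrow> nat \<Rightarrow> 'a multihypergraph \<Rightarrow> 'a multihypergraph \<Rightarrow> bool" where
  "is_core h w k H C \<longleftrightarrow> (peel_step h w k)\<^sup>*\<^sup>* H C \<and> (\<nexists>v. light k C v)"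

text \<open>The outcome of the peeling process does not depend on the order of the deletions;
  see \<open>is_core_ex1\<close> below.\<close>

definition core :: "nat \<Rightarrow> nat \<Rightarrow> nat \<Rightarrow> 'a multihypergraph \<Rightarrow> 'a multihypergraph" where
  "core h w k H = (THE C. is_core h w k H C)"

definition w_density :: "nat \<Rightarrow> nat \<Rightarrow> 'a multihypergraph \<Rightarrow> real" where
  "w_density h w G =
     (if verts G = {} then 0
      else (\<Sum>j<w. real (w - j) * real (size {# e \<in># edges G. size e = h - j #})) / real (card (verts G)))"

definition property_T :: "nat \<Rightarrow> nat \<Rightarrow> nat \<Rightarrow> 'a multihypergraph \<Rightarrow> bool" where
  "property_T h w k H \<longleftrightarrow> w_density h w (core h w k H) \<le> real k"

definition multi_model :: "nat \<Rightarrow> nat \<Rightarrow> nat \<Rightarrow> nat multihypergraph pmf" where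
  "multi_model h n m =
     map_pmf (\<lambda>es. \<lparr> verts = {1..n}, edges = mset es \<rparr>)
       (replicate_pmf m (map_pmf mset (replicate_pmf h (pmf_of_set {1..n}))))"

definition simple_hypergraphs :: "nat \<Rightarrow> nat \<Rightarrow> nat \<Rightarrow> nat multihypergraph set" where
  "simple_hypergraphs h n m =
     {\<lparr> verts = {1..n}, edges = E \<rparr> | E.
        size E = m \<and> (\<forall>e. count E e \<le> 1) \<and>
        (\<forall>e\<in>#E. size e = h \<and> set_mset e \<subseteq> {1..n} \<and> (\<forall>v. count e v \<le> 1))}"

definition simple_model :: "nat \<Rightarrow> nat \<Rightarrow> nat \<Rightarrow> nat multihypergraph pmf" where
  "simple_model h n m = pmf_of_set (simple_hypergraphs h n m)"

text \<open>In \<open>sharp_threshold D X P f\<close>, the set \<open>D n\<close> consists of those \<open>m\<close> for which the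
  probability space \<open>X n m\<close> exists. The limits as \<open>n\<close> tends to infinity are uniform in the
  admissible \<open>m\<close>, which amounts to quantifying over all admissible functions \<open>m = m(n)\<close>.\<close>

definition sharp_threshold ::
    "(nat \<Rightarrow> nat set) \<Rightarrow> (nat \<Rightarrow> nat \<Rightarrow> 'b pmf) \<Rightarrow> ('b \<Rightarrow> bool) \<Rightarrow> (nat \<Rightarrow> real) \<Rightarrow> bool" where
  "sharp_threshold D X P f \<longleftrightarrow>
     (\<forall>\<epsilon>>0. \<forall>\<delta>>0. \<forall>\<^sub>F n in sequentially. \<forall>m\<in>D n.
        (real m \<le> (1 - \<epsilon>) * f n \<longrightarrow> measure_pmf.prob (X n m) {H. P H} > 1 - \<delta>) \<and>
        (real m \<ge> (1 + \<epsilon>) * f n \<longrightarrow> measure_pmf.prob (X n m) {H. P H} < \<delta>))"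


lemma finite_simple_hypergraphs: "finite (simple_hypergraphs h n m)"
proof -
  have eq: "M = mset_set (set_mset M)" if "\<forall>x. count M x \<le> 1" for M :: "'c multiset"
  proof (rule multiset_eqI)
    fix x
    have "count M x = 1" if "x \<in># M"
      using that \<open>\<forall>x. count M x \<le> 1\<close>[rule_format, of x] count_greater_zero_iff[of M x] by linarith
    then show "count M x = count (mset_set (set_mset M)) x"
      by (cases "x \<in># M") (auto simp: not_in_iff)
  qed
  have "simple_hypergraphs h n m \<subseteq>
      (\<lambda>S. \<lparr> verts = {1..n}, edges = mset_set S \<rparr>) ` Pow (mset_set ` Pow {1..n})"
  proof
    fix H assume "H \<in> simple_hypergraphs h n m"
    then obtain E where E: "H = \<lparr> verts = {1..n}, edges = E \<rparr>" "\<forall>e. count E e \<le> 1"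
      "\<forall>e\<in>#E. set_mset e \<subseteq> {1..n} \<and> (\<forall>v. count e v \<le> 1)"
      by (auto simp: simple_hypergraphs_def)
    have "set_mset E \<subseteq> mset_set ` Pow {1..n}"
    proof
      fix e assume "e \<in># E"
      with E(3) have "set_mset e \<in> Pow {1..n}" and "e = mset_set (set_mset e)"
        by (blast, intro eq) blast
      then show "e \<in> mset_set ` Pow {1..n}" by (rule rev_image_eqI)
    qed
    then have "set_mset E \<in> Pow (mset_set ` Pow {1..n})" by (rule PowI)
    moreover have "H = \<lparr> verts = {1..n}, edges = mset_set (set_mset E) \<rparr>"
      unfolding eq[OF E(2), symmetric] by (rule E(1))
    ultimately show "H \<in> (\<lambda>S. \<lparr> verts = {1..n}, edges = mset_set S \<rparr>) ` Pow (mset_set ` Pow {1..n})"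
      by (rule rev_image_eqI)
  qed
  then show ?thesis
    by (rule finite_subset) auto
qed

lemma edges_delete_vertex:
  "edges (delete_vertex h w v H) =
     filter_mset (\<lambda>e. v \<notin># e) (edges H) +
     image_mset (filter_mset (\<lambda>u. u \<noteq> v))
       (filter_mset (\<lambda>e. v \<in># e \<and> h - w < size (filter_mset (\<lambda>u. u \<noteq> v) e)) (edges H))"
  by (simp add: delete_vertex_def filter_mset_image_mset filter_filter_mset conj_commute)

lemma verts_delete_vertex [simp]: "verts (delete_vertex h w v H) = verts H - {v}"
  by (simp add: delete_vertex_def)

lemma vdegree_delete_vertex: "vdegree (delete_vertex h w v H) u \<le> vdegree H u"
proof -
  have "(\<Sum>e\<in>#filter_mset (\<lambda>e. v \<notin># e) E +
     image_mset (filter_mset (\<lambda>u. u \<noteq> v))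
       (filter_mset (\<lambda>e. v \<in># e \<and> h - w < size (filter_mset (\<lambda>u. u \<noteq> v) e)) E). count e u)
     \<le> (\<Sum>e\<in>#E. count e u)" for E
    by (induction E) auto
  then show ?thesis by (simp add: vdegree_def edges_delete_vertex)
qed

lemma delete_vertex_commute:
  assumes "u \<noteq> v"
  shows "delete_vertex h w u (delete_vertex h w v H) = delete_vertex h w v (delete_vertex h w u H)"
proof (rule multihypergraph.equality)
  define f where "f = (\<lambda>v. \<lambda>E :: 'a multiset multiset. filter_mset (\<lambda>e. v \<notin># e) E +
     image_mset (filter_mset (\<lambda>u. u \<noteq> v))
       (filter_mset (\<lambda>e. v \<in># e \<and> h - w < size (filter_mset (\<lambda>u. u \<noteq> v) e)) E))"
  have "f u (f v E) = f v (f u E)" for E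
  proof (induction E)
    case (add e E)
    have add_f: "f a (A + B) = f a A + f a B" for a A B
      by (simp add: f_def)
    let ?r = "\<lambda>a e. filter_mset (\<lambda>x. x \<noteq> a) e"
    have single: "f a {#d#} = (if a \<notin># d then {#d#} else if h - w < size (?r a d) then {#?r a d#} else {#})"
      and empty: "f a {#} = {#}" for a d
      by (simp_all add: f_def)
    have comm: "?r v (?r u e) = ?r u (?r v e)"
      by (simp add: filter_filter_mset conj_commute)
    have le: "h - w < size (?r u (?r v e)) \<Longrightarrow> h - w < size (?r v e)"
      by (rule less_le_trans[OF _ size_filter_mset_lesseq])
    have le': "h - w < size (?r u (?r v e)) \<Longrightarrow> h - w < size (?r u e)"
      unfolding comm[symmetric] by (rule less_le_trans[OF _ size_filter_mset_lesseq])
    have "f u (f v {#e#}) = f v (f u {#e#})"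
      using assms comm by (cases "u \<in># e"; cases "v \<in># e") (auto simp: single empty dest: le le')
    with add show ?case
      using add_f[of u "{#e#}" E] add_f[of v "{#e#}" E] by (simp add: add_f)
  qed (simp add: f_def)
  then show "edges (delete_vertex h w u (delete_vertex h w v H)) =
      edges (delete_vertex h w v (delete_vertex h w u H))"
    by (simp only: edges_delete_vertex f_def)
qed auto

lemma is_core_delete_vertexI:
  assumes "light k H v" and "is_core h w k (delete_vertex h w v H) C"
  shows "is_core h w k H C"
proof -
  have "peel_step h w k H (delete_vertex h w v H)"
    using assms(1) by (auto simp: peel_step_def)
  with assms(2) show ?thesis
    unfolding is_core_def by (blast intro: converse_rtranclp_into_rtranclp)
qed

lemma is_core_cases:
  assumes "is_core h w k H C"
  obtains "C = H" "\<nexists>v. light k H v"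
  | v where "light k H v" "is_core h w k (delete_vertex h w v H) C"
proof (cases "\<exists>v. light k H v \<and> is_core h w k (delete_vertex h w v H) C")
  case True
  with that(2) show ?thesis by blast
next
  case False
  from assms have "(peel_step h w k)\<^sup>*\<^sup>* H C" and normal: "\<nexists>v. light k C v"
    by (simp_all add: is_core_def)
  from this(1) have "C = H"
  proof (cases rule: converse_rtranclpE)
    case (step H')
    from step(1) obtain v where "light k H v" "H' = delete_vertex h w v H"
      unfolding peel_step_def by blast
    with step(2) normal False show ?thesis
      by (simp add: is_core_def)
  qed simp
  with that(1) normal show ?thesis by blast
qed

lemma is_core_ex1:
  assumes "finite (verts H)"
  shows "\<exists>!C. is_core h w k H C"
  using assms
proof (induction "card (verts H)" arbitrary: H rule: less_induct)
  case less
  have IH: "\<exists>!C. is_core h w k (delete_vertex h w v H) C" if "light k H v" for v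
  proof (rule less.hyps)
    show "card (verts (delete_vertex h w v H)) < card (verts H)"
      using that less.prems by (intro psubset_card_mono) (auto simp: light_def)
  qed (use less.prems in simp)
  have light_del: "light k (delete_vertex h w v H) u" if "light k H u" "u \<noteq> v" for u v
    using that vdegree_delete_vertex[of h w v H u] by (auto simp: light_def)
  have same: "C = C'" if v: "light k H v" and u: "light k H u"
    and C: "is_core h w k (delete_vertex h w v H) C" and C': "is_core h w k (delete_vertex h w u H) C'"
    for u v C C'
  proof (cases "u = v")
    case True with IH[OF v] C C' show ?thesis by blast
  next
    case False
    let ?K = "delete_vertex h w u (delete_vertex h w v H)"
    have "card (verts ?K) < card (verts H)"
      using less.prems v by (intro psubset_card_mono) (auto simp: light_def)
    then obtain D where D: "is_core h w k ?K D"
      using less.hyps[of ?K] less.prems by (metis finite_Diff verts_delete_vertex)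
    have "is_core h w k (delete_vertex h w v H) D"
      using light_del[OF u False] D by (rule is_core_delete_vertexI)
    moreover have "is_core h w k (delete_vertex h w u H) D"
      using light_del[OF v False[symmetric]] D[unfolded delete_vertex_commute[OF False]]
      by (rule is_core_delete_vertexI)
    ultimately show ?thesis using IH[OF v] IH[OF u] C C' by metis
  qed
  show ?case
  proof (cases "\<exists>v. light k H v")
    case True
    then obtain v where v: "light k H v" by blast
    then obtain C where C: "is_core h w k (delete_vertex h w v H) C" using IH by blast
    show ?thesis
    proof (rule ex1I[of _ C])
      show "is_core h w k H C" using v C by (rule is_core_delete_vertexI)
      show "C' = C" if "is_core h w k H C'" for C'
        using that
      proof (cases rule: is_core_cases)
        case 1
        with v show ?thesis by blast
      next
        case (2 u)
        from same[OF 2(1) v 2(2) C] show ?thesis .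
      qed
    qed
  next
    case False
    then have "is_core h w k H H" by (simp add: is_core_def)
    moreover have "C = H" if "is_core h w k H C" for C
      using that
    proof (cases rule: is_core_cases)
      case (2 u)
      with False show ?thesis by blast
    qed
    ultimately show ?thesis by blast
  qed
qed

end

theory Submission
  imports Defs "HOL-Combinatorics.Multiset_Permutations"
begin

text \<open>For a vertex set \<open>S\<close> let \<open>\<Phi>(S)\<close> be the sum of \<open>max 0 (|e \<inter> S| - (h - w))\<close> over the edges
  minus \<open>k |S|\<close> (the surplus below). Deleting a light vertex never decreases \<open>\<Phi>\<close>, and \<open>\<T>\<close> says that
  \<open>\<Phi>\<close> is at most 0 at the core \<open>W\<close>; hence \<open>\<T>\<close> fails whenever \<open>w m > k n\<close>, and holds whenever the maximum
  of \<open>\<Phi>\<close> is 0. Unlike \<open>\<T>\<close>, this maximum is monotone in the edge set. Adding or replacing one edge changes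
  it by at most \<open>w\<close>, so its variance is \<open>O(m)\<close>. A first moment bound shows that for \<open>w m \<le> k n\<close> only sets containing
  almost all vertices have positive surplus, and such a set gains from each further edge with
  probability at least 3/4. So the maximum has a sharp threshold at its median positivity time,
  beyond which it is linear in \<open>n\<close>.

  It remains to exclude that the maximum is linear while \<open>\<Phi>(W) \<le> 0\<close>. In that case a linear number of
  vertices outside a maximizer \<open>S\<close> survive in the core; as they have degree above \<open>k\<close> there, the components outside \<open>S\<close>
  that contain them have at least as many excess incidences as vertices, while maximality of \<open>S\<close>
  lets at most \<open>k\<close> edges per vertex meet them. Since the average degree is close to
  \<open>k h / w > k\<close>, an exponentially tilted first moment excludes such sets once \<open>k\<close> is large.
  The simple model is the multihypergraph model conditioned on an event of probability bounded
  away from 0.\<close>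

subsection \<open>Sequences of independent samples\<close>

text \<open>Finite support carries over from one sample to a sequence, so every real function of a
  sequence is integrable in what follows.\<close>

lemma finite_set_replicate_pmf:
  "finite (set_pmf p) \<Longrightarrow> finite (set_pmf (replicate_pmf m p))"
  unfolding set_replicate_pmf using finite_lists_length_eq[of "set_pmf p" m]
  by (simp add: lists_eq_set conj_commute)

lemma expectation_bind_finite:
  fixes F :: "'b \<Rightarrow> real"
  assumes "finite (set_pmf p)" and "\<And>x. x \<in> set_pmf p \<Longrightarrow> finite (set_pmf (f x))"
  shows "measure_pmf.expectation (bind_pmf p f) F =
    measure_pmf.expectation p (\<lambda>x. measure_pmf.expectation (f x) F)"
  by (subst pmf_expectation_bind[OF assms(1)])
    (use assms in \<open>auto simp: integral_measure_pmf[OF assms(1)]\<close>)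

lemma expectation_replicate_add:
  fixes F :: "'a list \<Rightarrow> real"
  assumes "finite (set_pmf p)"
  shows "measure_pmf.expectation (replicate_pmf (m + d) p) F =
    measure_pmf.expectation (replicate_pmf m p)
      (\<lambda>xs. measure_pmf.expectation (replicate_pmf d p) (\<lambda>ys. F (xs @ ys)))"
  using assms finite_set_replicate_pmf[OF assms]
  by (simp add: replicate_pmf_distrib expectation_bind_finite set_bind_pmf)

lemma expectation_replicate_Suc:
  fixes F :: "'a list \<Rightarrow> real"
  assumes "finite (set_pmf p)"
  shows "measure_pmf.expectation (replicate_pmf (Suc m) p) F =
    measure_pmf.expectation p (\<lambda>x. measure_pmf.expectation (replicate_pmf m p) (\<lambda>xs. F (x # xs)))"
  using assms finite_set_replicate_pmf[OF assms]
  by (simp add: expectation_bind_finite set_bind_pmf)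

lemma expectation_replicate_prod:
  fixes \<phi> :: "'a \<Rightarrow> real"
  assumes "finite (set_pmf p)"
  shows "measure_pmf.expectation (replicate_pmf m p) (\<lambda>xs. \<Prod>x\<leftarrow>xs. \<phi> x) =
    measure_pmf.expectation p \<phi> ^ m"
proof (induction m)
  case (Suc m)
  then show ?case
    by (simp add: expectation_replicate_Suc[OF assms] del: replicate_pmf.simps)
qed simp

lemma expectation_add_finite:
  fixes f g :: "'a \<Rightarrow> real"
  assumes "finite (set_pmf p)"
  shows "measure_pmf.expectation p (\<lambda>x. f x + g x) =
    measure_pmf.expectation p f + measure_pmf.expectation p g"
  using assms by (simp add: integrable_measure_pmf_finite)

lemma expectation_mono_finite:
  fixes f g :: "'a \<Rightarrow> real"
  assumes "finite (set_pmf p)" and "\<And>x. x \<in> set_pmf p \<Longrightarrow> f x \<le> g x"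
  shows "measure_pmf.expectation p f \<le> measure_pmf.expectation p g"
  using assms by (intro integral_mono_AE integrable_measure_pmf_finite) (auto simp: AE_measure_pmf_iff)

lemma expectation_replicate_sum:
  fixes \<phi> :: "'a \<Rightarrow> real"
  assumes "finite (set_pmf p)"
  shows "measure_pmf.expectation (replicate_pmf m p) (\<lambda>xs. \<Sum>x\<leftarrow>xs. \<phi> x) =
    real m * measure_pmf.expectation p \<phi>"
proof (induction m)
  case (Suc m)
  then show ?case
    using expectation_add_finite[OF assms] expectation_add_finite[OF finite_set_replicate_pmf[OF assms]]
    by (simp add: expectation_replicate_Suc[OF assms] algebra_simps del: replicate_pmf.simps)
qed simp

lemma prob_le_expectation:
  fixes F :: "'a \<Rightarrow> real"
  assumes "finite (set_pmf p)"
    and "\<And>x. x \<in> set_pmf p \<Longrightarrow> 0 \<le> F x" and "\<And>x. x \<in> set_pmf p \<Longrightarrow> x \<in> A \<Longrightarrow> 1 \<le> F x"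
  shows "measure_pmf.prob p A \<le> measure_pmf.expectation p F"
proof -
  have "measure_pmf.prob p A = measure_pmf.expectation p (indicat_real A)"
    by simp
  also have "\<dots> \<le> measure_pmf.expectation p F"
    using assms by (intro expectation_mono_finite) (auto simp: indicator_def)
  finally show ?thesis .
qed

lemma prob_mono_supp:
  assumes "\<And>x. x \<in> set_pmf p \<Longrightarrow> x \<in> A \<Longrightarrow> x \<in> B"
  shows "measure_pmf.prob p A \<le> measure_pmf.prob p B"
  using assms by (intro measure_pmf.finite_measure_mono_AE) (auto simp: AE_measure_pmf_iff)

lemma prob_union_supp:
  assumes "\<And>x. x \<in> set_pmf p \<Longrightarrow> x \<in> A \<Longrightarrow> x \<in> B \<or> x \<in> C"
  shows "measure_pmf.prob p A \<le> measure_pmf.prob p B + measure_pmf.prob p C"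
proof -
  have "measure_pmf.prob p A \<le> measure_pmf.prob p (B \<union> C)"
    using assms by (intro prob_mono_supp) blast
  also have "\<dots> \<le> measure_pmf.prob p B + measure_pmf.prob p C"
    by (intro measure_subadditive) auto
  finally show ?thesis .
qed

text \<open>Two-round exposure: whatever outcome in \<open>A\<close> the first \<open>m\<close>
  samples have, the \<open>d\<close> fresh ones produce \<open>B\<close> with conditional
  probability at least \<open>c\<close>.\<close>

lemma prob_replicate_add_ge:
  assumes "finite (set_pmf p)" and "0 \<le> c"
    and "\<And>xs. xs \<in> set_pmf (replicate_pmf m p) \<Longrightarrow> A xs \<Longrightarrow>
      c \<le> measure_pmf.prob (replicate_pmf d p) {ys. B (xs @ ys)}"
  shows "c * measure_pmf.prob (replicate_pmf m p) {xs. A xs}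
    \<le> measure_pmf.prob (replicate_pmf (m + d) p) {xs. B xs}"
proof -
  have "c * measure_pmf.prob (replicate_pmf m p) {xs. A xs} =
    measure_pmf.expectation (replicate_pmf m p) (\<lambda>xs. c * indicat_real {xs. A xs} xs)"
    by simp
  also have "\<dots> \<le> measure_pmf.expectation (replicate_pmf m p)
     (\<lambda>xs. measure_pmf.prob (replicate_pmf d p) {ys. B (xs @ ys)})"
    using assms by (intro expectation_mono_finite finite_set_replicate_pmf) (auto simp: indicator_def)
  also have "\<dots> = measure_pmf.expectation (replicate_pmf m p)
     (\<lambda>xs. measure_pmf.expectation (replicate_pmf d p) (\<lambda>ys. indicat_real {xs. B xs} (xs @ ys)))"
  proof (intro Bochner_Integration.integral_cong refl)
    fix xs
    have "(\<lambda>ys. indicat_real {xs. B xs} (xs @ ys)) = indicat_real {ys. B (xs @ ys)}"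
      by (auto simp: indicator_def fun_eq_iff)
    then show "measure_pmf.prob (replicate_pmf d p) {ys. B (xs @ ys)} =
      measure_pmf.expectation (replicate_pmf d p) (\<lambda>ys. indicat_real {xs. B xs} (xs @ ys))"
      by simp
  qed
  also have "\<dots> = measure_pmf.prob (replicate_pmf (m + d) p) {xs. B xs}"
    by (simp add: expectation_replicate_add[OF assms(1), symmetric])
  finally show ?thesis .
qed

section \<open>Variance and concentration\<close>

lemma abs_expectation_diff_le:
  fixes g :: "'a \<Rightarrow> real"
  assumes fin: "finite (set_pmf p)" and x: "x \<in> set_pmf p"
    and bd: "\<And>a b. a \<in> set_pmf p \<Longrightarrow> b \<in> set_pmf p \<Longrightarrow> \<bar>g a - g b\<bar> \<le> c"
  shows "\<bar>g x - measure_pmf.expectation p g\<bar> \<le> c"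
proof -
  have "measure_pmf.expectation p g \<le> measure_pmf.expectation p (\<lambda>_. g x + c)"
    using bd[OF _ x] by (intro expectation_mono_finite fin) (simp add: abs_le_iff algebra_simps)
  moreover have "measure_pmf.expectation p (\<lambda>_. g x - c) \<le> measure_pmf.expectation p g"
    using bd[OF _ x] by (intro expectation_mono_finite fin) (simp add: abs_le_iff algebra_simps)
  ultimately show ?thesis by (simp add: abs_le_iff)
qed

text \<open>Induction on the number of coordinates via the law of total variance.\<close>

lemma variance_replicate_le:
  fixes f :: "'a list \<Rightarrow> real"
  assumes fin: "finite (set_pmf p)"
    and bd: "\<And>xs a b ys. a \<in> set_pmf p \<Longrightarrow> b \<in> set_pmf p \<Longrightarrow> set xs \<subseteq> set_pmf p \<Longrightarrow> set ys \<subseteq> set_pmf p \<Longrightarrow>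
      \<bar>f (xs @ a # ys) - f (xs @ b # ys)\<bar> \<le> c"
  shows "measure_pmf.variance (replicate_pmf m p) f \<le> real m * c\<^sup>2"
  using bd
proof (induction m arbitrary: f)
  case (Suc m)
  let ?R = "replicate_pmf m p"
  note finR = finite_set_replicate_pmf[OF fin, of m]
  define \<mu> where "\<mu> x = measure_pmf.expectation ?R (\<lambda>xs. f (x # xs))" for x
  define M where "M = measure_pmf.expectation (replicate_pmf (Suc m) p) f"
  have M: "M = measure_pmf.expectation p \<mu>"
    unfolding M_def \<mu>_def by (rule expectation_replicate_Suc[OF fin])
  have split: "measure_pmf.expectation ?R (\<lambda>xs. (f (x # xs) - M)\<^sup>2) =
      measure_pmf.expectation ?R (\<lambda>xs. (f (x # xs) - \<mu> x)\<^sup>2) + (\<mu> x - M)\<^sup>2" for x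
  proof -
    \<comment> \<open>The square is expanded around the conditional mean \<open>\<mu> x\<close>; the
      remaining part is affine in \<open>f (x # xs)\<close> and integrates to
      \<open>(\<mu> x - M)\<^sup>2\<close>.\<close>
    have "measure_pmf.expectation ?R (\<lambda>xs. (f (x # xs) - M)\<^sup>2) =
      measure_pmf.expectation ?R (\<lambda>xs. (f (x # xs) - \<mu> x)\<^sup>2 +
        (2 * (\<mu> x - M) * f (x # xs) + ((\<mu> x - M)\<^sup>2 - 2 * (\<mu> x - M) * \<mu> x)))"
      by (intro Bochner_Integration.integral_cong refl) (auto simp: power2_eq_square algebra_simps)
    also have "\<dots> = measure_pmf.expectation ?R (\<lambda>xs. (f (x # xs) - \<mu> x)\<^sup>2) +
        (2 * (\<mu> x - M) * \<mu> x + ((\<mu> x - M)\<^sup>2 - 2 * (\<mu> x - M) * \<mu> x))"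
      by (simp add: expectation_add_finite[OF finR] \<mu>_def)
    finally show ?thesis by simp
  qed
  have inner: "measure_pmf.expectation ?R (\<lambda>xs. (f (x # xs) - \<mu> x)\<^sup>2) \<le> real m * c\<^sup>2" if "x \<in> set_pmf p" for x
    unfolding \<mu>_def
  proof (rule Suc.IH)
    show "\<bar>f (x # xs @ a # ys) - f (x # xs @ b # ys)\<bar> \<le> c"
      if "a \<in> set_pmf p" "b \<in> set_pmf p" "set xs \<subseteq> set_pmf p" "set ys \<subseteq> set_pmf p" for xs a b ys
      using Suc.prems[of a b "x # xs" ys] that \<open>x \<in> set_pmf p\<close> by simp
  qed
  have \<mu>: "\<bar>\<mu> a - \<mu> b\<bar> \<le> c" if "a \<in> set_pmf p" "b \<in> set_pmf p" for a b
  proof -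
    have *: "measure_pmf.expectation ?R (\<lambda>xs. f (a # xs)) \<le> measure_pmf.expectation ?R (\<lambda>xs. f (b # xs) + c)"
      if "a \<in> set_pmf p" "b \<in> set_pmf p" for a b
    proof (intro expectation_mono_finite finR)
      fix xs assume "xs \<in> set_pmf ?R"
      then have "set xs \<subseteq> set_pmf p" by (auto simp: set_replicate_pmf)
      with Suc.prems[of a b "[]" xs] that show "f (a # xs) \<le> f (b # xs) + c" by simp
    qed
    from *[OF that] *[OF that(2,1)] show ?thesis
      by (simp add: expectation_add_finite[OF finR] \<mu>_def abs_le_iff algebra_simps)
  qed
  have outer: "(\<mu> x - M)\<^sup>2 \<le> c\<^sup>2" if "x \<in> set_pmf p" for x
  proof -
    have "\<bar>\<mu> x - M\<bar> \<le> \<bar>c\<bar>"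
      using abs_expectation_diff_le[OF fin that, of \<mu> c] \<mu> unfolding M by fastforce
    then show ?thesis by (simp add: abs_le_square_iff)
  qed
  have "measure_pmf.variance (replicate_pmf (Suc m) p) f =
      measure_pmf.expectation p (\<lambda>x. measure_pmf.expectation ?R (\<lambda>xs. (f (x # xs) - M)\<^sup>2))"
    unfolding M_def[symmetric] by (rule expectation_replicate_Suc[OF fin])
  also have "\<dots> \<le> measure_pmf.expectation p (\<lambda>x. real m * c\<^sup>2 + c\<^sup>2)"
    unfolding split using inner outer by (intro expectation_mono_finite fin add_mono)
  finally show ?case by (simp add: algebra_simps)
qed simp

text \<open>Wherever the mean lies, \<open>a\<close> exceeds it or \<open>b\<close> falls below it
  by at least \<open>(a - b) / 2\<close>, so one of the two events is contained in Chebyshev's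
  deviation event. When one event is known to be likely, the other must be unlikely.\<close>

lemma prob_separated_le_variance:
  fixes f :: "'a \<Rightarrow> real"
  assumes fin: "finite (set_pmf p)" and "b < a"
  shows "min (measure_pmf.prob p {x. a \<le> f x}) (measure_pmf.prob p {x. f x \<le> b})
    \<le> 4 * measure_pmf.variance p f / (a - b)\<^sup>2"
proof -
  define \<mu> where "\<mu> = measure_pmf.expectation p f"
  have cheb: "measure_pmf.prob p {x. \<bar>f x - \<mu>\<bar> \<ge> (a - b) / 2} \<le> measure_pmf.variance p f / ((a - b) / 2)\<^sup>2"
    using measure_pmf.Chebyshev_inequality[of f p "(a - b) / 2"] \<open>b < a\<close>
    by (simp add: \<mu>_def integrable_measure_pmf_finite[OF fin])
  have "measure_pmf.prob p {x. a \<le> f x} \<le> measure_pmf.prob p {x. \<bar>f x - \<mu>\<bar> \<ge> (a - b) / 2} \<or>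
    measure_pmf.prob p {x. f x \<le> b} \<le> measure_pmf.prob p {x. \<bar>f x - \<mu>\<bar> \<ge> (a - b) / 2}"
  proof (cases "a - \<mu> \<ge> (a - b) / 2")
    case True
    then show ?thesis by (intro disjI1 measure_pmf.finite_measure_mono) (auto simp: abs_if)
  next
    case False
    then show ?thesis by (intro disjI2 measure_pmf.finite_measure_mono) (auto simp: abs_if field_simps)
  qed
  moreover have "measure_pmf.variance p f / ((a - b) / 2)\<^sup>2 = 4 * measure_pmf.variance p f / (a - b)\<^sup>2"
    by (simp add: power_divide)
  ultimately show ?thesis using cheb by linarith
qed

section \<open>Samples without repetition\<close>

lemma prob_distinct_ge:
  assumes fin: "finite (set_pmf p)"
    and good: "1 - \<alpha> \<le> measure_pmf.prob p {x. G x}" and atom: "\<And>x. G x \<Longrightarrow> pmf p x \<le> \<beta>"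
    and "0 \<le> \<beta>" and "m \<le> N" and "\<alpha> + real N * \<beta> \<le> 1"
  shows "(1 - \<alpha> - real N * \<beta>) ^ m \<le>
    measure_pmf.prob (replicate_pmf m p) {xs. distinct xs \<and> (\<forall>x\<in>set xs. G x)}"
  using \<open>m \<le> N\<close>
proof (induction m)
  case (Suc m)
  let ?D = "\<lambda>xs. distinct xs \<and> (\<forall>x\<in>set xs. G x)" and ?R = "replicate_pmf m p"
  \<comment> \<open>Given a repetition-free good prefix, the next sample fails by being bad, with
    probability at most \<open>\<alpha>\<close>, or by hitting one of at most \<open>N\<close>
    earlier values, each an atom of mass at most \<open>\<beta>\<close>.\<close>
  have step: "1 - \<alpha> - real N * \<beta> \<le> measure_pmf.prob p {x. ?D (x # xs)}"
    if xs: "xs \<in> set_pmf ?R" "?D xs" for xs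
  proof -
    have "measure_pmf.prob p {x. G x} \<le> measure_pmf.prob p {x. ?D (x # xs)} + measure_pmf.prob p (set xs)"
      using xs by (intro prob_union_supp) auto
    moreover have "measure_pmf.prob p (set xs) \<le> real (card (set xs)) * \<beta>"
      using atom xs(2) sum_bounded_above[of "set xs" "pmf p" \<beta>] by (simp add: measure_measure_pmf_finite)
    moreover have "real (card (set xs)) * \<beta> \<le> real N * \<beta>"
      using xs(1) Suc.prems card_length[of xs] \<open>0 \<le> \<beta>\<close>
      by (intro mult_right_mono) (auto simp: set_replicate_pmf)
    ultimately show ?thesis using good by linarith
  qed
  have "measure_pmf.prob (replicate_pmf (Suc m) p) {xs. ?D xs} =
      measure_pmf.expectation (replicate_pmf (Suc m) p) (indicat_real {xs. ?D xs})"
    by simp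
  \<comment> \<open>The order of drawing is exchanged: the head of the list is drawn last, so that
    it can be conditioned on the tail.\<close>
  also have "\<dots> = measure_pmf.expectation (bind_pmf ?R (\<lambda>xs. map_pmf (\<lambda>x. x # xs) p)) (indicat_real {xs. ?D xs})"
    unfolding replicate_pmf.simps map_pmf_def by (subst bind_commute_pmf) (rule refl)
  also have "\<dots> =
      measure_pmf.expectation ?R (\<lambda>xs. measure_pmf.prob p {x. ?D (x # xs)})"
  proof (subst expectation_bind_finite)
    have "measure_pmf.expectation (map_pmf (\<lambda>x. x # xs) p) (indicat_real {xs. ?D xs}) =
        measure_pmf.prob p {x. ?D (x # xs)}" for xs
      by (simp add: vimage_def del: integral_map_pmf)
    then show "measure_pmf.expectation ?R (\<lambda>xs. measure_pmf.expectation (map_pmf (\<lambda>x. x # xs) p)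
        (indicat_real {xs. ?D xs})) = measure_pmf.expectation ?R (\<lambda>xs. measure_pmf.prob p {x. ?D (x # xs)})"
      by (simp only:)
  qed (use fin in \<open>auto simp: finite_set_replicate_pmf\<close>)
  also have "\<dots> \<ge> measure_pmf.expectation ?R (\<lambda>xs. (1 - \<alpha> - real N * \<beta>) * indicat_real {xs. ?D xs} xs)"
    using step by (intro expectation_mono_finite finite_set_replicate_pmf fin) (auto simp: indicator_def)
  also have "measure_pmf.expectation ?R (\<lambda>xs. (1 - \<alpha> - real N * \<beta>) * indicat_real {xs. ?D xs} xs) =
     (1 - \<alpha> - real N * \<beta>) * measure_pmf.prob ?R {xs. ?D xs}"
    by simp
  finally have "(1 - \<alpha> - real N * \<beta>) * measure_pmf.prob ?R {xs. ?D xs} \<le>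
      measure_pmf.prob (replicate_pmf (Suc m) p) {xs. ?D xs}" .
  moreover have "(1 - \<alpha> - real N * \<beta>) ^ Suc m \<le> (1 - \<alpha> - real N * \<beta>) * measure_pmf.prob ?R {xs. ?D xs}"
    using Suc \<open>\<alpha> + real N * \<beta> \<le> 1\<close> by (simp add: mult_left_mono)
  ultimately show ?case by linarith
qed simp

lemma pmf_replicate_pmf:
  "length xs = m \<Longrightarrow> pmf (replicate_pmf m p) xs = (\<Prod>x\<leftarrow>xs. pmf p x)"
proof (induction m arbitrary: xs)
  case (Suc m)
  then obtain y ys where xs: "xs = y # ys" "length ys = m" by (cases xs) auto
  have "replicate_pmf (Suc m) p = map_pmf (\<lambda>(x, xs). x # xs) (pair_pmf p (replicate_pmf m p))"
    by (simp add: pair_pmf_def map_bind_pmf bind_assoc_pmf bind_return_pmf)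
  moreover have "pmf \<dots> ((\<lambda>(x, xs). x # xs) (y, ys)) = pmf (pair_pmf p (replicate_pmf m p)) (y, ys)"
    by (rule pmf_map_inj') (auto simp: inj_on_def)
  ultimately show ?case using Suc.IH[of ys] xs by (simp add: pmf_pair)
qed simp

text \<open>A repetition-free multiset of size \<open>m\<close> arises from \<open>fact m\<close>
  lists, each of probability \<open>\<beta> ^ m\<close>. This serves for the vertices of an edge and
  again for the edges of a hypergraph.\<close>

lemma pmf_mset_replicate_pmf:
  assumes "size M = m" and "\<And>x. count M x \<le> 1" and "\<And>x. x \<in># M \<Longrightarrow> pmf p x = \<beta>"
  shows "pmf (map_pmf mset (replicate_pmf m p)) M = fact m * \<beta> ^ m"
proof -
  have "pmf (map_pmf mset (replicate_pmf m p)) M = measure_pmf.prob (replicate_pmf m p) (permutations_of_multiset M)"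
    by (simp add: pmf_map permutations_of_multiset_def vimage_def)
  also have "\<dots> = (\<Sum>xs\<in>permutations_of_multiset M. pmf (replicate_pmf m p) xs)"
    by (simp add: measure_measure_pmf_finite)
  also have "\<dots> = (\<Sum>xs\<in>permutations_of_multiset M. \<beta> ^ m)"
  proof (rule sum.cong)
    fix xs assume "xs \<in> permutations_of_multiset M"
    then have xs: "mset xs = M" by (simp add: permutations_of_multiset_def)
    then have "length xs = m" using assms(1) by (metis size_mset)
    moreover have "map (pmf p) xs = map (\<lambda>_. \<beta>) xs"
      using assms(3) xs by (auto)
    ultimately show "pmf (replicate_pmf m p) xs = \<beta> ^ m"
      by (simp add: pmf_replicate_pmf map_replicate_const)
  qed simp
  also have "card (permutations_of_multiset M) = fact m"
  proof -
    have "(\<Prod>x\<in>set_mset M. fact (count M x)) = (1 :: nat)"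
    proof (rule prod.neutral, intro ballI)
      fix x show "fact (count M x) = (1 :: nat)"
        using assms(2)[of x] by (cases "count M x") auto
    qed
    then show ?thesis using card_permutations_of_multiset(1)[of M] assms(1) by simp
  qed
  then have "(\<Sum>xs\<in>permutations_of_multiset M. \<beta> ^ m) = fact m * \<beta> ^ m" by simp
  finally show ?thesis .
qed

subsection \<open>The surplus of a vertex set\<close>

definition hits :: "'a set \<Rightarrow> 'a multiset \<Rightarrow> nat" where
  "hits S e = size (filter_mset (\<lambda>v. v \<in> S) e)"

text \<open>The subtraction inside \<open>int\<close> is that of natural numbers and supplies the
  truncation at 0; the outer one is on integers since the value may be negative.\<close>

definition surplus :: "nat \<Rightarrow> nat \<Rightarrow> nat \<Rightarrow> 'a multiset multiset \<Rightarrow> 'a set \<Rightarrow> int" where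
  "surplus h w k E S = (\<Sum>e\<in>#E. int (hits S e - (h - w))) - int k * int (card S)"

definition uniform_on :: "nat \<Rightarrow> 'a set \<Rightarrow> 'a multiset multiset \<Rightarrow> bool" where
  "uniform_on h V E \<longleftrightarrow> (\<forall>e\<in>#E. size e = h \<and> set_mset e \<subseteq> V)"

text \<open>Incidences with \<open>U\<close>, counted with multiplicity, minus the number of edges
  meeting \<open>U\<close>. For nonempty \<open>U\<close>, a bipartite incidence graph that is a
  forest would give a value below \<open>card U\<close>, so \<open>card U \<le> excess E U\<close>
  forces cycles.\<close>

definition excess :: "'a multiset multiset \<Rightarrow> 'a set \<Rightarrow> nat" where
  "excess E U = (\<Sum>e\<in>#E. hits U e - 1)"

text \<open>What peeling leaves once the remaining vertex set is \<open>W\<close>, written without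
  reference to the order of deletions.\<close>

definition restrict_edges :: "nat \<Rightarrow> nat \<Rightarrow> 'a multiset multiset \<Rightarrow> 'a set \<Rightarrow> 'a multiset multiset" where
  "restrict_edges h w E W =
    image_mset (filter_mset (\<lambda>v. v \<in> W)) (filter_mset (\<lambda>e. h - w < hits W e) E)"

lemma hits_empty [simp]: "hits {} e = 0"
  by (simp add: hits_def)

lemma hits_mono: "S \<subseteq> T \<Longrightarrow> hits S e \<le> hits T e"
  unfolding hits_def by (induction e) auto

lemma hits_le_size: "hits S e \<le> size e"
  by (simp add: hits_def size_filter_mset_lesseq)

lemma hits_union_disjoint: "S \<inter> T = {} \<Longrightarrow> hits (S \<union> T) e = hits S e + hits T e"
  unfolding hits_def by (induction e) auto

lemma hits_Diff_singleton: "v \<in> S \<Longrightarrow> hits S e = hits (S - {v}) e + count e v"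
  unfolding hits_def by (induction e) auto

lemma hits_eq_size: "set_mset e \<subseteq> S \<Longrightarrow> hits S e = size e"
  unfolding hits_def by (induction e) auto

lemma hits_eq_sum_count: "finite S \<Longrightarrow> hits S e = (\<Sum>v\<in>S. count e v)"
  unfolding hits_def
proof (induction e)
  case (add x e)
  have "(\<Sum>v\<in>S. count (add_mset x e) v) = (\<Sum>v\<in>S. count e v + (if v = x then 1 else 0))"
    by (intro sum.cong) auto
  with add show ?case by (simp add: sum.distrib)
qed simp

lemma int_sum_mset: "int (\<Sum>e\<in>#E. f e) = (\<Sum>e\<in>#E. int (f e))"
  by (induction E) auto

lemma surplus_empty [simp]: "surplus h w k E {} = 0"
  by (simp add: surplus_def)

section \<open>Peeling in terms of vertex sets\<close>

lemma vdegree_restrict_edges: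
  "v \<in> W \<Longrightarrow> vdegree \<lparr>verts = W, edges = restrict_edges h w E W\<rparr> v =
    (\<Sum>e\<in>#E. if h - w < hits W e then count e v else 0)"
  unfolding vdegree_def restrict_edges_def by (induction E) auto

text \<open>Traces on shrinking vertex sets only get smaller, so an edge dropped at \<open>W\<close>
  would also be dropped at \<open>W - {v}\<close>, and restricting in two stages equals restricting
  once. Peeling thus stays within hypergraphs of this form.\<close>

lemma edges_delete_vertex_restrict_edges:
  "edges (delete_vertex h w v \<lparr>verts = W, edges = restrict_edges h w E W\<rparr>) = restrict_edges h w E (W - {v})"
proof (induction E)
  case empty
  show ?case by (simp add: edges_delete_vertex restrict_edges_def)
next
  case (add e E)
  have ff: "filter_mset (\<lambda>u. u \<noteq> v) (filter_mset (\<lambda>u. u \<in> W) e) = filter_mset (\<lambda>u. u \<in> W - {v}) e"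
    by (simp add: filter_filter_mset conj_commute)
  have le: "hits (W - {v}) e \<le> hits W e" by (rule hits_mono) auto
  have eq: "filter_mset (\<lambda>u. u \<in> W) e = filter_mset (\<lambda>u. u \<in> W - {v}) e" if "v \<notin># filter_mset (\<lambda>u. u \<in> W) e"
    using that by (intro filter_mset_cong) auto
  have heq: "hits W e = hits (W - {v}) e" if "v \<notin># filter_mset (\<lambda>u. u \<in> W) e"
    using eq[OF that] by (simp add: hits_def)
  show ?case
  proof (cases "v \<in># filter_mset (\<lambda>u. u \<in> W) e")
    case True
    then show ?thesis
      using add le ff by (auto simp: edges_delete_vertex restrict_edges_def hits_def)
  next
    case False
    then show ?thesis
      using add heq[OF False] eq[OF False] by (auto simp: edges_delete_vertex restrict_edges_def)
  qed
qed

text \<open>An edge whose contribution falls when \<open>v\<close> leaves \<open>T\<close> has more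
  than \<open>h - w\<close> vertices in \<open>T\<close>, hence in \<open>W\<close>, so it is
  counted in the degree of \<open>v\<close>. The total loss is at most this degree, hence at most
  \<open>k\<close>, and one vertex fewer gives \<open>k\<close> back.\<close>

lemma surplus_remove_light:
  assumes "finite T" "T \<subseteq> W" "v \<in> W"
    and "(\<Sum>e\<in>#E. if h - w < hits W e then count e v else 0) \<le> k"
  shows "surplus h w k E T \<le> surplus h w k E (T - {v})"
proof (cases "v \<in> T")
  case True
  have "(\<Sum>e\<in>#E. int (hits T e - (h - w))) \<le>
      (\<Sum>e\<in>#E. int (hits (T - {v}) e - (h - w)) + int (if h - w < hits W e then count e v else 0))"
  proof (rule sum_mset_mono)
    fix e
    show "int (hits T e - (h - w)) \<le>
        int (hits (T - {v}) e - (h - w)) + int (if h - w < hits W e then count e v else 0)"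
      using hits_Diff_singleton[OF True, of e] hits_mono[OF assms(2), of e] by auto
  qed
  also have "\<dots> = (\<Sum>e\<in>#E. int (hits (T - {v}) e - (h - w))) +
      int (\<Sum>e\<in>#E. if h - w < hits W e then count e v else 0)"
    by (simp add: sum_mset.distrib int_sum_mset del: of_nat_diff of_nat_sum_mset)
  also have "\<dots> \<le> (\<Sum>e\<in>#E. int (hits (T - {v}) e - (h - w))) + int k"
    using assms(4) by (intro add_left_mono) (simp only: of_nat_le_iff)
  finally have "(\<Sum>e\<in>#E. int (hits T e - (h - w))) \<le> (\<Sum>e\<in>#E. int (hits (T - {v}) e - (h - w))) + int k" .
  moreover have "int (card T) = int (card (T - {v})) + 1"
    using card_Suc_Diff1[OF assms(1) True] by linarith
  ultimately show ?thesis by (simp add: surplus_def algebra_simps)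
qed simp

text \<open>Gathers the facts about the core used below, so that later arguments speak only of
  vertex sets and never of peeling sequences.\<close>

definition core_set :: "nat \<Rightarrow> nat \<Rightarrow> nat \<Rightarrow> 'a set \<Rightarrow> 'a multiset multiset \<Rightarrow> 'a set \<Rightarrow> bool" where
  "core_set h w k V E W \<longleftrightarrow>
    core h w k \<lparr>verts = V, edges = E\<rparr> = \<lparr>verts = W, edges = restrict_edges h w E W\<rparr> \<and> W \<subseteq> V \<and>
    (\<forall>S\<subseteq>V. surplus h w k E S \<le> surplus h w k E (S \<inter> W)) \<and>
    (\<forall>v\<in>W. k < (\<Sum>e\<in>#E. if h - w < hits W e then count e v else 0))"

lemma core_set_exists:
  assumes fin: "finite V" and unif: "uniform_on h V E" and "0 < w" "w < h"
  shows "\<exists>W. core_set h w k V E W"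
proof -
  let ?H = "\<lparr>verts = V, edges = E\<rparr>"
  \<comment> \<open>An invariant of peeling: the current hypergraph is the restriction to its vertex
    set, and no surplus has been lost so far.\<close>
  define I where "I = (\<lambda>H. verts H \<subseteq> V \<and> H = \<lparr>verts = verts H, edges = restrict_edges h w E (verts H)\<rparr> \<and>
      (\<forall>S\<subseteq>V. surplus h w k E S \<le> surplus h w k E (S \<inter> verts H)))"
  have "I ?H"
  proof -
    have hV: "hits V e = h" "filter_mset (\<lambda>v. v \<in> V) e = e" if "e \<in># E" for e
      using that unif by (auto simp: uniform_on_def hits_eq_size filter_mset_eq_conv)
    have "filter_mset (\<lambda>e. h - w < hits V e) E = E"
      using hV(1) \<open>0 < w\<close> \<open>w < h\<close> by (auto simp: filter_mset_eq_conv)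
    moreover have "image_mset (filter_mset (\<lambda>v. v \<in> V)) E = image_mset (\<lambda>e. e) E"
      using hV(2) by (intro image_mset_cong) auto
    ultimately have "restrict_edges h w E V = E"
      by (simp add: restrict_edges_def)
    then show ?thesis by (auto simp: I_def Int_absorb2)
  qed
  have step: "I H'" if "I H" "peel_step h w k H H'" for H H'
  proof -
    from that(2) obtain v where v: "light k H v" and H': "H' = delete_vertex h w v H"
      by (auto simp: peel_step_def)
    define W where "W = verts H"
    have H: "H = \<lparr>verts = W, edges = restrict_edges h w E W\<rparr>" and "W \<subseteq> V" using that(1) by (simp_all add: I_def W_def)
    have H'2: "H' = \<lparr>verts = W - {v}, edges = restrict_edges h w E (W - {v})\<rparr>"
      unfolding H' H by (rule multihypergraph.equality) (auto simp: edges_delete_vertex_restrict_edges)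
    have "v \<in> W" using v by (simp add: light_def W_def)
    moreover have "(\<Sum>e\<in>#E. if h - w < hits W e then count e v else 0) \<le> k"
      using v \<open>v \<in> W\<close> vdegree_restrict_edges[of v W h w E] by (simp add: light_def flip: H)
    ultimately have "surplus h w k E (S \<inter> W) \<le> surplus h w k E (S \<inter> W - {v})" if "S \<subseteq> V" for S
      using that fin by (intro surplus_remove_light[of _ W]) (auto intro: finite_subset)
    moreover have "S \<inter> W - {v} = S \<inter> (W - {v})" for S by blast
    moreover have "surplus h w k E S \<le> surplus h w k E (S \<inter> W)" if "S \<subseteq> V" for S
      using \<open>I H\<close> that by (simp add: I_def W_def)
    ultimately have "surplus h w k E S \<le> surplus h w k E (S \<inter> (W - {v}))" if "S \<subseteq> V" for S
      using order_trans that by metis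
    then show ?thesis
      using \<open>W \<subseteq> V\<close> unfolding I_def H'2 by auto
  qed
  have "is_core h w k ?H (core h w k ?H)"
    unfolding core_def by (rule theI') (use is_core_ex1[of ?H] fin in simp)
  then have reach: "(peel_step h w k)\<^sup>*\<^sup>* ?H (core h w k ?H)" and nl: "\<nexists>v. light k (core h w k ?H) v"
    by (simp_all add: is_core_def)
  from reach have I: "I (core h w k ?H)"
    by (induction rule: rtranclp_induct) (use \<open>I ?H\<close> step in auto)
  define W where "W = verts (core h w k ?H)"
  show ?thesis
    unfolding core_set_def
  proof (intro exI conjI)
    show eq: "core h w k ?H = \<lparr>verts = W, edges = restrict_edges h w E W\<rparr>"
      using I by (simp add: I_def W_def)
    show "W \<subseteq> V" and "\<forall>S\<subseteq>V. surplus h w k E S \<le> surplus h w k E (S \<inter> W)"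
      using I by (simp_all add: I_def W_def)
    show "\<forall>v\<in>W. k < (\<Sum>e\<in>#E. if h - w < hits W e then count e v else 0)"
    proof
      fix v assume "v \<in> W"
      then show "k < (\<Sum>e\<in>#E. if h - w < hits W e then count e v else 0)"
        using nl vdegree_restrict_edges[of v W h w E] unfolding eq light_def by auto
    qed
  qed
qed

text \<open>An edge of size \<open>s\<close> is counted only at \<open>j = h - s\<close>, where its
  weight \<open>w - j\<close> equals \<open>s - (h - w)\<close>.\<close>

lemma sum_w_density:
  assumes "\<forall>e\<in>#D. h - w < size e \<and> size e \<le> h" and "w < h"
  shows "(\<Sum>j<w. real (w - j) * real (size {#e \<in># D. size e = h - j#})) = (\<Sum>e\<in>#D. real (size e - (h - w)))"
  using assms(1)
proof (induction D)
  case (add e D)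
  have j: "size e = h - j \<longleftrightarrow> j = h - size e" if "j < w" for j
    using add.prems that \<open>w < h\<close> by auto
  have "(\<Sum>j<w. real (w - j) * real (size {#e' \<in># add_mset e D. size e' = h - j#})) =
      (\<Sum>j<w. real (w - j) * real (size {#e' \<in># D. size e' = h - j#}) + (if j = h - size e then real (w - j) else 0))"
    using j by (intro sum.cong) (auto simp: algebra_simps)
  also have "\<dots> = (\<Sum>e\<in>#D. real (size e - (h - w))) + real (w - (h - size e))"
    using add by (auto simp: sum.distrib)
  also have "w - (h - size e) = size e - (h - w)"
    using add.prems \<open>w < h\<close> by auto
  finally show ?case by simp
qed simp

lemma sum_mset_restrict_edges:
  "(\<Sum>e\<in>#restrict_edges h w E W. real (size e - (h - w))) = (\<Sum>e\<in>#E. real (hits W e - (h - w)))"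
  unfolding restrict_edges_def by (induction E) (auto simp flip: hits_def)

text \<open>By the two preceding identities the numerator of the density is the sum of truncated
  hits of \<open>W\<close>; clearing the denominator gives the surplus. For empty \<open>W\<close>
  both sides hold: the density is 0 by convention and so is the surplus.\<close>

lemma property_T_iff_surplus:
  assumes fin: "finite V" and unif: "uniform_on h V E" and "w < h"
    and core: "core h w k \<lparr>verts = V, edges = E\<rparr> = \<lparr>verts = W, edges = restrict_edges h w E W\<rparr>"
    and "W \<subseteq> V"
  shows "property_T h w k \<lparr>verts = V, edges = E\<rparr> \<longleftrightarrow> surplus h w k E W \<le> 0"
proof (cases "W = {}")
  case True
  then show ?thesis by (simp add: property_T_def core w_density_def)
next
  case False
  then have pos: "card W > 0" using fin \<open>W \<subseteq> V\<close> by (simp add: card_gt_0_iff finite_subset)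
  have "\<forall>e\<in>#restrict_edges h w E W. h - w < size e \<and> size e \<le> h"
    using unif hits_le_size[of W] by (auto simp: restrict_edges_def uniform_on_def simp flip: hits_def)
  from sum_w_density[OF this \<open>w < h\<close>]
  have "w_density h w \<lparr>verts = W, edges = restrict_edges h w E W\<rparr> =
      (\<Sum>e\<in>#E. real (hits W e - (h - w))) / real (card W)"
    using False by (simp add: w_density_def sum_mset_restrict_edges del: of_nat_diff)
  also have "(\<Sum>e\<in>#E. real (hits W e - (h - w))) = real_of_int (\<Sum>e\<in>#E. int (hits W e - (h - w)))"
    by (induction E) auto
  finally have "property_T h w k \<lparr>verts = V, edges = E\<rparr> \<longleftrightarrow>
      real_of_int (\<Sum>e\<in>#E. int (hits W e - (h - w))) \<le> real k * real (card W)"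
    using pos by (simp add: property_T_def core divide_le_eq)
  also have "\<dots> \<longleftrightarrow> (\<Sum>e\<in>#E. int (hits W e - (h - w))) \<le> int k * int (card W)"
    unfolding of_int_of_nat_eq[symmetric, where 'a = real] of_int_mult[symmetric] of_int_le_iff ..
  finally show ?thesis by (simp add: surplus_def del: of_nat_diff)
qed

section \<open>The maximal surplus\<close>

definition top_surplus :: "nat \<Rightarrow> nat \<Rightarrow> nat \<Rightarrow> 'a set \<Rightarrow> 'a multiset multiset \<Rightarrow> int" where
  "top_surplus h w k V E = Max (surplus h w k E ` Pow V)"

lemma surplus_le_top: "finite V \<Longrightarrow> S \<subseteq> V \<Longrightarrow> surplus h w k E S \<le> top_surplus h w k V E"
  unfolding top_surplus_def by (rule Max_ge) auto

lemma top_surplus_attained: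
  assumes "finite V"
  obtains S where "S \<subseteq> V" "surplus h w k E S = top_surplus h w k V E"
proof -
  have "top_surplus h w k V E \<in> surplus h w k E ` Pow V"
    unfolding top_surplus_def using assms by (intro Max_in) auto
  with that show thesis by auto
qed

lemma surplus_union: "surplus h w k (E + F) S = surplus h w k E S + (\<Sum>e\<in>#F. int (hits S e - (h - w)))"
  by (simp add: surplus_def)

lemma top_surplus_mono:
  assumes "finite V"
  shows "top_surplus h w k V E \<le> top_surplus h w k V (E + F)"
proof -
  obtain S where S: "S \<subseteq> V" "surplus h w k E S = top_surplus h w k V E"
    using top_surplus_attained[OF assms] by blast
  have "0 \<le> (\<Sum>e\<in>#F. int (hits S e - (h - w)))"
    by (induction F) auto
  with surplus_le_top[OF assms S(1), of h w k "E + F"] S(2) show ?thesis by (simp add: surplus_union)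
qed

lemma top_surplus_add_le:
  assumes "finite V" "w < h" "size e = h"
  shows "top_surplus h w k V (add_mset e E) \<le> top_surplus h w k V E + int w"
proof -
  obtain S where S: "S \<subseteq> V" "surplus h w k (add_mset e E) S = top_surplus h w k V (add_mset e E)"
    using top_surplus_attained[OF assms(1)] by blast
  have "surplus h w k (add_mset e E) S \<le> surplus h w k E S + int w"
    using assms hits_le_size[of S e] by (auto simp: surplus_def)
  with surplus_le_top[OF assms(1) S(1), of h w k E] S(2) show ?thesis by simp
qed

text \<open>Both values lie between that of \<open>E\<close> and that of \<open>E\<close> plus
  \<open>w\<close>. This is the bounded difference fed into the variance estimate.\<close>

lemma top_surplus_exchange:
  assumes "finite V" "w < h" "size a = h" "size b = h"
  shows "\<bar>top_surplus h w k V (add_mset a E) - top_surplus h w k V (add_mset b E)\<bar> \<le> int w"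
  using top_surplus_add_le[OF assms(1,2,3), of k E] top_surplus_add_le[OF assms(1,2,4), of k E]
    top_surplus_mono[OF assms(1), of h w k E "{#a#}"] top_surplus_mono[OF assms(1), of h w k E "{#b#}"]
  by simp

text \<open>The core is itself a candidate in the maximum. As the empty set has surplus 0, the
  hypothesis says that the maximum is exactly 0.\<close>

lemma property_T_if_top_le_0:
  assumes "finite V" "uniform_on h V E" "0 < w" "w < h" "top_surplus h w k V E \<le> 0"
  shows "property_T h w k \<lparr>verts = V, edges = E\<rparr>"
proof -
  obtain W where "core_set h w k V E W"
    using core_set_exists[OF assms(1-4)] by blast
  then have W: "core h w k \<lparr>verts = V, edges = E\<rparr> = \<lparr>verts = W, edges = restrict_edges h w E W\<rparr>" "W \<subseteq> V"
    and up: "\<And>S. S \<subseteq> V \<Longrightarrow> surplus h w k E S \<le> surplus h w k E (S \<inter> W)"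
    unfolding core_set_def by simp_all
  show ?thesis
    using property_T_iff_surplus[OF assms(1,2,4) W] surplus_le_top[OF assms(1) W(2), of h w k E] assms(5) by simp
qed

lemma surplus_whole:
  assumes "uniform_on h V E" "w < h"
  shows "surplus h w k E V = int w * int (size E) - int k * int (card V)"
proof -
  have "(\<Sum>e\<in>#E. int (hits V e - (h - w))) = (\<Sum>e\<in>#E. int w)"
    using assms by (intro arg_cong[of _ _ sum_mset] image_mset_cong) (auto simp: uniform_on_def hits_eq_size)
  then show ?thesis by (simp add: surplus_def)
qed

text \<open>The full vertex set has positive surplus and peeling does not lower it. This settles the
  range \<open>k * n < w * m\<close> deterministically.\<close>

lemma not_property_T_if_many_edges:
  assumes "finite V" "uniform_on h V E" "0 < w" "w < h" "k * card V < w * size E"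
  shows "\<not> property_T h w k \<lparr>verts = V, edges = E\<rparr>"
proof -
  obtain W where "core_set h w k V E W"
    using core_set_exists[OF assms(1-4)] by blast
  then have W: "core h w k \<lparr>verts = V, edges = E\<rparr> = \<lparr>verts = W, edges = restrict_edges h w E W\<rparr>" "W \<subseteq> V"
    and up: "\<And>S. S \<subseteq> V \<Longrightarrow> surplus h w k E S \<le> surplus h w k E (S \<inter> W)"
    unfolding core_set_def by simp_all
  have "0 < surplus h w k E V"
    using assms(5) unfolding surplus_whole[OF assms(2,4)]
    by (simp flip: of_nat_mult)
  then show ?thesis
    using property_T_iff_surplus[OF assms(1,2,4) W(1,2)] W(2) up[of V] by (simp add: Int_absorb1)
qed

section \<open>Overshooting the densest set\<close>

lemma excess_insert_gt:
  assumes "e \<in># E" "0 < hits U e" "v \<in># e" "v \<notin> U"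
  shows "excess E U < excess E (insert v U)"
proof -
  from assms(1) obtain E' where E: "E = add_mset e E'" by (metis multi_member_split)
  have "excess E' U \<le> excess E' (insert v U)"
    unfolding excess_def by (intro sum_mset_mono diff_le_mono hits_mono) auto
  moreover have "hits U e - 1 < hits (insert v U) e - 1"
  proof -
    have "hits (insert v U) e = hits U e + count e v"
      using hits_Diff_singleton[of v "insert v U" e] assms(4) by simp
    moreover have "0 < count e v" using assms(3) by simp
    ultimately show ?thesis using assms(2) by arith
  qed
  ultimately show ?thesis by (simp add: E excess_def)
qed

text \<open>If peeling overshoots the densest set \<open>S\<close>, the overshoot can be enlarged to a union \<open>U\<close> of
  components of the hypergraph induced outside \<open>S\<close>; maximality of the surplus of \<open>S\<close> then bounds
  the number of edges meeting \<open>U\<close>, while the minimum degree of the core forces cycles inside \<open>U\<close>.\<close>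

lemma property_T_overshoot:
  assumes fin: "finite V" and unif: "uniform_on h V E" and w: "0 < w" "w < h"
    and T: "property_T h w k \<lparr>verts = V, edges = E\<rparr>" and pos: "0 < top_surplus h w k V E"
  obtains S U where "S \<subseteq> V" "0 < surplus h w k E S" "U \<subseteq> V - S"
    "top_surplus h w k V E \<le> int k * int (card U)"
    "size (filter_mset (\<lambda>e. 0 < hits U e) E) \<le> k * card U" "card U \<le> excess E U"
proof -
  obtain W where "core_set h w k V E W"
    using core_set_exists[OF fin unif w] by blast
  then have core: "core h w k \<lparr>verts = V, edges = E\<rparr> = \<lparr>verts = W, edges = restrict_edges h w E W\<rparr>"
    and WV: "W \<subseteq> V" and up: "\<And>S. S \<subseteq> V \<Longrightarrow> surplus h w k E S \<le> surplus h w k E (S \<inter> W)"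
    and deg: "\<And>v. v \<in> W \<Longrightarrow> k < (\<Sum>e\<in>#E. if h - w < hits W e then count e v else 0)"
    unfolding core_set_def by simp_all
  have W0: "surplus h w k E W \<le> 0"
    using T property_T_iff_surplus[OF fin unif w(2) core WV] by simp
  obtain S0 where S0: "S0 \<subseteq> V" "surplus h w k E S0 = top_surplus h w k V E"
    using top_surplus_attained[OF fin] by blast
  \<comment> \<open>Cutting a maximizer down to the core loses no surplus, so there is a maximizer
    inside the core.\<close>
  define S where "S = S0 \<inter> W"
  have SW: "S \<subseteq> W" and SV: "S \<subseteq> V" using WV by (auto simp: S_def)
  have Stop: "surplus h w k E S = top_surplus h w k V E"
    using up[OF S0(1)] S0(2) surplus_le_top[OF fin SV, of h w k E] by (simp add: S_def)
  define Q where "Q = W - S"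
  have finS: "finite S" and finQ: "finite Q" using fin SV WV by (auto simp: Q_def intro: finite_subset)
  have W_eq: "W = S \<union> Q" and disj: "S \<inter> Q = {}" using SW by (auto simp: Q_def)
  have cardW: "int (card W) = int (card S) + int (card Q)"
    unfolding W_eq using finS finQ disj by (simp add: card_Un_disjoint)
  have hW: "hits W e = hits S e + hits Q e" for e
    unfolding W_eq by (rule hits_union_disjoint[OF disj])
  \<comment> \<open>Each vertex of the overshoot \<open>Q\<close> has core degree at least
    \<open>k + 1\<close>; exchanging the sums counts incidences of \<open>Q\<close> with the
    surviving edges.\<close>
  have "int (card Q) * (int k + 1) \<le> (\<Sum>v\<in>Q. int (\<Sum>e\<in>#E. if h - w < hits W e then count e v else 0))"
  proof -
    have "(\<Sum>v\<in>Q. int k + 1) \<le> (\<Sum>v\<in>Q. int (\<Sum>e\<in>#E. if h - w < hits W e then count e v else 0))"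
    proof (rule sum_mono)
      fix v assume "v \<in> Q"
      then have "v \<in> W" by (simp add: Q_def)
      from deg[OF this] show "int k + 1 \<le> int (\<Sum>e\<in>#E. if h - w < hits W e then count e v else 0)"
        by linarith
    qed
    then show ?thesis by simp
  qed
  also have "\<dots> = (\<Sum>e\<in>#E. int (if h - w < hits W e then hits Q e else 0))"
    by (induction E) (auto simp: sum.distrib hits_eq_sum_count[OF finQ])
  finally have degQ: "int (card Q) * (int k + 1) \<le> (\<Sum>e\<in>#E. int (if h - w < hits W e then hits Q e else 0))" .
  \<comment> \<open>If a surviving edge meets \<open>Q\<close>, at least one of its incidences with
    \<open>Q\<close> is matched by the gain in truncated hits from \<open>S\<close> to
    \<open>W\<close>, because \<open>hits W e > h - w\<close>; the unmatched ones number at most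
    \<open>hits Q e - 1\<close>. The total gain is below \<open>k * card Q\<close>, as
    \<open>S\<close> has positive surplus and \<open>W\<close> does not, so more than
    \<open>card Q\<close> excess incidences remain.\<close>
  have "(\<Sum>e\<in>#E. int (hits S e - (h - w)) + int (if h - w < hits W e then hits Q e else 0)) \<le>
      (\<Sum>e\<in>#E. int (hits W e - (h - w)) + int (hits Q e - 1))"
    by (rule sum_mset_mono) (auto simp: hW)
  then have "(\<Sum>e\<in>#E. int (hits S e - (h - w))) + (\<Sum>e\<in>#E. int (if h - w < hits W e then hits Q e else 0)) \<le>
      (\<Sum>e\<in>#E. int (hits W e - (h - w))) + int (excess E Q)"
    by (simp add: sum_mset.distrib excess_def int_sum_mset del: of_nat_diff of_nat_sum_mset)
  then have excQ: "int (card Q) < int (excess E Q)"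
    using degQ W0 pos Stop by (simp add: surplus_def cardW algebra_simps del: of_nat_diff)
  \<comment> \<open>Going from \<open>S\<close> to \<open>W\<close> costs at most \<open>k\<close>
    per added vertex, and the surplus drops by at least its whole maximum.\<close>
  have cardQ: "top_surplus h w k V E \<le> int k * int (card Q)"
  proof -
    have "(\<Sum>e\<in>#E. int (hits S e - (h - w))) \<le> (\<Sum>e\<in>#E. int (hits W e - (h - w)))"
      by (rule sum_mset_mono) (auto simp: hW)
    then show ?thesis using W0 Stop by (simp add: surplus_def cardW algebra_simps del: of_nat_diff)
  qed
  \<comment> \<open>Enlargements of \<open>Q\<close> avoiding \<open>S\<close> whose added vertices
    bring in total at least as many excess incidences. A maximal one is closed under edges, up to
    vertices of \<open>S\<close>: by \<open>excess_insert_gt\<close> any further vertex of an edge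
    meeting it could be added.\<close>
  define \<U> where "\<U> = {U. Q \<subseteq> U \<and> U \<subseteq> V - S \<and> excess E Q + card (U - Q) \<le> excess E U}"
  have "finite \<U>" using fin by (auto simp: \<U>_def intro: finite_subset[of _ "Pow V"])
  moreover have "Q \<in> \<U>" using WV by (auto simp: \<U>_def Q_def)
  ultimately obtain U where U: "U \<in> \<U>" and max: "\<And>U'. U' \<in> \<U> \<Longrightarrow> U \<subseteq> U' \<Longrightarrow> U = U'"
    using finite_has_maximal[of \<U>] by blast
  have QU: "Q \<subseteq> U" and UV: "U \<subseteq> V - S" and excU: "excess E Q + card (U - Q) \<le> excess E U"
    using U by (auto simp: \<U>_def)
  have finU: "finite U" using UV fin by (auto intro: finite_subset)
  have closed: "set_mset e \<subseteq> S \<union> U" if e: "e \<in># E" "0 < hits U e" for e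
  proof (rule ccontr)
    assume "\<not> set_mset e \<subseteq> S \<union> U"
    then obtain v where v: "v \<in># e" "v \<notin> S" "v \<notin> U" by blast
    have "v \<in> V" using e(1) v(1) unif by (auto simp: uniform_on_def)
    have "card (insert v U - Q) = Suc (card (U - Q))"
      using v(3) QU finU by (subst insert_Diff_if) auto
    with excess_insert_gt[OF e v(1,3)] excU QU UV v \<open>v \<in> V\<close> have "insert v U \<in> \<U>"
      by (auto simp: \<U>_def)
    from max[OF this] v(3) show False by blast
  qed
  \<comment> \<open>An edge meeting \<open>U\<close> lies entirely in \<open>S \<union> U\<close>,
    so it contributes \<open>w\<close> there but at most \<open>w - 1\<close> on \<open>S\<close>
    alone. Adding \<open>U\<close> to the maximizer cannot raise the surplus, which bounds the
    number of such edges by \<open>k * card U\<close>.\<close>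
  have "(\<Sum>e\<in>#E. int (hits S e - (h - w)) + (if 0 < hits U e then 1 else 0)) \<le>
      (\<Sum>e\<in>#E. int (hits (S \<union> U) e - (h - w)))"
  proof (rule sum_mset_mono)
    fix e assume e: "e \<in># E"
    have un: "hits (S \<union> U) e = hits S e + hits U e"
      using UV by (intro hits_union_disjoint) auto
    have "hits (S \<union> U) e = h" if "0 < hits U e"
      using hits_eq_size[OF closed[OF e that]] e unif by (simp add: uniform_on_def)
    with un show "int (hits S e - (h - w)) + (if 0 < hits U e then 1 else 0) \<le> int (hits (S \<union> U) e - (h - w))"
      using w by auto
  qed
  moreover have "(\<Sum>e\<in>#E. (if 0 < hits U e then 1 else 0)) = int (size (filter_mset (\<lambda>e. 0 < hits U e) E))"
    by (induction E) auto
  moreover have "surplus h w k E (S \<union> U) \<le> surplus h w k E S"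
    unfolding Stop using UV SV by (intro surplus_le_top fin) auto
  moreover have "int (card (S \<union> U)) = int (card S) + int (card U)"
    using finS finU UV by (subst card_Un_disjoint) auto
  ultimately have "int (size (filter_mset (\<lambda>e. 0 < hits U e) E)) \<le> int k * int (card U)"
    by (simp add: surplus_def sum_mset.distrib algebra_simps del: of_nat_diff)
  then have "size (filter_mset (\<lambda>e. 0 < hits U e) E) \<le> k * card U"
    by (simp flip: of_nat_mult)
  moreover have "card U = card Q + card (U - Q)"
    using card_Un_disjoint[of Q "U - Q"] finQ finU QU by (auto simp: Un_absorb1)
  then have "card U \<le> excess E U" using excQ excU by linarith
  moreover have "int k * int (card Q) \<le> int k * int (card U)"
    using card_mono[OF finU QU] by (intro mult_left_mono) auto
  ultimately show thesis using that[OF SV _ UV] cardQ Stop pos by auto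
qed

subsection \<open>A random edge\<close>

definition edge_pmf :: "nat \<Rightarrow> nat \<Rightarrow> nat multiset pmf" where
  "edge_pmf h n = map_pmf mset (replicate_pmf h (pmf_of_set {1..n}))"

lemma set_edge_pmf:
  assumes "1 \<le> n" "e \<in> set_pmf (edge_pmf h n)"
  shows "size e = h" "set_mset e \<subseteq> {1..n}"
  using assms by (auto simp: edge_pmf_def set_replicate_pmf lists_eq_set)

lemma finite_set_edge_pmf: "1 \<le> n \<Longrightarrow> finite (set_pmf (edge_pmf h n))"
  unfolding edge_pmf_def by (simp add: finite_set_replicate_pmf)

text \<open>\<open>hits S e\<close> is binomial with parameters \<open>h\<close> and
  \<open>card S / n\<close>, and this is its generating function. At \<open>y = 0\<close>, where
  \<open>0 ^ 0 = 1\<close>, it yields the probability of missing \<open>S\<close>.\<close>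

lemma expectation_edge_power_hits:
  fixes y :: real
  assumes "1 \<le> n" and S: "S \<subseteq> {1..n}"
  shows "measure_pmf.expectation (edge_pmf h n) (\<lambda>e. y ^ hits S e) =
    (1 - card S / n + card S / n * y) ^ h"
proof -
  have pow: "y ^ hits S (mset xs) = (\<Prod>v\<leftarrow>xs. if v \<in> S then y else 1)" for xs
    unfolding hits_def by (induction xs) auto
  have "(\<Sum>v\<in>{1..n}. if v \<in> S then y else 1) = real (n - card S) + real (card S) * y"
  proof -
    have fin: "finite S" using S finite_subset by blast
    have "(\<Sum>v\<in>{1..n}. if v \<in> S then y else 1) =
        (\<Sum>v\<in>{1..n} - S. if v \<in> S then y else 1) + (\<Sum>v\<in>S. if v \<in> S then y else 1)"
      using S by (intro sum.subset_diff) auto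
    also have "\<dots> = real (card ({1..n} - S)) + real (card S) * y" by simp
    finally show ?thesis using S fin by (simp add: card_Diff_subset)
  qed
  moreover have "card S \<le> n" using card_mono[OF _ S] by simp
  ultimately have "measure_pmf.expectation (pmf_of_set {1..n}) (\<lambda>v. if v \<in> S then y else 1) =
      1 - card S / n + card S / n * y"
    using assms(1) by (subst integral_pmf_of_set) (auto simp: field_simps of_nat_diff)
  then show ?thesis
    using assms(1) by (simp add: edge_pmf_def pow expectation_replicate_prod)
qed

lemma expectation_edge_hits:
  assumes "1 \<le> n" and S: "S \<subseteq> {1..n}"
  shows "measure_pmf.expectation (edge_pmf h n) (\<lambda>e. real (hits S e)) = h * (card S / n)"
proof -
  have hits: "real (hits S (mset xs)) = (\<Sum>v\<leftarrow>xs. if v \<in> S then 1 else 0)" for xs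
    unfolding hits_def by (induction xs) auto
  have "(\<Sum>v\<in>{1..n}. if v \<in> S then 1 else 0 :: real) = real (card S)"
    using S by (simp add: sum.If_cases Int_absorb1)
  then have "measure_pmf.expectation (pmf_of_set {1..n}) (\<lambda>v. if v \<in> S then 1 else 0) = card S / n"
    using assms(1) by (subst integral_pmf_of_set) auto
  then show ?thesis
    using assms(1) by (simp add: edge_pmf_def hits expectation_replicate_sum)
qed

text \<open>Lying inside \<open>S\<close> means missing the complement, so the generating function
  for the complement at 0 gives the value.\<close>

lemma prob_edge_inside:
  assumes "1 \<le> n" and S: "S \<subseteq> {1..n}"
  shows "measure_pmf.prob (edge_pmf h n) {e. hits S e = h} = (card S / n) ^ h"
proof -
  have c: "real (card ({1..n} - S)) = real n - real (card S)"
    using card_mono[OF _ S] finite_subset[OF S] S by (simp add: card_Diff_subset of_nat_diff)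
  have "measure_pmf.prob (edge_pmf h n) {e. hits S e = h} =
      measure_pmf.expectation (edge_pmf h n) (indicat_real {e. hits S e = h})" by simp
  also have "\<dots> = measure_pmf.expectation (edge_pmf h n) (\<lambda>e. 0 ^ hits ({1..n} - S) e)"
  proof (intro integral_cong_AE, goal_cases)
    case 3
    have "indicat_real {e. hits S e = h} e = 0 ^ hits ({1..n} - S) e" if "e \<in> set_pmf (edge_pmf h n)" for e
    proof -
      have "hits (S \<union> ({1..n} - S)) e = h"
        using set_edge_pmf[OF assms(1) that] S by (subst hits_eq_size) auto
      then have "hits S e + hits ({1..n} - S) e = h"
        by (subst (asm) hits_union_disjoint) auto
      then show ?thesis by (auto simp: indicator_def)
    qed
    then show ?case by (simp add: AE_measure_pmf_iff)
  qed auto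
  also have "\<dots> = (card S / n) ^ h"
  proof -
    have "1 - real (card ({1..n} - S)) / n + real (card ({1..n} - S)) / n * 0 = card S / n"
      using assms(1) c by (simp add: field_simps)
    then show ?thesis
      using expectation_edge_power_hits[OF assms(1), of "{1..n} - S" h 0] by simp
  qed
  finally show ?thesis .
qed

lemma prob_edge_miss:
  assumes "1 \<le> n" and S: "S \<subseteq> {1..n}"
  shows "measure_pmf.prob (edge_pmf h n) {e. hits S e = 0} = (1 - card S / n) ^ h"
proof -
  have "measure_pmf.prob (edge_pmf h n) {e. hits S e = 0} =
      measure_pmf.expectation (edge_pmf h n) (indicat_real {e. hits S e = 0})" by simp
  also have "\<dots> = measure_pmf.expectation (edge_pmf h n) (\<lambda>e. 0 ^ hits S e)"
    by (intro Bochner_Integration.integral_cong) (auto simp: indicator_def)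
  finally show ?thesis using expectation_edge_power_hits[OF assms, of h 0] by simp
qed

section \<open>Exponential weights for edges\<close>

lemma power_diff_le:
  fixes x y :: real
  assumes "0 \<le> y" "y \<le> x"
  shows "x ^ h - y ^ h \<le> h * (x - y) * x ^ (h - 1)"
proof (induction h)
  case (Suc h)
  have "x ^ Suc h - y ^ Suc h = x * (x ^ h - y ^ h) + (x - y) * y ^ h"
    by (simp add: algebra_simps)
  also have "\<dots> \<le> x * (h * (x - y) * x ^ (h - 1)) + (x - y) * x ^ h"
    using Suc assms by (intro add_mono mult_left_mono power_mono) auto
  also have "\<dots> = Suc h * (x - y) * x ^ (Suc h - 1)"
    by (cases h) (auto simp: algebra_simps)
  finally show ?case .
qed simp

lemma one_minus_power_le:
  fixes p :: real
  assumes "0 \<le> p" "p \<le> 1"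
  shows "(1 - p) ^ h \<le> 1 - h * p + (h * p)\<^sup>2"
proof (induction h)
  case (Suc h)
  have "(1 - p) ^ Suc h \<le> (1 - p) * (1 - h * p + (h * p)\<^sup>2)"
    using Suc assms by (simp add: mult_left_mono)
  also have "\<dots> = 1 - Suc h * p + ((h * p)\<^sup>2 + h * p\<^sup>2) - p * (h * p)\<^sup>2"
    by (simp add: algebra_simps power2_eq_square)
  also have "\<dots> \<le> 1 - Suc h * p + (Suc h * p)\<^sup>2"
    using assms by (simp add: algebra_simps power2_eq_square)
  finally show ?case .
qed simp

text \<open>Over a list of edges the product of these weights is \<open>t\<close> to the number of
  edges meeting \<open>U\<close> times \<open>y\<close> to the excess of \<open>U\<close>, so the
  two quantities are controlled separately.\<close>

definition tilt :: "real \<Rightarrow> real \<Rightarrow> 'a set \<Rightarrow> 'a multiset \<Rightarrow> real" where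
  "tilt t y U e = (if hits U e = 0 then 1 else t * y ^ (hits U e - 1))"

text \<open>With \<open>y = b / p\<close> the generating function at \<open>y\<close> has base
  \<open>1 - p + b\<close>, bounded however small \<open>U\<close> is, while the prefactor
  \<open>t / y\<close> leaves a term linear in \<open>p\<close>.\<close>

lemma expectation_tilt_le:
  fixes b t :: real
  assumes n: "1 \<le> n" and U: "U \<subseteq> {1..n}" "U \<noteq> {}" and "0 < b" "0 \<le> t"
  defines "p \<equiv> real (card U) / real n"
  shows "measure_pmf.expectation (edge_pmf h n) (tilt t (b / p) U) \<le>
    (1 - p) ^ h + t * p * h * (1 + b) ^ (h - 1)"
proof -
  have "card U > 0" using U finite_subset[OF U(1)] by (simp add: card_gt_0_iff)
  moreover have "card U \<le> n" using card_mono[OF _ U(1)] by simp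
  ultimately have p: "0 < p" "p \<le> 1" using n by (auto simp: p_def)
  define y where "y = b / p"
  have y: "0 < y" "p * y = b" using p \<open>0 < b\<close> by (auto simp: y_def)
  have tilt: "tilt t y U = (\<lambda>e. (1 - t / y) * 0 ^ hits U e + t / y * y ^ hits U e)"
  proof
    fix e show "tilt t y U e = (1 - t / y) * 0 ^ hits U e + t / y * y ^ hits U e"
      using y by (cases "hits U e") (auto simp: tilt_def)
  qed
  have "measure_pmf.expectation (edge_pmf h n) (tilt t y U) =
      (1 - t / y) * (1 - p) ^ h + t / y * (1 - p + b) ^ h"
    unfolding tilt expectation_add_finite[OF finite_set_edge_pmf[OF n]] integral_mult_right_zero
      expectation_edge_power_hits[OF n U(1)] p_def[symmetric] y(2) by simp
  also have "\<dots> = (1 - p) ^ h + t / y * ((1 - p + b) ^ h - (1 - p) ^ h)"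
    by (simp add: algebra_simps)
  also have "\<dots> \<le> (1 - p) ^ h + t / y * (h * b * (1 + b) ^ (h - 1))"
  proof (intro add_left_mono mult_left_mono)
    have "(1 - p + b) ^ h - (1 - p) ^ h \<le> h * b * (1 - p + b) ^ (h - 1)"
      using power_diff_le[of "1 - p" "1 - p + b" h] p \<open>0 < b\<close> by simp
    also have "\<dots> \<le> h * b * (1 + b) ^ (h - 1)"
      using p \<open>0 < b\<close> by (intro mult_left_mono power_mono) auto
    finally show "(1 - p + b) ^ h - (1 - p) ^ h \<le> h * b * (1 + b) ^ (h - 1)" .
  qed (use y \<open>0 \<le> t\<close> in auto)
  also have "t / y * (h * b * (1 + b) ^ (h - 1)) = t * p * h * (1 + b) ^ (h - 1)"
    using p \<open>0 < b\<close> by (simp add: y_def)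
  finally show ?thesis by (simp add: y_def)
qed

lemma prod_tilt:
  "(\<Prod>e\<leftarrow>es. tilt t y U e) =
    t ^ size (filter_mset (\<lambda>e. 0 < hits U e) (mset es)) * y ^ excess (mset es) U"
  by (induction es) (auto simp: tilt_def excess_def power_add)

text \<open>The exponential Markov inequality for a sum over independent samples, written
  multiplicatively.\<close>

lemma prob_le_expectation_power:
  fixes \<phi> :: "'a \<Rightarrow> real"
  assumes "finite (set_pmf p)" "\<And>x. 0 \<le> \<phi> x" "0 < T"
    and "\<And>xs. A xs \<Longrightarrow> T \<le> (\<Prod>x\<leftarrow>xs. \<phi> x)"
  shows "measure_pmf.prob (replicate_pmf m p) {xs. A xs} \<le> measure_pmf.expectation p \<phi> ^ m / T"
proof -
  have "measure_pmf.prob (replicate_pmf m p) {xs. A xs} \<le>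
      measure_pmf.expectation (replicate_pmf m p) (\<lambda>xs. (\<Prod>x\<leftarrow>xs. \<phi> x) / T)"
    using assms by (intro prob_le_expectation finite_set_replicate_pmf)
      (auto intro!: divide_nonneg_pos prod_list_nonneg)
  then show ?thesis using assms(1) by (simp add: expectation_replicate_prod)
qed

subsection \<open>First moments over vertex sets\<close>

text \<open>One term of the binomial expansion of
  \<open>(1 + s / n) ^ n \<le> exp s\<close>.\<close>

lemma binomial_le_exp:
  assumes "1 \<le> s"
  shows "real (n choose s) \<le> (exp 1 * n / s) ^ s"
proof (cases "n = 0")
  case True
  then show ?thesis using assms by (cases s) auto
next
  case False
  define x where "x = real s / real n"
  have x: "0 < x" using assms False by (simp add: x_def)
  have "real (n choose s) * x ^ s \<le> (1 + x) ^ n"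
  proof (cases "s \<le> n")
    case True
    have "real (n choose s) * x ^ s \<le> (\<Sum>k\<le>n. real (n choose k) * x ^ k)"
      using x True by (intro member_le_sum) auto
    also have "\<dots> = (1 + x) ^ n" using binomial_ring[of x 1 n] by (simp add: add.commute)
    finally show ?thesis .
  next
    case False
    then show ?thesis using x by (simp add: binomial_eq_0)
  qed
  also have "\<dots> \<le> exp x ^ n" using x by (intro power_mono exp_ge_add_one_self) auto
  also have "\<dots> = exp 1 ^ s"
    using False by (simp add: x_def flip: exp_of_nat_mult)
  finally have "real (n choose s) \<le> exp 1 ^ s / x ^ s" using x by (simp add: field_simps)
  then show ?thesis by (simp add: x_def power_divide power_mult_distrib)
qed

lemma prob_union_by_card:
  assumes V: "finite V" and A: "\<And>S. S \<subseteq> V \<Longrightarrow> R (card S) \<Longrightarrow> measure_pmf.prob p {x. A S x} \<le> B (card S)"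
  shows "measure_pmf.prob p {x. \<exists>S\<subseteq>V. R (card S) \<and> A S x} \<le>
    (\<Sum>s\<in>{s. s \<le> card V \<and> R s}. real (card V choose s) * B s)"
proof -
  define \<S> where "\<S> = {S. S \<subseteq> V \<and> R (card S)}"
  have fin: "finite \<S>" using V by (simp add: \<S>_def)
  have "measure_pmf.prob p {x. \<exists>S\<subseteq>V. R (card S) \<and> A S x} = measure_pmf.prob p (\<Union>S\<in>\<S>. {x. A S x})"
    by (intro arg_cong[of _ _ "measure_pmf.prob p"]) (auto simp: \<S>_def)
  also have "\<dots> \<le> (\<Sum>S\<in>\<S>. measure_pmf.prob p {x. A S x})"
    using fin by (intro measure_UNION_le) auto
  also have "\<dots> \<le> (\<Sum>S\<in>\<S>. B (card S))" using A by (intro sum_mono) (auto simp: \<S>_def)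
  also have "\<dots> = (\<Sum>s\<in>{s. s \<le> card V \<and> R s}. \<Sum>S\<in>{S\<in>\<S>. card S = s}. B (card S))"
    using fin V card_mono by (intro sum.group[symmetric]) (auto simp: \<S>_def)
  also have "\<dots> = (\<Sum>s\<in>{s. s \<le> card V \<and> R s}. real (card V choose s) * B s)"
  proof (intro sum.cong refl)
    fix s assume "s \<in> {s. s \<le> card V \<and> R s}"
    then have "{S\<in>\<S>. card S = s} = {S. S \<subseteq> V \<and> card S = s}" by (auto simp: \<S>_def)
    then show "(\<Sum>S\<in>{S\<in>\<S>. card S = s}. B (card S)) = real (card V choose s) * B s"
      using n_subsets[OF V, of s] by simp
  qed
  finally show ?thesis .
qed

lemma sum_real_over_power2_le: "(\<Sum>s\<le>N. real s / 2 ^ s) \<le> 2"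
proof -
  have "(\<Sum>s\<le>N. real s / 2 ^ s) = 2 - (real N + 2) / 2 ^ N"
    by (induction N) (auto simp: field_simps)
  then show ?thesis by simp
qed

text \<open>Union bound over the sets of each size. The allowance \<open>c * s / 2 ^ s\<close> sums
  to at most \<open>2 * c\<close>; its factor \<open>s\<close> suits a \<open>c\<close> of order
  \<open>1 / n\<close>, for which \<open>c * s\<close> is a fraction of the vertices.\<close>

lemma prob_union_le_inverse:
  assumes V: "finite V" and c: "0 \<le> c"
    and R: "\<And>s. R s \<Longrightarrow> 1 \<le> s \<and> 0 \<le> B s \<and> (exp 1 * card V / s * B s) ^ s \<le> c * real s / 2 ^ s"
    and A: "\<And>S. S \<subseteq> V \<Longrightarrow> R (card S) \<Longrightarrow> measure_pmf.prob p {x. A S x} \<le> B (card S) ^ card S"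
  shows "measure_pmf.prob p {x. \<exists>S\<subseteq>V. R (card S) \<and> A S x} \<le> 2 * c"
proof -
  have "measure_pmf.prob p {x. \<exists>S\<subseteq>V. R (card S) \<and> A S x} \<le>
      (\<Sum>s\<in>{s. s \<le> card V \<and> R s}. real (card V choose s) * B s ^ s)"
    using V A by (rule prob_union_by_card)
  also have "\<dots> \<le> (\<Sum>s\<in>{s. s \<le> card V \<and> R s}. c * (real s / 2 ^ s))"
  proof (rule sum_mono)
    fix s assume "s \<in> {s. s \<le> card V \<and> R s}"
    then have s: "1 \<le> s" "0 \<le> B s" "(exp 1 * card V / s * B s) ^ s \<le> c * real s / 2 ^ s" using R by auto
    have "real (card V choose s) * B s ^ s \<le> (exp 1 * card V / s) ^ s * B s ^ s"
      using s by (intro mult_right_mono binomial_le_exp) auto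
    also have "\<dots> = (exp 1 * card V / s * B s) ^ s" by (rule power_mult_distrib[symmetric])
    finally show "real (card V choose s) * B s ^ s \<le> c * (real s / 2 ^ s)" using s(3) by simp
  qed
  also have "\<dots> \<le> (\<Sum>s\<le>card V. c * (real s / 2 ^ s))"
    using c by (intro sum_mono2) auto
  also have "\<dots> \<le> c * 2"
    unfolding sum_distrib_left[symmetric] using c by (intro mult_left_mono sum_real_over_power2_le)
  finally show ?thesis by simp
qed

section \<open>Sets of positive surplus\<close>

lemma surplus_pos_excess:
  assumes "w < h" "0 < surplus h w k E S"
  shows "k * card S \<le> excess E S"
proof -
  have "(\<Sum>e\<in>#E. int (hits S e - (h - w))) \<le> (\<Sum>e\<in>#E. int (hits S e - 1))"
    using assms(1) by (intro sum_mset_mono) auto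
  also have "\<dots> = int (excess E S)" by (simp add: excess_def int_sum_mset del: of_nat_sum_mset)
  finally have "int (k * card S) \<le> int (excess E S)" using assms(2) by (simp add: surplus_def)
  then show ?thesis by (simp only: of_nat_le_iff)
qed

text \<open>Positive surplus forces \<open>k * card S\<close> excess incidences, each weighted here
  by the inverse density \<open>n / card S\<close>. The resulting base is small only where the
  density is small.\<close>

lemma prob_small_set_dense:
  assumes n: "1 \<le> n" and S: "S \<subseteq> {1..n}" "S \<noteq> {}" and w: "0 < w" "w < h" and m: "w * m \<le> k * n"
  shows "measure_pmf.prob (replicate_pmf m (edge_pmf h n)) {es. 0 < surplus h w k (mset es) S} \<le>
    ((exp (h * 2 ^ (h - 1) / w) * (card S / n)) ^ k) ^ card S"
proof -
  define \<sigma> where "\<sigma> = real (card S) / real n"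
  have "card S > 0" using S finite_subset[OF S(1)] by (simp add: card_gt_0_iff)
  moreover have "card S \<le> n" using card_mono[OF _ S(1)] by simp
  ultimately have \<sigma>: "0 < \<sigma>" "\<sigma> \<le> 1" using n by (auto simp: \<sigma>_def)
  have "measure_pmf.prob (replicate_pmf m (edge_pmf h n)) {es. 0 < surplus h w k (mset es) S} \<le>
      measure_pmf.expectation (edge_pmf h n) (tilt 1 (1 / \<sigma>) S) ^ m / (1 / \<sigma>) ^ (k * card S)"
  proof (rule prob_le_expectation_power)
    fix es assume "0 < surplus h w k (mset es) S"
    with surplus_pos_excess[OF w(2)] have "k * card S \<le> excess (mset es) S" .
    then show "(1 / \<sigma>) ^ (k * card S) \<le> (\<Prod>e\<leftarrow>es. tilt 1 (1 / \<sigma>) S e)"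
      unfolding prod_tilt using \<sigma> by (auto intro!: power_increasing)
  qed (use n \<sigma> in \<open>auto simp: finite_set_edge_pmf tilt_def\<close>)
  also have "\<dots> \<le> exp (k * card S * (h * 2 ^ (h - 1) / w)) / (1 / \<sigma>) ^ (k * card S)"
  proof (rule divide_right_mono)
    define z where "z = \<sigma> * (h * 2 ^ (h - 1))"
    have "(1 - \<sigma>) ^ h \<le> 1" using \<sigma> by (intro power_le_one) auto
    then have "measure_pmf.expectation (edge_pmf h n) (tilt 1 (1 / \<sigma>) S) \<le> 1 + z"
      using expectation_tilt_le[OF n S, of 1 1 h] unfolding \<sigma>_def z_def by simp
    also have "\<dots> \<le> exp z" by (rule exp_ge_add_one_self)
    finally have "measure_pmf.expectation (edge_pmf h n) (tilt 1 (1 / \<sigma>) S) ^ m \<le> exp z ^ m"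
      using \<sigma> by (intro power_mono integral_nonneg) (auto simp: tilt_def)
    also have "\<dots> = exp (m * \<sigma> * (h * 2 ^ (h - 1)))" by (simp add: z_def flip: exp_of_nat_mult)
    also have "m * \<sigma> \<le> k * card S / w"
    proof -
      have "real w * real m \<le> real k * real n" using m by (metis of_nat_le_iff of_nat_mult)
      then have "real m \<le> k * n / w" using w by (simp add: field_simps)
      from mult_right_mono[OF this, of \<sigma>] \<sigma> show ?thesis using n by (simp add: \<sigma>_def)
    qed
    then have "exp (m * \<sigma> * (h * 2 ^ (h - 1))) \<le> exp (k * card S / w * (h * 2 ^ (h - 1)))"
      by (intro exp_le_cancel_iff[THEN iffD2] mult_right_mono) auto
    finally show "measure_pmf.expectation (edge_pmf h n) (tilt 1 (1 / \<sigma>) S) ^ m \<le>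
        exp (k * card S * (h * 2 ^ (h - 1) / w))" by simp
  qed (use \<sigma> in auto)
  also have "\<dots> = ((exp (h * 2 ^ (h - 1) / w) * \<sigma>) ^ k) ^ card S"
    by (simp add: power_mult_distrib power_divide exp_of_nat_mult flip: power_mult)
      (simp add: algebra_simps flip: exp_of_nat_mult)
  finally show ?thesis by (simp add: \<sigma>_def)
qed

text \<open>The truncated function is convex with chord \<open>w / h * x\<close> from 0 to
  \<open>h\<close>; at integers strictly between, it lies at least \<open>1 / h\<close> below the
  chord.\<close>

lemma truncated_le_linear:
  fixes x h w :: nat
  assumes "0 < w" "w < h" "x \<le> h"
  shows "real (x - (h - w)) \<le>
    w / h * x - 1 / h * (1 - (if x = 0 then 1 else 0) - (if x = h then 1 else 0))"
proof -
  consider "x = 0" | "x = h" | "0 < x" "x \<le> h - w" | "h - w < x" "x < h" using assms by linarith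
  then show ?thesis
  proof cases
    case 3
    have "1 \<le> w * x" using 3 assms by simp
    then have "1 \<le> real w * real x" by (metis of_nat_1 of_nat_le_iff of_nat_mult)
    with 3 assms show ?thesis by (auto simp: field_simps)
  next
    case 4
    have "real (h - w) * real x \<le> real (h - w) * (real h - 1)"
      using 4 assms by (intro mult_left_mono) auto
    moreover have "1 \<le> real h - real w" using assms by simp
    ultimately show ?thesis using 4 assms by (auto simp: field_simps of_nat_diff)
  qed (use assms in auto)
qed

text \<open>An edge contributes on average less than the chord value \<open>w * \<sigma>\<close> to
  a set of density \<open>\<sigma>\<close>, by an amount of order
  \<open>\<sigma> * (1 - \<sigma>)\<close>, since it may meet both the set and its complement. As
  \<open>w * m \<le> k * n\<close>, positive surplus is a large deviation.\<close>

lemma prob_mid_set_dense: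
  fixes \<eta> \<sigma>\<^sub>0 :: real
  assumes n: "1 \<le> n" and S: "S \<subseteq> {1..n}" "S \<noteq> {}" and w: "0 < w" "w < h" and m: "w * m \<le> k * n"
    and \<eta>: "0 < \<eta>" "\<eta> \<le> 1" "card S / n \<le> 1 - \<eta>" and \<sigma>\<^sub>0: "0 < \<sigma>\<^sub>0" "\<sigma>\<^sub>0 \<le> card S / n"
  shows "measure_pmf.prob (replicate_pmf m (edge_pmf h n)) {es. 0 < surplus h w k (mset es) S} \<le>
    (exp (- (\<eta>\<^sup>2 * \<sigma>\<^sub>0 / (real w * real h ^ 4))) ^ k) ^ card S"
proof -
  define \<sigma> where "\<sigma> = real (card S) / real n"
  have "card S > 0" using S finite_subset[OF S(1)] by (simp add: card_gt_0_iff)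
  moreover have "card S \<le> n" using card_mono[OF _ S(1)] by simp
  ultimately have \<sigma>: "0 < \<sigma>" "\<sigma> \<le> 1" using n by (auto simp: \<sigma>_def)
  have h: "2 \<le> h" "0 < real h" using w by auto
  \<comment> \<open>Chosen so that the quadratic term of the exponential costs half of the linear
    gain in the final exponent.\<close>
  define \<tau> where "\<tau> = \<eta> * \<sigma>\<^sub>0 / h ^ 3"
  have \<tau>: "0 < \<tau>" using \<eta> \<sigma>\<^sub>0 h by (simp add: \<tau>_def)
  have "\<eta> * \<sigma>\<^sub>0 \<le> 1 * 1" using \<eta> \<sigma>\<^sub>0 \<sigma> by (intro mult_mono) (auto simp: \<sigma>_def)
  moreover have "1 \<le> real h ^ 2" using h by (intro one_le_power) auto
  ultimately have "\<eta> * \<sigma>\<^sub>0 \<le> real h ^ 2" by linarith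
  then have \<tau>h: "\<tau> * h \<le> 1" using h by (simp add: \<tau>_def field_simps power2_eq_square power3_eq_cube)
  define g where "g e = real (hits S e - (h - w))" for e
  define z where "z = \<tau> * (w * \<sigma> - 2 * \<sigma> * (1 - \<sigma>) / h) + (\<tau> * h)\<^sup>2"
  note fin = finite_set_edge_pmf[OF n, of h]
  have "measure_pmf.expectation (edge_pmf h n) (\<lambda>e. exp (\<tau> * g e)) \<le>
      measure_pmf.expectation (edge_pmf h n) (\<lambda>e. (1 - \<tau> / h + (\<tau> * h)\<^sup>2 + \<tau> * w / h * real (hits S e)) +
        (\<tau> / h * indicat_real {e. hits S e = 0} e + \<tau> / h * indicat_real {e. hits S e = h} e))"
  proof (rule expectation_mono_finite[OF fin])
    fix e assume "e \<in> set_pmf (edge_pmf h n)"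
    then have e: "hits S e \<le> h" using set_edge_pmf(1)[OF n] hits_le_size[of S e] by metis
    have g: "0 \<le> g e" "g e \<le> h" using e w by (auto simp: g_def)
    have "\<tau> * g e \<le> \<tau> * h" using g \<tau> by (intro mult_left_mono) auto
    with \<tau>h have "\<tau> * g e \<le> 1" by linarith
    then have "exp (\<tau> * g e) \<le> 1 + \<tau> * g e + (\<tau> * g e)\<^sup>2" using g \<tau> by (intro exp_bound) simp_all
    also have "(\<tau> * g e)\<^sup>2 \<le> (\<tau> * h)\<^sup>2" using g \<tau> by (intro power_mono mult_left_mono) auto
    also have "\<tau> * g e \<le> \<tau> * (w / h * hits S e - 1 / h *
        (1 - indicat_real {e. hits S e = 0} e - indicat_real {e. hits S e = h} e))"
      using truncated_le_linear[OF w e] \<tau> h by (intro mult_left_mono) (auto simp: g_def indicator_def)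
    finally show "exp (\<tau> * g e) \<le> (1 - \<tau> / h + (\<tau> * h)\<^sup>2 + \<tau> * w / h * real (hits S e)) +
        (\<tau> / h * indicat_real {e. hits S e = 0} e + \<tau> / h * indicat_real {e. hits S e = h} e)"
      by (simp add: algebra_simps)
  qed
  also have "\<dots> = (1 - \<tau> / h + (\<tau> * h)\<^sup>2 + \<tau> * w / h * (h * \<sigma>)) + (\<tau> / h * (1 - \<sigma>) ^ h + \<tau> / h * \<sigma> ^ h)"
    using prob_edge_miss[OF n S(1), of h] prob_edge_inside[OF n S(1), of h] expectation_edge_hits[OF n S(1), of h]
    by (simp add: expectation_add_finite[OF fin] \<sigma>_def)
  \<comment> \<open>Lowering the exponents to 2 is allowed by \<open>h \<ge> 2\<close> and gives
    \<open>(1 - \<sigma>)\<^sup>2 + \<sigma>\<^sup>2 = 1 - 2 * \<sigma> * (1 -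
    \<sigma>)\<close>.\<close>
  also have "\<dots> \<le> (1 - \<tau> / h + (\<tau> * h)\<^sup>2 + \<tau> * w / h * (h * \<sigma>)) + (\<tau> / h * (1 - \<sigma>)\<^sup>2 + \<tau> / h * \<sigma>\<^sup>2)"
    by (rule add_left_mono, intro add_mono mult_left_mono power_decreasing) (use h \<sigma> \<tau> in auto)
  also have "\<dots> = 1 + z"
    using h by (simp add: z_def power2_eq_square field_simps)
  also have "\<dots> \<le> exp z" by (rule exp_ge_add_one_self)
  finally have E: "measure_pmf.expectation (edge_pmf h n) (\<lambda>e. exp (\<tau> * g e)) \<le> exp z" .
  have z: "0 \<le> z"
  proof -
    have "2 * \<sigma> * (1 - \<sigma>) / h \<le> 2 * \<sigma> / 2" using \<sigma> h by (intro frac_le) (auto simp: mult_le_cancel_left1)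
    also have "\<dots> \<le> w * \<sigma>" using \<sigma> w by simp
    finally show ?thesis using \<tau> by (simp add: z_def)
  qed
  have "measure_pmf.prob (replicate_pmf m (edge_pmf h n)) {es. 0 < surplus h w k (mset es) S} \<le>
      measure_pmf.expectation (edge_pmf h n) (\<lambda>e. exp (\<tau> * g e)) ^ m / exp (\<tau> * (k * card S))"
  proof (rule prob_le_expectation_power[OF fin])
    fix es assume "0 < surplus h w k (mset es) S"
    then have "real_of_int (int (k * card S)) \<le> real_of_int (\<Sum>e\<in>#mset es. int (hits S e - (h - w)))"
      unfolding of_int_le_iff by (simp add: surplus_def)
    also have "\<dots> = (\<Sum>e\<leftarrow>es. g e)" unfolding g_def by (induction es) auto
    finally have "exp (\<tau> * (k * card S)) \<le> exp (\<tau> * (\<Sum>e\<leftarrow>es. g e))"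
      using \<tau> by simp
    also have "\<dots> = (\<Prod>e\<leftarrow>es. exp (\<tau> * g e))"
      by (induction es) (auto simp: exp_add algebra_simps)
    finally show "exp (\<tau> * (k * card S)) \<le> (\<Prod>e\<leftarrow>es. exp (\<tau> * g e))" .
  qed auto
  also have "\<dots> \<le> exp z ^ m / exp (\<tau> * (k * card S))"
    using E by (intro divide_right_mono power_mono) (auto intro: integral_nonneg)
  also have "\<dots> = exp (m * z - \<tau> * (k * card S))"
    by (simp add: exp_diff exp_of_nat_mult)
  also have "\<dots> \<le> exp (- (\<eta>\<^sup>2 * \<sigma>\<^sub>0 / (real w * real h ^ 4)) * k * card S)"
  proof (intro exp_le_cancel_iff[THEN iffD2])
    have "real w * real m \<le> real k * real n" using m by (metis of_nat_le_iff of_nat_mult)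
    then have "real m \<le> k * card S / (w * \<sigma>)"
      using w n \<sigma> \<open>card S > 0\<close> by (simp add: field_simps \<sigma>_def)
    then have "m * z \<le> k * card S / (w * \<sigma>) * z" using z by (rule mult_right_mono)
    also have "\<dots> = \<tau> * (k * card S) + k * card S / w * (\<tau>\<^sup>2 * h\<^sup>2 / \<sigma> - 2 * \<tau> * (1 - \<sigma>) / h)"
      using w \<sigma> h by (simp add: z_def field_simps power2_eq_square)
    finally have "m * z \<le> \<tau> * (k * card S) + k * card S / w * (\<tau>\<^sup>2 * h\<^sup>2 / \<sigma> - 2 * \<tau> * (1 - \<sigma>) / h)" .
    also have "\<dots> \<le> \<tau> * (k * card S) + k * card S / w * (\<tau>\<^sup>2 * h\<^sup>2 / \<sigma>\<^sub>0 - 2 * \<tau> * \<eta> / h)"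
    proof (intro add_left_mono mult_left_mono diff_mono)
      show "\<tau>\<^sup>2 * h\<^sup>2 / \<sigma> \<le> \<tau>\<^sup>2 * h\<^sup>2 / \<sigma>\<^sub>0"
    proof -
      have "\<sigma>\<^sub>0 \<le> \<sigma>" using \<sigma>\<^sub>0 by (simp add: \<sigma>_def)
      then show ?thesis using \<sigma>\<^sub>0 \<sigma> by (intro divide_left_mono mult_pos_pos) simp_all
    qed
      show "2 * \<tau> * \<eta> / h \<le> 2 * \<tau> * (1 - \<sigma>) / h"
        using \<eta> \<tau> by (intro divide_right_mono mult_left_mono) (auto simp: \<sigma>_def)
    qed simp
    finally have "m * z \<le> \<tau> * (k * card S) + k * card S / w * (\<tau>\<^sup>2 * h\<^sup>2 / \<sigma>\<^sub>0 - 2 * \<tau> * \<eta> / h)" .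
    moreover have "\<tau>\<^sup>2 * h\<^sup>2 / \<sigma>\<^sub>0 - 2 * \<tau> * \<eta> / h = - (\<eta>\<^sup>2 * \<sigma>\<^sub>0 / h ^ 4)"
      using \<sigma>\<^sub>0 h by (simp add: \<tau>_def field_simps power2_eq_square power3_eq_cube power4_eq_xxxx)
    moreover have "k * card S / w * (- (\<eta>\<^sup>2 * \<sigma>\<^sub>0 / h ^ 4)) = - (\<eta>\<^sup>2 * \<sigma>\<^sub>0 / (real w * real h ^ 4)) * k * card S"
      by simp
    ultimately show "m * z - \<tau> * (k * card S) \<le> - (\<eta>\<^sup>2 * \<sigma>\<^sub>0 / (real w * real h ^ 4)) * k * card S"
      by (simp add: mult_ac)
  qed
  also have "\<dots> = (exp (- (\<eta>\<^sup>2 * \<sigma>\<^sub>0 / (real w * real h ^ 4))) ^ k) ^ card S"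
    by (simp add: algebra_simps flip: exp_of_nat_mult)
  finally show ?thesis .
qed

text \<open>Sets of density up to a constant fall under \<open>prob_small_set_dense\<close>, denser
  ones under \<open>prob_mid_set_dense\<close>. The exponent \<open>k\<close> in both bounds lets a
  large \<open>k\<close>, chosen independently of \<open>n\<close>, outweigh the number of
  sets.\<close>

lemma prob_dense_set_le:
  fixes h w :: nat and \<eta> :: real
  assumes w: "0 < w" "w < h" and \<eta>: "0 < \<eta>" "\<eta> \<le> 1"
  shows "\<exists>K::nat. \<forall>k\<ge>K. \<forall>n\<ge>1. \<forall>m. w * m \<le> k * n \<longrightarrow>
    measure_pmf.prob (replicate_pmf m (edge_pmf h n))
      {es. \<exists>S\<subseteq>{1..n}. (1 \<le> card S \<and> card S / n \<le> 1 - \<eta>) \<and> 0 < surplus h w k (mset es) S} \<le> 2 / n"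
proof -
  define c :: real where "c = exp (h * 2 ^ (h - 1) / w)"
  have c: "1 \<le> c" by (simp add: c_def)
  define \<sigma>\<^sub>0 where "\<sigma>\<^sub>0 = 1 / (2 * c)"
  have \<sigma>\<^sub>0: "0 < \<sigma>\<^sub>0" "c * \<sigma>\<^sub>0 = 1 / 2" using c by (auto simp: \<sigma>\<^sub>0_def)
  define q where "q = exp (- (\<eta>\<^sup>2 * \<sigma>\<^sub>0 / (real w * real h ^ 4)))"
  have q: "0 < q" "q < 1" using \<eta> \<sigma>\<^sub>0 w by (auto simp: q_def)
  have "(\<lambda>k. exp 1 * c\<^sup>2 * (1 / 2) ^ (k - 2) :: real) \<longlonglongrightarrow> 0"
    by (rule LIMSEQ_offset[where k = 2]) (auto intro!: tendsto_mult_right_zero LIMSEQ_power_zero)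
  then have "\<forall>\<^sub>F k in sequentially. exp 1 * c\<^sup>2 * (1 / 2) ^ (k - 2) < (1 / 2 :: real)"
    by (rule order_tendstoD) simp
  moreover have "(\<lambda>k. exp 1 / \<sigma>\<^sub>0 * q ^ k) \<longlonglongrightarrow> 0"
    using q by (intro tendsto_mult_right_zero LIMSEQ_power_zero) simp
  then have "\<forall>\<^sub>F k in sequentially. exp 1 / \<sigma>\<^sub>0 * q ^ k < \<sigma>\<^sub>0 / 2"
    by (rule order_tendstoD) (use \<sigma>\<^sub>0 in simp)
  ultimately have "\<forall>\<^sub>F k in sequentially. 2 \<le> k \<and> exp 1 * c\<^sup>2 * (1 / 2) ^ (k - 2) < (1 / 2 :: real) \<and>
      exp 1 / \<sigma>\<^sub>0 * q ^ k < \<sigma>\<^sub>0 / 2"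
    using eventually_ge_at_top[of 2] by eventually_elim auto
  then obtain K where K: "\<And>k. K \<le> k \<Longrightarrow> 2 \<le> k" "\<And>k. K \<le> k \<Longrightarrow> exp 1 * c\<^sup>2 * (1 / 2) ^ (k - 2) < (1 / 2 :: real)"
      "\<And>k. K \<le> k \<Longrightarrow> exp 1 / \<sigma>\<^sub>0 * q ^ k < \<sigma>\<^sub>0 / 2"
    unfolding eventually_at_top_linorder by blast
  show ?thesis
  proof (intro exI[of _ K] allI impI)
    fix k n m :: nat assume "K \<le> k" and n: "1 \<le> n" and m: "w * m \<le> k * n"
    note K = K[OF \<open>K \<le> k\<close>]
    \<comment> \<open>Below the split point the base \<open>c * s / n\<close> is at most
      \<open>c * \<sigma>\<^sub>0 = 1 / 2\<close>; above it the base \<open>q < 1\<close> is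
      fixed.\<close>
    define B where "B s = (if s / n \<le> \<sigma>\<^sub>0 then (c * (real s / n)) ^ k else q ^ k)" for s :: nat
    have "measure_pmf.prob (replicate_pmf m (edge_pmf h n))
      {es. \<exists>S\<subseteq>{1..n}. (1 \<le> card S \<and> card S / n \<le> 1 - \<eta>) \<and> 0 < surplus h w k (mset es) S} \<le> 2 * (1 / n)"
    proof (rule prob_union_le_inverse[where B = B])
      fix s :: nat assume s: "1 \<le> s \<and> s / n \<le> 1 - \<eta>"
      define \<sigma> where "\<sigma> = real s / n"
      have \<sigma>: "0 < \<sigma>" "\<sigma> \<le> 1" using s n \<eta> unfolding \<sigma>_def by (simp, linarith)
      have B: "0 \<le> B s" using c q by (auto simp: B_def)
      have "exp 1 / \<sigma> * B s \<le> \<sigma> / 2"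
      proof (cases "\<sigma> \<le> \<sigma>\<^sub>0")
        case True
        \<comment> \<open>Two of the \<open>k\<close> factors are set aside: one cancels the
          \<open>1 / \<sigma>\<close> from the binomial coefficient, the other leaves a spare factor
          \<open>\<sigma>\<close>.\<close>
        have "exp 1 / \<sigma> * B s = exp 1 / \<sigma> * ((c * \<sigma>) ^ (k - 2) * (c * \<sigma>)\<^sup>2)"
        proof -
          have "(c * \<sigma>) ^ k = (c * \<sigma>) ^ (k - 2) * (c * \<sigma>)\<^sup>2"
            using K(1) by (metis le_add_diff_inverse2 power_add)
          moreover have "B s = (c * \<sigma>) ^ k" using True by (simp add: B_def \<sigma>_def)
          ultimately show ?thesis by simp
        qed
        also have "\<dots> = exp 1 * c\<^sup>2 * \<sigma> * (c * \<sigma>) ^ (k - 2)"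
          using \<sigma> by (simp add: power_mult_distrib power2_eq_square)
        also have "\<dots> \<le> exp 1 * c\<^sup>2 * \<sigma> * (c * \<sigma>\<^sub>0) ^ (k - 2)"
          using True \<sigma> c by (intro mult_left_mono power_mono) auto
        also have "\<dots> = \<sigma> * (exp 1 * c\<^sup>2 * (1 / 2) ^ (k - 2))" unfolding \<sigma>\<^sub>0(2) by simp
        also have "\<dots> \<le> \<sigma> * (1 / 2)" using K(2) \<sigma> by (intro mult_left_mono) auto
        finally show ?thesis by simp
      next
        case False
        then have "exp 1 / \<sigma> * B s \<le> exp 1 / \<sigma>\<^sub>0 * q ^ k"
          using q \<sigma>\<^sub>0 by (auto simp: B_def \<sigma>_def[symmetric] intro!: mult_right_mono divide_left_mono)
        then show ?thesis using K(3) False by linarith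
      qed
      then have "(exp 1 / \<sigma> * B s) ^ s \<le> (\<sigma> / 2) ^ s" using B \<sigma> by (intro power_mono) auto
      also have "\<dots> = \<sigma> ^ s / 2 ^ s" by (simp add: power_divide)
      \<comment> \<open>Keeping a single factor \<open>\<sigma> = s / n\<close> yields the bound of
        order \<open>1 / n\<close>.\<close>
      also have "\<dots> \<le> \<sigma> ^ 1 / 2 ^ s" using \<sigma> s by (intro divide_right_mono power_decreasing) auto
      finally show "1 \<le> s \<and> 0 \<le> B s \<and> (exp 1 * card {1..n} / s * B s) ^ s \<le> 1 / n * real s / 2 ^ s"
        using s B by (simp add: \<sigma>_def)
    next
      fix S assume S: "S \<subseteq> {1..n}" "1 \<le> card S \<and> card S / n \<le> 1 - \<eta>"
      then have "S \<noteq> {}" by auto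
      then show "measure_pmf.prob (replicate_pmf m (edge_pmf h n)) {es. 0 < surplus h w k (mset es) S} \<le> B (card S) ^ card S"
        using prob_small_set_dense[OF n S(1) _ w m] prob_mid_set_dense[OF n S(1) _ w m \<eta> _ \<sigma>\<^sub>0(1)] S(2)
        by (auto simp: B_def c_def q_def)
    qed auto
    then show "measure_pmf.prob (replicate_pmf m (edge_pmf h n))
      {es. \<exists>S\<subseteq>{1..n}. (1 \<le> card S \<and> card S / n \<le> 1 - \<eta>) \<and> 0 < surplus h w k (mset es) S} \<le> 2 / n" by simp
  qed
qed

section \<open>Sets with cycles and few incident edges\<close>

lemma overshoot_constants:
  fixes h w :: nat
  assumes w: "0 < w" "w < h"
  obtains \<eta> \<theta> :: real where "0 < \<eta>" "\<eta> \<le> 1 / (4 * h)" "0 < \<theta>"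
    "\<theta> < (1 - \<eta>) * (h / w) * ((1 - h * \<eta>) - exp (- \<theta>) * (1 + \<eta>) ^ (h - 1))"
proof -
  \<comment> \<open>Since \<open>h / w \<ge> 1 + 1 / w\<close> and
    \<open>1 - exp (- \<theta>) \<ge> \<theta> / (1 + \<theta>)\<close>, any positive
    \<open>\<theta> < 1 / w\<close> satisfies the strict inequality at \<open>\<eta> = 0\<close>;
    continuity then extends it to small positive \<open>\<eta>\<close>.\<close>
  define \<theta> :: real where "\<theta> = 1 / (w + 1)"
  have \<theta>: "0 < \<theta>" by (simp add: \<theta>_def)
  have "exp (- \<theta>) \<le> 1 / (1 + \<theta>)"
    using exp_ge_add_one_self[of \<theta>] \<theta> by (simp add: exp_minus field_simps)
  then have "\<theta> / (1 + \<theta>) \<le> 1 - exp (- \<theta>)" using \<theta> by (simp add: field_simps)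
  then have "(1 + 1 / w) * (\<theta> / (1 + \<theta>)) \<le> (h / w) * (1 - exp (- \<theta>))"
  proof (intro mult_mono)
    have "1 + 1 / real w = (real w + 1) / real w" using w by (simp add: field_simps)
    also have "\<dots> \<le> real h / real w" using w by (intro divide_right_mono) auto
    finally show "1 + 1 / real w \<le> real h / real w" .
  qed (use \<theta> in auto)
  moreover have "\<theta> < (1 + 1 / w) * (\<theta> / (1 + \<theta>))"
  proof -
    have a: "\<theta> / (1 + \<theta>) = 1 / (real w + 2)" by (simp add: \<theta>_def field_simps)
    have b: "(1 + 1 / w) * (1 / (real w + 2)) = (real w + 1) / (real w * (real w + 2))"
      using w by (simp add: field_simps)
    have "1 / (real w + 1) < (real w + 1) / (real w * (real w + 2))"
    proof -
      have "(real w + 1) / ((real w + 1) * (real w + 1)) < (real w + 1) / (real w * (real w + 2))"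
        using w by (intro divide_strict_left_mono mult_pos_pos) (auto simp: algebra_simps)
      then show ?thesis by simp
    qed
    then show ?thesis unfolding a b by (simp add: \<theta>_def add.commute)
  qed
  ultimately have lim: "\<theta> < (h / w) * (1 - exp (- \<theta>))" by linarith
  have "((\<lambda>\<eta> :: real. (1 - \<eta>) * (h / w) * ((1 - h * \<eta>) - exp (- \<theta>) * (1 + \<eta>) ^ (h - 1))) \<longlongrightarrow>
      (1 - 0) * (h / w) * ((1 - h * (0 :: real)) - exp (- \<theta>) * (1 + 0) ^ (h - 1))) (at_right 0)"
    by (intro tendsto_intros)
  then have "\<forall>\<^sub>F \<eta> in at_right (0 :: real). \<theta> < (1 - \<eta>) * (h / w) * ((1 - h * \<eta>) - exp (- \<theta>) * (1 + \<eta>) ^ (h - 1))"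
    by (rule order_tendstoD) (use lim in simp)
  moreover have "\<forall>\<^sub>F \<eta> in at_right (0 :: real). \<eta> \<in> {0<..<1 / (4 * h)}"
    using w by (intro eventually_at_right_real) simp
  ultimately have "\<forall>\<^sub>F \<eta> in at_right (0 :: real). 0 < \<eta> \<and> \<eta> \<le> 1 / (4 * h) \<and>
      \<theta> < (1 - \<eta>) * (h / w) * ((1 - h * \<eta>) - exp (- \<theta>) * (1 + \<eta>) ^ (h - 1))"
    by eventually_elim auto
  from eventually_happens'[OF _ this] \<theta> that show thesis by auto
qed

text \<open>The weight \<open>exp (- \<theta>)\<close> favours few edges at \<open>U\<close>,
  although the average degree is at least about \<open>k * h / w\<close>, and
  \<open>\<eta> / p\<close> favours excess. The latter yields the factor
  \<open>card U / n / \<eta>\<close>, which offsets the number of sets of that size.\<close>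

lemma prob_cyclic_set:
  fixes h w :: nat and \<eta> \<theta> :: real
  assumes n: "1 \<le> n" and U: "U \<subseteq> {1..n}" "U \<noteq> {}" and w: "0 < w" "w < h"
    and m: "(1 - \<eta>) * k * n / w \<le> m" and \<eta>: "0 < \<eta>" "\<eta> \<le> 1" "card U / n \<le> \<eta>" and \<theta>: "0 < \<theta>"
  defines "A \<equiv> (1 - h * \<eta>) - exp (- \<theta>) * (1 + \<eta>) ^ (h - 1)"
  assumes A: "0 \<le> A"
  shows "measure_pmf.prob (replicate_pmf m (edge_pmf h n))
      {es. size (filter_mset (\<lambda>e. 0 < hits U e) (mset es)) \<le> k * card U \<and> card U \<le> excess (mset es) U} \<le>
    (exp (- ((1 - \<eta>) * (h / w) * A - \<theta>)) ^ k * (card U / n / \<eta>)) ^ card U"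
proof -
  define p where "p = real (card U) / real n"
  have "card U > 0" using U finite_subset[OF U(1)] by (simp add: card_gt_0_iff)
  moreover have "card U \<le> n" using card_mono[OF _ U(1)] by simp
  ultimately have p: "0 < p" "p \<le> 1" "p \<le> \<eta>" using n \<eta> by (auto simp: p_def)
  define r where "r = card U"
  \<comment> \<open>A lower bound for the product of weights on the event: few edges bound the power
    of \<open>exp (- \<theta>) \<le> 1\<close>, and the excess bounds the power of
    \<open>\<eta> / p \<ge> 1\<close>.\<close>
  define T where "T = exp (- \<theta>) ^ (k * r) * (\<eta> / p) ^ r"
  have T: "0 < T" using p \<eta> by (simp add: T_def)
  have "measure_pmf.expectation (edge_pmf h n) (tilt (exp (- \<theta>)) (\<eta> / p) U) \<le>
      (1 - p) ^ h + exp (- \<theta>) * p * h * (1 + \<eta>) ^ (h - 1)"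
    using expectation_tilt_le[OF n U \<eta>(1), of "exp (- \<theta>)" h] by (simp add: p_def)
  also have "(1 - p) ^ h \<le> 1 - h * p + (h * p)\<^sup>2" using p by (intro one_minus_power_le) auto
  \<comment> \<open>The second-order term is absorbed via \<open>p \<le> \<eta>\<close>; it is the
    source of \<open>1 - h * \<eta>\<close> in \<open>A\<close>.\<close>
  also have "(h * p)\<^sup>2 \<le> h * p * (h * \<eta>)"
    unfolding power2_eq_square using p by (intro mult_left_mono) auto
  finally have "measure_pmf.expectation (edge_pmf h n) (tilt (exp (- \<theta>)) (\<eta> / p) U) \<le> 1 + (- (h * p * A))"
    by (simp add: A_def algebra_simps)
  also have "\<dots> \<le> exp (- (h * p * A))" by (rule exp_ge_add_one_self)
  finally have E: "measure_pmf.expectation (edge_pmf h n) (tilt (exp (- \<theta>)) (\<eta> / p) U) \<le> exp (- (h * p * A))" .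
  have "measure_pmf.prob (replicate_pmf m (edge_pmf h n))
      {es. size (filter_mset (\<lambda>e. 0 < hits U e) (mset es)) \<le> k * r \<and> r \<le> excess (mset es) U} \<le>
      measure_pmf.expectation (edge_pmf h n) (tilt (exp (- \<theta>)) (\<eta> / p) U) ^ m / T"
  proof (rule prob_le_expectation_power[OF _ _ T])
    fix es :: "nat multiset list"
    assume "size (filter_mset (\<lambda>e. 0 < hits U e) (mset es)) \<le> k * r \<and> r \<le> excess (mset es) U"
    then show "T \<le> (\<Prod>e\<leftarrow>es. tilt (exp (- \<theta>)) (\<eta> / p) U e)"
      unfolding prod_tilt T_def using p \<theta> \<eta> by (intro mult_mono power_decreasing power_increasing) auto
  qed (use n \<eta> p in \<open>auto simp: finite_set_edge_pmf tilt_def\<close>)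
  also have "\<dots> \<le> exp (- (h * p * A)) ^ m / T"
    using E T \<eta> p by (intro divide_right_mono power_mono integral_nonneg) (auto simp: tilt_def)
  also have "exp (- (h * p * A)) ^ m = exp (- (h * A * (m * p)))"
    by (simp add: algebra_simps flip: exp_of_nat_mult)
  also have "\<dots> \<le> exp (- (h * A * ((1 - \<eta>) * k * r / w)))"
  proof -
    have "(1 - \<eta>) * k * n / w * p \<le> m * p" using m p by (intro mult_right_mono) auto
    then have "(1 - \<eta>) * k * r / w \<le> m * p" using n by (simp add: p_def r_def)
    then have "h * A * ((1 - \<eta>) * k * r / w) \<le> h * A * (m * p)" using A by (intro mult_left_mono) auto
    then show ?thesis by simp
  qed
  also have "exp (- (h * A * ((1 - \<eta>) * k * r / w))) / T =
      exp (- (h * A * ((1 - \<eta>) * k * r / w))) * exp (\<theta> * (k * r)) * (p / \<eta>) ^ r"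
    by (simp add: T_def power_divide exp_minus field_simps flip: exp_of_nat_mult)
  also have "\<dots> = exp (- ((1 - \<eta>) * (h / w) * A - \<theta>) * (k * r)) * (p / \<eta>) ^ r"
    by (simp add: algebra_simps flip: exp_add)
  also have "\<dots> = (exp (- ((1 - \<eta>) * (h / w) * A - \<theta>)) ^ k * (p / \<eta>)) ^ r"
  proof -
    have "exp (x * (k * r)) = (exp x ^ k) ^ r" for x :: real
      by (simp add: mult_ac flip: exp_of_nat_mult)
    then show ?thesis by (simp only: power_mult_distrib)
  qed
  finally show ?thesis using T by (simp add: divide_right_mono p_def r_def)
qed

text \<open>The factor \<open>s / n\<close> in the bound for one set cancels the
  \<open>n / s\<close> of the binomial estimate, so each vertex costs
  \<open>exp 1 / \<eta> * q ^ k\<close> with \<open>q < 1\<close>; a large \<open>k\<close> makes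
  this less than 1/2 for all sizes at once.\<close>

lemma prob_cyclic_set_le:
  fixes h w :: nat and \<eta> \<theta> :: real
  assumes w: "0 < w" "w < h" and \<eta>: "0 < \<eta>" "\<eta> \<le> 1" and \<theta>: "0 < \<theta>"
    "\<theta> < (1 - \<eta>) * (h / w) * ((1 - h * \<eta>) - exp (- \<theta>) * (1 + \<eta>) ^ (h - 1))"
  shows "\<exists>K::nat. \<forall>k\<ge>K. \<forall>n\<ge>1. \<forall>m. \<forall>\<rho>>0. (1 - \<eta>) * k * n / w \<le> m \<longrightarrow>
    measure_pmf.prob (replicate_pmf m (edge_pmf h n))
      {es. \<exists>U\<subseteq>{1..n}. (\<rho> * real n \<le> real (card U) \<and> card U / n \<le> \<eta>) \<and>
        size (filter_mset (\<lambda>e. 0 < hits U e) (mset es)) \<le> k * card U \<and> card U \<le> excess (mset es) U} \<le> 2 / (\<rho> * n)"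
proof -
  define A where "A = (1 - h * \<eta>) - exp (- \<theta>) * (1 + \<eta>) ^ (h - 1)"
  have "0 < (1 - \<eta>) * (h / w) * A" using \<theta> unfolding A_def by linarith
  moreover have "0 \<le> (1 - \<eta>) * (h / w)" using \<eta> by simp
  ultimately have A: "0 \<le> A" using mult_nonneg_nonpos[of "(1 - \<eta>) * (h / w)" A] by linarith
  define q where "q = exp (- ((1 - \<eta>) * (h / w) * A - \<theta>))"
  have q: "0 < q" "q < 1" using \<theta> by (auto simp: q_def A_def)
  have "(\<lambda>k. exp 1 / \<eta> * q ^ k) \<longlonglongrightarrow> 0"
    using q by (intro tendsto_mult_right_zero LIMSEQ_power_zero) simp
  then have "\<forall>\<^sub>F k in sequentially. exp 1 / \<eta> * q ^ k < 1 / 2"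
    by (rule order_tendstoD) simp
  then obtain K where K: "\<And>k. K \<le> k \<Longrightarrow> exp 1 / \<eta> * q ^ k < 1 / 2"
    unfolding eventually_at_top_linorder by blast
  show ?thesis
  proof (intro exI[of _ K] allI impI)
    fix k n m :: nat and \<rho> :: real
    assume "K \<le> k" and n: "1 \<le> n" and \<rho>: "0 < \<rho>" and m: "(1 - \<eta>) * k * n / w \<le> m"
    define B where "B s = q ^ k * (real s / n / \<eta>)" for s :: nat
    have "measure_pmf.prob (replicate_pmf m (edge_pmf h n))
      {es. \<exists>U\<subseteq>{1..n}. (\<rho> * real n \<le> real (card U) \<and> card U / n \<le> \<eta>) \<and>
        size (filter_mset (\<lambda>e. 0 < hits U e) (mset es)) \<le> k * card U \<and> card U \<le> excess (mset es) U} \<le>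
      2 * (1 / (\<rho> * n))"
    proof (rule prob_union_le_inverse[where B = B and R = "\<lambda>s. \<rho> * n \<le> real s \<and> real s / n \<le> \<eta>"])
      fix s :: nat assume s: "\<rho> * n \<le> s \<and> s / n \<le> \<eta>"
      have \<rho>n: "0 < \<rho> * n" using n \<rho> by simp
      with s have "0 < s" by (cases "s = 0") auto
      have B: "0 \<le> B s" using q \<eta> by (auto simp: B_def)
      have "exp 1 * n / s * B s = exp 1 / \<eta> * q ^ k" using \<open>0 < s\<close> n by (simp add: B_def)
      also have "\<dots> \<le> 1 / 2" using K[OF \<open>K \<le> k\<close>] by simp
      finally have "(exp 1 * n / s * B s) ^ s \<le> (1 / 2) ^ s" using B by (intro power_mono) auto
      also have "\<dots> = 1 / 2 ^ s" by (simp add: power_one_over)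
      \<comment> \<open>The lower bound \<open>\<rho> * n \<le> s\<close> supplies the factor
        \<open>s / (\<rho> * n) \<ge> 1\<close>.\<close>
      also have "\<dots> \<le> 1 / (\<rho> * n) * real s / 2 ^ s" using s \<rho>n by (intro divide_right_mono) (auto simp: field_simps)
      finally show "1 \<le> s \<and> 0 \<le> B s \<and> (exp 1 * card {1..n} / s * B s) ^ s \<le> 1 / (\<rho> * n) * real s / 2 ^ s"
        using \<open>0 < s\<close> B by simp
    next
      fix U assume U: "U \<subseteq> {1..n}" "\<rho> * n \<le> card U \<and> card U / n \<le> \<eta>"
      have "0 < \<rho> * n" using n \<rho> by simp
      then have "U \<noteq> {}" using U by auto
      then show "measure_pmf.prob (replicate_pmf m (edge_pmf h n))
          {es. size (filter_mset (\<lambda>e. 0 < hits U e) (mset es)) \<le> k * card U \<and> card U \<le> excess (mset es) U}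
          \<le> B (card U) ^ card U"
        using prob_cyclic_set[OF n U(1) _ w m \<eta> _ \<theta>(1)] U(2) A by (simp add: B_def q_def A_def)
    qed (use \<rho> in auto)
    then show "measure_pmf.prob (replicate_pmf m (edge_pmf h n))
      {es. \<exists>U\<subseteq>{1..n}. (\<rho> * real n \<le> real (card U) \<and> card U / n \<le> \<eta>) \<and>
        size (filter_mset (\<lambda>e. 0 < hits U e) (mset es)) \<le> k * card U \<and> card U \<le> excess (mset es) U} \<le> 2 / (\<rho> * n)"
      by simp
  qed
qed

subsection \<open>Growth and concentration of the top surplus\<close>

lemma replicate_edge_support:
  assumes "1 \<le> n" "es \<in> set_pmf (replicate_pmf m (edge_pmf h n))"
  shows "length es = m" "uniform_on h {1..n} (mset es)"
proof -
  have es: "length es = m" "\<forall>e\<in>set es. e \<in> set_pmf (edge_pmf h n)"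
    using assms(2) by (auto simp: set_replicate_pmf)
  then show "length es = m" "uniform_on h {1..n} (mset es)"
    using set_edge_pmf[OF assms(1)] unfolding uniform_on_def set_mset_mset by blast+
qed

lemma prob_top_separated:
  fixes a b :: real
  assumes n: "1 \<le> n" and "w < h" and ab: "b < a"
  shows "min (measure_pmf.prob (replicate_pmf m (edge_pmf h n)) {es. a \<le> top_surplus h w k {1..n} (mset es)})
      (measure_pmf.prob (replicate_pmf m (edge_pmf h n)) {es. top_surplus h w k {1..n} (mset es) \<le> b})
    \<le> 4 * (real m * (real w)\<^sup>2) / (a - b)\<^sup>2"
proof -
  let ?f = "\<lambda>es. real_of_int (top_surplus h w k {1..n} (mset es))"
  have "measure_pmf.variance (replicate_pmf m (edge_pmf h n)) ?f \<le> m * (real w)\<^sup>2"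
  proof (rule variance_replicate_le)
    fix xs ys and a b :: "nat multiset"
    assume "a \<in> set_pmf (edge_pmf h n)" "b \<in> set_pmf (edge_pmf h n)"
    then have "size a = h" "size b = h" using set_edge_pmf(1)[OF n] by blast+
    from top_surplus_exchange[OF _ \<open>w < h\<close> this, of "{1..n}" k "mset xs + mset ys"]
    have "\<bar>top_surplus h w k {1..n} (mset (xs @ a # ys)) - top_surplus h w k {1..n} (mset (xs @ b # ys))\<bar> \<le> int w"
      by simp
    then show "\<bar>?f (xs @ a # ys) - ?f (xs @ b # ys)\<bar> \<le> real w" by linarith
  qed (rule finite_set_edge_pmf[OF n])
  then have "4 * measure_pmf.variance (replicate_pmf m (edge_pmf h n)) ?f / (a - b)\<^sup>2 \<le> 4 * (real m * (real w)\<^sup>2) / (a - b)\<^sup>2"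
    by (intro divide_right_mono) auto
  with prob_separated_le_variance[OF finite_set_replicate_pmf[OF finite_set_edge_pmf[OF n, of h], of m] ab, where f = ?f]
  show ?thesis by linarith
qed

text \<open>A large set with positive surplus after \<open>m\<close> edges is kept fixed. A fresh
  edge lies inside it with probability at least \<open>(1 - \<eta>) ^ h \<ge> 3 / 4\<close> and then
  adds \<open>w \<ge> 1\<close>; other edges take nothing away.\<close>

lemma prob_top_growth:
  fixes \<eta> :: real
  assumes n: "1 \<le> n" and w: "0 < w" "w < h" and \<eta>: "0 < \<eta>" "\<eta> \<le> 1 / (4 * h)"
  shows "1 / 2 * measure_pmf.prob (replicate_pmf m (edge_pmf h n))
      {es. \<exists>S\<subseteq>{1..n}. 1 - \<eta> \<le> card S / n \<and> 0 < surplus h w k (mset es) S} \<le>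
    measure_pmf.prob (replicate_pmf (m + d) (edge_pmf h n)) {es. d / 2 \<le> top_surplus h w k {1..n} (mset es)}"
proof (rule prob_replicate_add_ge)
  fix es :: "nat multiset list"
  assume "\<exists>S\<subseteq>{1..n}. 1 - \<eta> \<le> card S / n \<and> 0 < surplus h w k (mset es) S"
  then obtain S where S: "S \<subseteq> {1..n}" "1 - \<eta> \<le> card S / n" "0 < surplus h w k (mset es) S" by blast
  let ?D = "replicate_pmf d (edge_pmf h n)"
  define miss where "miss e = indicat_real {e. hits S e \<noteq> h} e" for e
  note fin = finite_set_edge_pmf[OF n, of h]
  have h\<eta>: "h * \<eta> \<le> 1 / 4" using \<eta>(2) w by (simp add: field_simps)
  have "1 * \<eta> \<le> h * \<eta>" using w \<eta> by (intro mult_right_mono) auto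
  then have "\<eta> \<le> 1" using h\<eta> by linarith
  have "1 + real h * (- \<eta>) \<le> (1 + - \<eta>) ^ h" using \<open>\<eta> \<le> 1\<close> by (intro Bernoulli_inequality) simp
  also have "\<dots> \<le> (card S / n) ^ h" using S(2) \<open>\<eta> \<le> 1\<close> by (intro power_mono) auto
  also have "\<dots> = measure_pmf.prob (edge_pmf h n) {e. hits S e = h}" using prob_edge_inside[OF n S(1)] by simp
  finally have "3 / 4 \<le> measure_pmf.prob (edge_pmf h n) {e. hits S e = h}" using h\<eta> by linarith
  moreover have "measure_pmf.prob (edge_pmf h n) {e. hits S e \<noteq> h} =
      1 - measure_pmf.prob (edge_pmf h n) {e. hits S e = h}"
    using measure_pmf.prob_compl[of "{e. hits S e = h}" "edge_pmf h n"] by (simp add: Collect_neg_eq Compl_eq_Diff_UNIV)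
  ultimately have miss: "measure_pmf.expectation (edge_pmf h n) miss \<le> 1 / 4"
    unfolding miss_def by simp
  have inside: "d / 2 \<le> real_of_int (top_surplus h w k {1..n} (mset (es @ ys)))"
    if ys: "length ys = d" and le: "(\<Sum>e\<leftarrow>ys. miss e) \<le> d / 2" for ys
  proof -
    have "real (length ys) - (\<Sum>e\<leftarrow>ys. miss e) \<le> real_of_int (\<Sum>e\<in>#mset ys. int (hits S e - (h - w)))"
      using w by (induction ys) (auto simp: miss_def indicator_def)
    moreover have "0 \<le> real_of_int (surplus h w k (mset es) S)" using S(3) by simp
    moreover have "real_of_int (surplus h w k (mset (es @ ys)) S) \<le> real_of_int (top_surplus h w k {1..n} (mset (es @ ys)))"
      unfolding of_int_le_iff using S(1) by (intro surplus_le_top) auto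
    moreover have "real_of_int (surplus h w k (mset (es @ ys)) S) =
        real_of_int (surplus h w k (mset es) S) + real_of_int (\<Sum>e\<in>#mset ys. int (hits S e - (h - w)))"
      unfolding mset_append surplus_union by (rule of_int_add)
    ultimately show ?thesis using ys le by linarith
  qed
  \<comment> \<open>At most \<open>d / 4\<close> misses are expected, so by Markov's inequality more
    than \<open>d / 2\<close> of them occur with probability at most 1/2.\<close>
  have "measure_pmf.prob ?D {ys. d / 2 < (\<Sum>e\<leftarrow>ys. miss e)} \<le> 1 / 2"
  proof (cases "d = 0")
    case False
    have "measure_pmf.prob ?D {ys. d / 2 < (\<Sum>e\<leftarrow>ys. miss e)} \<le>
        measure_pmf.expectation ?D (\<lambda>ys. 2 / d * (\<Sum>e\<leftarrow>ys. miss e))"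
      using False by (intro prob_le_expectation finite_set_replicate_pmf fin)
        (auto simp: miss_def field_simps intro!: sum_list_nonneg)
    also have "\<dots> = 2 * measure_pmf.expectation (edge_pmf h n) miss"
      using False by (simp add: expectation_replicate_sum[OF fin])
    finally show ?thesis using miss by linarith
  qed simp
  moreover have "measure_pmf.prob ?D UNIV \<le>
      measure_pmf.prob ?D {ys. d / 2 \<le> top_surplus h w k {1..n} (mset (es @ ys))} +
      measure_pmf.prob ?D {ys. d / 2 < (\<Sum>e\<leftarrow>ys. miss e)}"
  proof (rule prob_union_supp)
    fix ys assume "ys \<in> set_pmf ?D"
    then have "length ys = d" using replicate_edge_support(1)[OF n] by blast
    with inside[of ys] show "ys \<in> {ys. d / 2 \<le> top_surplus h w k {1..n} (mset (es @ ys))} \<or>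
        ys \<in> {ys. d / 2 < (\<Sum>e\<leftarrow>ys. miss e)}" by force
  qed
  ultimately show "1 / 2 \<le> measure_pmf.prob ?D {ys. d / 2 \<le> top_surplus h w k {1..n} (mset (es @ ys))}"
    by simp
qed (use finite_set_edge_pmf[OF n] in auto)

text \<open>\<open>m\<^sub>0 n\<close> is the least number of edges at which the maximal surplus is
  positive with probability at least 1/2. The upper tail is stated for
  \<open>w * m \<le> k * n\<close>, the range left open by
  \<open>not_property_T_if_many_edges\<close>; the lower tail records that inequality for the
  transfer to the simple model.\<close>

lemma multi_tails:
  fixes h w :: nat
  assumes w: "0 < w" "w < h"
  shows "\<exists>K::nat. \<forall>k>K. \<exists>m\<^sub>0 :: nat \<Rightarrow> nat. \<forall>\<epsilon> :: real. 0 < \<epsilon> \<and> \<epsilon> < 1 \<longrightarrow> (\<exists>D::real. \<forall>\<^sub>F n in sequentially. \<forall>m.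
     (real m \<le> (1 - \<epsilon>) * m\<^sub>0 n \<longrightarrow> w * m \<le> k * n \<and>
        measure_pmf.prob (replicate_pmf m (edge_pmf h n))
          {es. \<not> property_T h w k \<lparr>verts = {1..n}, edges = mset es\<rparr>} \<le> D / n) \<and>
     ((1 + \<epsilon>) * m\<^sub>0 n \<le> real m \<longrightarrow> w * m \<le> k * n \<longrightarrow>
        measure_pmf.prob (replicate_pmf m (edge_pmf h n))
          {es. property_T h w k \<lparr>verts = {1..n}, edges = mset es\<rparr>} \<le> D / n))"
proof -
  obtain \<eta> \<theta> :: real where \<eta>: "0 < \<eta>" "\<eta> \<le> 1 / (4 * h)" and \<theta>: "0 < \<theta>"
    "\<theta> < (1 - \<eta>) * (h / w) * ((1 - h * \<eta>) - exp (- \<theta>) * (1 + \<eta>) ^ (h - 1))"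
    using overshoot_constants[OF w] by blast
  have "1 / (4 * real h) \<le> 1 / 4" using w by simp
  then have \<eta>1: "\<eta> < 1" using \<eta>(2) by linarith
  from prob_dense_set_le[OF w \<eta>(1) less_imp_le[OF \<eta>1]]
  obtain K1 where K1: "\<forall>k\<ge>K1. \<forall>n\<ge>1. \<forall>m. w * m \<le> k * n \<longrightarrow>
    measure_pmf.prob (replicate_pmf m (edge_pmf h n))
      {es. \<exists>S\<subseteq>{1..n}. (1 \<le> card S \<and> card S / n \<le> 1 - \<eta>) \<and> 0 < surplus h w k (mset es) S} \<le> 2 / n"
    by (rule exE)
  from prob_cyclic_set_le[OF w \<eta>(1) less_imp_le[OF \<eta>1] \<theta>]
  obtain K2 where K2: "\<forall>k\<ge>K2. \<forall>n\<ge>1. \<forall>m. \<forall>\<rho>>0. (1 - \<eta>) * k * n / w \<le> m \<longrightarrow>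
    measure_pmf.prob (replicate_pmf m (edge_pmf h n))
      {es. \<exists>U\<subseteq>{1..n}. (\<rho> * real n \<le> real (card U) \<and> card U / n \<le> \<eta>) \<and>
        size (filter_mset (\<lambda>e. 0 < hits U e) (mset es)) \<le> k * card U \<and> card U \<le> excess (mset es) U} \<le> 2 / (\<rho> * n)"
    by (rule exE)
  show ?thesis
  proof (intro exI[of _ "max K1 K2"] allI impI)
    fix k :: nat assume "max K1 K2 < k"
    then have k: "K1 \<le> k" "K2 \<le> k" "1 \<le> k" by auto
    define P where "P n m = measure_pmf.prob (replicate_pmf m (edge_pmf h n))" for n m
    define top where "top n es = real_of_int (top_surplus h w k {1..n} (mset es))" for n :: nat and es
    define Small where "Small n es \<longleftrightarrow>
      (\<exists>S\<subseteq>{1..n}. (1 \<le> card S \<and> card S / n \<le> 1 - \<eta>) \<and> 0 < surplus h w k (mset es) S)" for n :: nat and es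
    define Big where "Big n es \<longleftrightarrow>
      (\<exists>S\<subseteq>{1..n}. 1 - \<eta> \<le> card S / n \<and> 0 < surplus h w k (mset es) S)" for n :: nat and es
    define Cyc where "Cyc \<rho> n es \<longleftrightarrow>
      (\<exists>U\<subseteq>{1..n}. (\<rho> * real n \<le> real (card U) \<and> card U / n \<le> \<eta>) \<and>
        size (filter_mset (\<lambda>e. 0 < hits U e) (mset es)) \<le> k * card U \<and> card U \<le> excess (mset es) U)" for \<rho> and n :: nat and es
    define T where "T n es \<longleftrightarrow> property_T h w k \<lparr>verts = {1..n}, edges = mset es\<rparr>" for n :: nat and es
    have small: "P n m {es. Small n es} \<le> 2 / n" if "1 \<le> n" "w * m \<le> k * n" for n m
      unfolding P_def Small_def using that k by (intro K1[rule_format])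
    have cyc: "P n m {es. Cyc \<rho> n es} \<le> 2 / (\<rho> * n)" if "1 \<le> n" "0 < \<rho>" "(1 - \<eta>) * k * n / w \<le> m" for n m \<rho>
      unfolding P_def Cyc_def using that k by (intro K2[rule_format])
    have growth: "1 / 2 * P n m {es. Big n es} \<le> P n (m + d) {es. d / 2 \<le> top n es}" if "1 \<le> n" for n m d
      unfolding P_def Big_def top_def using that \<eta>(2) by (intro prob_top_growth w \<eta>(1)) simp_all
    have separated: "min (P n m {es. a \<le> top n es}) (P n m {es. top n es \<le> b}) \<le> 4 * (real m * (real w)\<^sup>2) / (a - b)\<^sup>2"
      if "1 \<le> n" "b < a" for n m a b
      unfolding P_def top_def using that w by (intro prob_top_separated)
    have top_pos: "Small n es \<or> Big n es" if "0 < top n es" "1 \<le> n" for n :: nat and es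
    proof -
      obtain S where S: "S \<subseteq> {1..n}" "surplus h w k (mset es) S = top_surplus h w k {1..n} (mset es)"
        using top_surplus_attained[of "{1..n}"] by blast
      then have pos: "0 < surplus h w k (mset es) S" using that by (simp add: top_def)
      then have "S \<noteq> {}" by auto
      then have "1 \<le> card S" using finite_subset[OF S(1)] by (simp add: Suc_le_eq card_gt_0_iff)
      with S(1) pos show ?thesis unfolding Small_def Big_def by (cases "card S / n \<le> 1 - \<eta>") auto
    qed
    have top_pos_prob: "P n m {es. 0 < top n es} \<le> 2 / n + P n m {es. Big n es}" if "1 \<le> n" "w * m \<le> k * n" for n m
    proof -
      have "P n m {es. 0 < top n es} \<le> P n m {es. Small n es} + P n m {es. Big n es}"
        unfolding P_def using top_pos that by (intro prob_union_supp) auto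
      then show ?thesis using small[OF that] by linarith
    qed
    have many: "0 < top n es" if "1 \<le> n" "k * n < w * m" "es \<in> set_pmf (replicate_pmf m (edge_pmf h n))" for n m es
    proof -
      note sup = replicate_edge_support[OF that(1,3)]
      have "0 < int w * int m - int k * int n" using that(2) by (simp flip: of_nat_mult)
      then have "0 < surplus h w k (mset es) {1..n}"
        using surplus_whole[OF sup(2) w(2), of k] sup(1) by simp
      then show ?thesis
        unfolding top_def using surplus_le_top[of "{1..n}" "{1..n}" h w k "mset es"] by simp
    qed
    have many_prob: "P n m {es. 0 < top n es} = 1" if "1 \<le> n" "k * n < w * m" for n m
      unfolding P_def using many[OF that] by (subst measure_pmf.prob_eq_1) (auto simp: AE_measure_pmf_iff)
    define m\<^sub>0 where "m\<^sub>0 n = (LEAST m. 1 / 2 \<le> P n m {es. 0 < top n es})" for n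
    have m\<^sub>0: "1 / 2 \<le> P n (m\<^sub>0 n) {es. 0 < top n es}" if "1 \<le> n" for n
      unfolding m\<^sub>0_def
    proof (rule LeastI)
      show "1 / 2 \<le> P n (k * n + 1) {es. 0 < top n es}"
      proof -
        have "k * n < 1 * (k * n + 1)" by simp
        also have "\<dots> \<le> w * (k * n + 1)" using w by (intro mult_le_mono1) simp
        finally have "k * n < w * (k * n + 1)" .
        from many_prob[OF that this] show ?thesis by linarith
      qed
    qed
    have m\<^sub>0_min: "P n m {es. 0 < top n es} < 1 / 2" if "m < m\<^sub>0 n" for n m
      using not_less_Least[of m "\<lambda>m. 1 / 2 \<le> P n m {es. 0 < top n es}"] that unfolding m\<^sub>0_def by simp
    have before: "w * m \<le> k * n" if "1 \<le> n" "m < m\<^sub>0 n" for n m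
      using many_prob[OF that(1), of m] m\<^sub>0_min[OF that(2)] by linarith
    define c where "c = (1 - \<eta>) * k / w"
    have c: "0 < c" using \<eta>1 k w by (simp add: c_def)
    have m\<^sub>0_ge: "c * n \<le> m\<^sub>0 n" if n: "5 \<le> n" for n
    proof (cases "w * m\<^sub>0 n \<le> k * n")
      case True
      \<comment> \<open>Some outcome with \<open>m\<^sub>0 n\<close> edges has a set of positive
        surplus on at least \<open>(1 - \<eta>) * n\<close> vertices. As an edge contributes at most
        \<open>w\<close>, this forces
        \<open>k * (1 - \<eta>) * n \<le> w * m\<^sub>0 n\<close>.\<close>
      have "2 / real n < 1 / 2" using n by (simp add: field_simps)
      then have "P n (m\<^sub>0 n) {es. Big n es} \<noteq> 0"
        using top_pos_prob[OF _ True] m\<^sub>0[of n] n by linarith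
      then have "set_pmf (replicate_pmf (m\<^sub>0 n) (edge_pmf h n)) \<inter> {es. Big n es} \<noteq> {}"
        unfolding P_def measure_pmf_zero_iff .
      then obtain es where es: "es \<in> set_pmf (replicate_pmf (m\<^sub>0 n) (edge_pmf h n))" "Big n es" by blast
      then obtain S where S: "S \<subseteq> {1..n}" "1 - \<eta> \<le> card S / n" "0 < surplus h w k (mset es) S"
        by (auto simp: Big_def)
      have sup: "length es = m\<^sub>0 n" "uniform_on h {1..n} (mset es)"
        using replicate_edge_support[OF _ es(1)] n by auto
      have "(\<Sum>e\<in>#mset es. int (hits S e - (h - w))) \<le> (\<Sum>e\<in>#mset es. int w)"
      proof (rule sum_mset_mono)
        fix e assume "e \<in># mset es"
        then have "hits S e \<le> h" using sup(2) hits_le_size[of S e] by (simp add: uniform_on_def)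
        then show "int (hits S e - (h - w)) \<le> int w" using w by simp
      qed
      then have "int (k * card S) \<le> int (w * m\<^sub>0 n)" using S(3) sup(1) by (simp add: surplus_def mult.commute)
      then have "real (k * card S) \<le> real (w * m\<^sub>0 n)" by (simp only: of_nat_le_iff)
      moreover have "real k * ((1 - \<eta>) * n) \<le> real k * real (card S)"
        using S(2) n by (intro mult_left_mono) (auto simp: field_simps)
      ultimately have "k * ((1 - \<eta>) * n) \<le> w * real (m\<^sub>0 n)" by simp
      then show ?thesis using w by (simp add: c_def field_simps)
    next
      case False
      then have "real (k * n) \<le> real (w * m\<^sub>0 n)" by (simp only: of_nat_le_iff)
      moreover have "(1 - \<eta>) * real (k * n) \<le> 1 * real (k * n)" using \<eta> by (intro mult_right_mono) auto
      ultimately have "(1 - \<eta>) * real (k * n) \<le> real (w * m\<^sub>0 n)" by linarith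
      then show ?thesis using w by (simp add: c_def field_simps)
    qed
    show "\<exists>m\<^sub>0 :: nat \<Rightarrow> nat. \<forall>\<epsilon> :: real. 0 < \<epsilon> \<and> \<epsilon> < 1 \<longrightarrow> (\<exists>D::real. \<forall>\<^sub>F n in sequentially. \<forall>m.
     (real m \<le> (1 - \<epsilon>) * m\<^sub>0 n \<longrightarrow> w * m \<le> k * n \<and>
        measure_pmf.prob (replicate_pmf m (edge_pmf h n))
          {es. \<not> property_T h w k \<lparr>verts = {1..n}, edges = mset es\<rparr>} \<le> D / n) \<and>
     ((1 + \<epsilon>) * m\<^sub>0 n \<le> real m \<longrightarrow> w * m \<le> k * n \<longrightarrow>
        measure_pmf.prob (replicate_pmf m (edge_pmf h n))
          {es. property_T h w k \<lparr>verts = {1..n}, edges = mset es\<rparr>} \<le> D / n))"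
      unfolding T_def[symmetric] P_def[symmetric]
    proof (intro exI[of _ m\<^sub>0] allI impI)
      fix \<epsilon> :: real assume "0 < \<epsilon> \<and> \<epsilon> < 1"
      then have \<epsilon>: "0 < \<epsilon>" "\<epsilon> < 1" by auto
      \<comment> \<open>Makes \<open>C / n\<close> the Chebyshev bound for a gap of
        \<open>\<epsilon> * c * n / 4\<close> when \<open>w * m \<le> k * n\<close>; the factor 64
        is 4 * 16.\<close>
      define C where "C = 64 * k * w / (\<epsilon> * c)\<^sup>2"
      \<comment> \<open>A maximum above \<open>\<epsilon> * c * n / 4\<close> forces the overshoot
        to contain at least this fraction of the vertices.\<close>
      define \<rho> where "\<rho> = \<epsilon> * c / (4 * k)"
      have C: "0 < C" and \<rho>: "0 < \<rho>" using k w \<epsilon> c by (auto simp: C_def \<rho>_def)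
      define D where "D = 2 + 2 * C + 2 / \<rho>"
      have var_bound: "4 * (real m * (real w)\<^sup>2) / x\<^sup>2 \<le> C / n" if "w * m \<le> k * n" "\<epsilon> * c * n / 4 \<le> x" "1 \<le> n" for m n :: nat and x
      proof -
        have "0 < \<epsilon> * c * n / 4" using \<epsilon> c that by simp
        have "real (w * m) \<le> real (k * n)" using that(1) by (simp only: of_nat_le_iff)
        then have "4 * real w * (real w * real m) \<le> 4 * real w * (real k * real n)" by (intro mult_left_mono) auto
        moreover have "(\<epsilon> * c * n / 4)\<^sup>2 \<le> x\<^sup>2"
          using that \<open>0 < \<epsilon> * c * n / 4\<close> by (intro power_mono) auto
        moreover have "0 < (\<epsilon> * c * n / 4)\<^sup>2"
          using \<open>0 < \<epsilon> * c * n / 4\<close> by (rule zero_less_power)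
        moreover have "0 \<le> 4 * real w * (real k * real n)" by simp
        ultimately have "4 * real w * (real w * real m) / x\<^sup>2 \<le> 4 * real w * (real k * real n) / (\<epsilon> * c * n / 4)\<^sup>2"
          by - (rule frac_le; assumption)
        also have "\<dots> = C / n" using that \<epsilon> c by (simp add: C_def field_simps power2_eq_square)
        finally show ?thesis by (simp add: power2_eq_square mult_ac)
      qed
      have "\<forall>\<^sub>F n in sequentially. max (max 8 (8 * C + 1)) (2 / (\<epsilon> * c)) \<le> real n"
        using filterlim_real_sequentially unfolding filterlim_at_top by blast
      then show "\<exists>D. \<forall>\<^sub>F n in sequentially. \<forall>m.
          (real m \<le> (1 - \<epsilon>) * m\<^sub>0 n \<longrightarrow> w * m \<le> k * n \<and> P n m {es. \<not> T n es} \<le> D / n) \<and>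
          ((1 + \<epsilon>) * m\<^sub>0 n \<le> real m \<longrightarrow> w * m \<le> k * n \<longrightarrow> P n m {es. T n es} \<le> D / n)"
      proof (intro exI[of _ D], eventually_elim, intro allI conjI impI)
        fix n m :: nat
        assume n_large: "max (max 8 (8 * C + 1)) (2 / (\<epsilon> * c)) \<le> real n"
        then have n: "8 \<le> n" "1 \<le> n" "5 \<le> n" by auto
        have "8 * C < n" using n_large by simp
        then have Cn: "C / n < 1 / 8" using n by (simp add: field_simps)
        have "2 / (\<epsilon> * c) \<le> n" using n_large by simp
        then have \<epsilon>cn: "2 \<le> \<epsilon> * c * n" using \<epsilon> c by (simp add: field_simps)
        have "\<epsilon> * (c * n) \<le> \<epsilon> * m\<^sub>0 n" using m\<^sub>0_ge[OF n(3)] \<epsilon> by (intro mult_left_mono) auto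
        then have \<epsilon>m: "\<epsilon> * c * n \<le> \<epsilon> * m\<^sub>0 n" by simp
        {
          assume below: "real m \<le> (1 - \<epsilon>) * m\<^sub>0 n"
          then have "\<epsilon> * m\<^sub>0 n \<le> real (m\<^sub>0 n) - real m" by (simp add: algebra_simps)
          with \<epsilon>m \<epsilon>cn have gap: "2 \<le> real (m\<^sub>0 n) - real m" "\<epsilon> * c * n \<le> real (m\<^sub>0 n) - real m" by linarith+
          then have "m < m\<^sub>0 n" by simp
          from before[OF n(2) this] show wm: "w * m \<le> k * n" .
          \<comment> \<open>The target is \<open>m\<^sub>0 n - 1\<close>, the last count before the
            median; since the gap is at least 2, \<open>d\<close> is still at least half of
            it.\<close>
          define d where "d = m\<^sub>0 n - 1 - m"
          have d: "m\<^sub>0 n - 1 = m + d" "real d = real (m\<^sub>0 n) - real m - 1" using \<open>m < m\<^sub>0 n\<close> by (auto simp: d_def)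
          have wd: "w * (m + d) \<le> k * n" using before[OF n(2), of "m + d"] d \<open>m < m\<^sub>0 n\<close> by simp
          \<comment> \<open>If \<open>Big\<close> were likely at \<open>m\<close>, growth would make
            a linear surplus likely at \<open>m + d\<close>, where a nonpositive maximum still has
            probability above 1/2; concentration rules this out.\<close>
          have "1 / 2 * P n m {es. Big n es} \<le> C / n"
          proof -
            have "UNIV - {es. 0 < top n es} = {es. top n es \<le> 0}" by auto
            then have "P n (m + d) {es. top n es \<le> 0} = 1 - P n (m + d) {es. 0 < top n es}"
              using measure_pmf.prob_compl[of "{es. 0 < top n es}" "replicate_pmf (m + d) (edge_pmf h n)"]
              unfolding P_def by simp
            moreover have "P n (m + d) {es. 0 < top n es} < 1 / 2"
              using m\<^sub>0_min[of "m + d" n] d \<open>m < m\<^sub>0 n\<close> by simp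
            ultimately have half: "1 / 2 < P n (m + d) {es. top n es \<le> 0}" by linarith
            have "min (P n (m + d) {es. d / 2 \<le> top n es}) (P n (m + d) {es. top n es \<le> 0}) \<le> C / n"
            proof (rule order_trans[OF separated])
              show "4 * (real (m + d) * (real w)\<^sup>2) / (real d / 2 - 0)\<^sup>2 \<le> C / n"
                using wd n(2) gap d(2) by (intro var_bound) auto
            qed (use gap d(2) n in auto)
            then have "P n (m + d) {es. d / 2 \<le> top n es} \<le> C / n" using half Cn by linarith
            then show ?thesis using growth[OF n(2), of m d] by linarith
          qed
          moreover have "P n m {es. 0 < top n es} \<le> 2 / n + P n m {es. Big n es}"
            by (rule top_pos_prob[OF n(2) wm])
          moreover have "P n m {es. \<not> T n es} \<le> P n m {es. 0 < top n es}"
            unfolding P_def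
          proof (rule prob_mono_supp)
            fix es assume es: "es \<in> set_pmf (replicate_pmf m (edge_pmf h n))" "es \<in> {es. \<not> T n es}"
            then have "\<not> top_surplus h w k {1..n} (mset es) \<le> 0"
              using property_T_if_top_le_0[OF finite_atLeastAtMost replicate_edge_support(2)[OF n(2) es(1)] w, of k]
              unfolding T_def by blast
            then show "es \<in> {es. 0 < top n es}" by (simp add: top_def)
          qed
          ultimately have "P n m {es. \<not> T n es} \<le> 2 / n + 2 * (C / n)" by linarith
          also have "\<dots> \<le> D / n"
            using \<rho> n by (simp add: D_def add_divide_distrib)
          finally show "P n m {es. \<not> T n es} \<le> D / n" .
        next
          assume above: "(1 + \<epsilon>) * m\<^sub>0 n \<le> real m" and wm: "w * m \<le> k * n"
          then have "\<epsilon> * m\<^sub>0 n \<le> real m - real (m\<^sub>0 n)" by (simp add: algebra_simps)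
          with \<epsilon>m \<epsilon>cn have gap: "2 \<le> real m - real (m\<^sub>0 n)" "\<epsilon> * c * n \<le> real m - real (m\<^sub>0 n)" by linarith+
          define d where "d = m - m\<^sub>0 n"
          have d: "m = m\<^sub>0 n + d" "real d = real m - real (m\<^sub>0 n)"
          proof -
            have "m\<^sub>0 n \<le> m" using gap(1) by linarith
            then show "m = m\<^sub>0 n + d" "real d = real m - real (m\<^sub>0 n)" by (simp_all add: d_def)
          qed
          have "w * m\<^sub>0 n \<le> k * n"
            using wm mult_le_mono2[of "m\<^sub>0 n" m w] d(1) by linarith
          from top_pos_prob[OF n(2) this] m\<^sub>0[OF n(2)]
          have "1 / 2 - 2 / n \<le> P n (m\<^sub>0 n) {es. Big n es}" by linarith
          moreover have "2 / real n \<le> 1 / 4" using n by (simp add: field_simps)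
          \<comment> \<open>At \<open>m\<^sub>0 n\<close> edges a big set has probability at least
            1/4, and growth retains half of that. As \<open>C / n < 1 / 8\<close>, concentration
            then makes a maximum of at most \<open>d / 4\<close> unlikely.\<close>
          ultimately have eighth: "1 / 8 \<le> P n m {es. d / 2 \<le> top n es}"
            using growth[OF n(2), of "m\<^sub>0 n" d] unfolding d(1)[symmetric] by linarith
          have "min (P n m {es. d / 2 \<le> top n es}) (P n m {es. top n es \<le> d / 4}) \<le> C / n"
          proof (rule order_trans[OF separated])
            show "4 * (real m * (real w)\<^sup>2) / (real d / 2 - real d / 4)\<^sup>2 \<le> C / n"
              using wm n(2) gap d(2) by (intro var_bound) auto
          qed (use gap d(2) n in auto)
          then have low: "P n m {es. top n es \<le> d / 4} \<le> C / n" using eighth Cn by linarith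
          \<comment> \<open>With a maximum above \<open>d / 4\<close>, the property can hold only
            through a large overshoot \<open>U\<close>. The set \<open>S\<close> that comes with it
            is either too small, which is the event \<open>Small\<close>, or so large that
            \<open>U\<close> witnesses \<open>Cyc\<close>.\<close>
          have "P n m {es. T n es} \<le> P n m {es. top n es \<le> d / 4} + P n m {es. Small n es \<or> Cyc \<rho> n es}"
            unfolding P_def
          proof (rule prob_union_supp)
            fix es assume es: "es \<in> set_pmf (replicate_pmf m (edge_pmf h n))" "es \<in> {es. T n es}"
            note sup = replicate_edge_support(2)[OF n(2) es(1)]
            show "es \<in> {es. top n es \<le> d / 4} \<or> es \<in> {es. Small n es \<or> Cyc \<rho> n es}"
            proof (cases "top n es \<le> d / 4")
              case False
              then have "0 < top_surplus h w k {1..n} (mset es)" using gap d(2) by (simp add: top_def)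
              then obtain S U where S: "S \<subseteq> {1..n}" "0 < surplus h w k (mset es) S"
                and U: "U \<subseteq> {1..n} - S" "top_surplus h w k {1..n} (mset es) \<le> int k * int (card U)"
                  "size (filter_mset (\<lambda>e. 0 < hits U e) (mset es)) \<le> k * card U" "card U \<le> excess (mset es) U"
                using property_T_overshoot[OF finite_atLeastAtMost sup w, of k] es(2)
                unfolding T_def mem_Collect_eq by blast
              have fin: "finite S" "finite U" using S(1) U(1) by (auto intro: finite_subset)
              show ?thesis
              proof (cases "card S / n \<le> 1 - \<eta>")
                case True
                have "S \<noteq> {}" using S(2) by auto
                then have "1 \<le> card S" using fin by (simp add: Suc_le_eq card_gt_0_iff)
                with True S have "Small n es" unfolding Small_def by blast
                then show ?thesis by simp
              next
                case big: False
                have "card U + card S \<le> n"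
                proof -
                  have "card (U \<union> S) \<le> card {1..n}" using S(1) U(1) by (intro card_mono) auto
                  moreover have "U \<inter> S = {}" using U(1) by blast
                  ultimately show ?thesis using card_Un_disjoint[OF fin(2,1)] by simp
                qed
                then have "real (card U) / n + real (card S) / n \<le> 1"
                  using n by (simp flip: add_divide_distrib)
                then have U\<eta>: "card U / n \<le> \<eta>" using big by linarith
                have "real_of_int (top_surplus h w k {1..n} (mset es)) \<le> real_of_int (int k * int (card U))"
                  using U(2) by (simp only: of_int_le_iff)
                then have "d / 4 \<le> k * card U" using False by (simp add: top_def)
                then have "\<epsilon> * c * n / 4 \<le> k * card U" using gap d by linarith
                then have "\<rho> * n \<le> card U" using k by (simp add: \<rho>_def field_simps)
                with U U\<eta> have "Cyc \<rho> n es" unfolding Cyc_def by blast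
                then show ?thesis by simp
              qed
            qed simp
          qed
          moreover have "P n m {es. Small n es \<or> Cyc \<rho> n es} \<le> P n m {es. Small n es} + P n m {es. Cyc \<rho> n es}"
            unfolding P_def by (rule prob_union_supp) auto
          moreover have "(1 - \<eta>) * k * n / w \<le> m"
            using m\<^sub>0_ge[OF n(3)] gap by (simp add: c_def)
          ultimately have "P n m {es. T n es} \<le> C / n + 2 / n + 2 / (\<rho> * n)"
            using low small[OF n(2) wm] cyc[OF n(2) \<rho>, of m] by linarith
          also have "\<dots> \<le> D / n"
            using C n by (simp add: D_def add_divide_distrib divide_right_mono)
          finally show "P n m {es. T n es} \<le> D / n" .
        }
      qed
    qed
  qed
qed

subsection \<open>Transfer to simple hypergraphs\<close>

lemma multi_model_eq:
  "multi_model h n m = map_pmf (\<lambda>es. \<lparr>verts = {1..n}, edges = mset es\<rparr>) (replicate_pmf m (edge_pmf h n))"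
  by (simp add: multi_model_def edge_pmf_def)

lemma simple_hypergraphsD:
  assumes "H \<in> simple_hypergraphs h n m"
  obtains E where "H = \<lparr>verts = {1..n}, edges = E\<rparr>" "size E = m" "uniform_on h {1..n} E"
    "\<forall>e. count E e \<le> 1" "\<forall>e\<in>#E. \<forall>v. count e v \<le> 1"
proof -
  obtain E where "H = \<lparr>verts = {1..n}, edges = E\<rparr>" "size E = m" "\<forall>e. count E e \<le> 1" "uniform_on h {1..n} E"
    "\<forall>e\<in>#E. \<forall>v. count e v \<le> 1"
    using assms unfolding simple_hypergraphs_def uniform_on_def by blast
  then show thesis by (intro that) auto
qed

text \<open>Edges can be listed in \<open>fact m\<close> orders and the vertices of each in
  \<open>fact h\<close>, so all simple hypergraphs are equally likely; conditioning on simplicity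
  thus gives the uniform model.\<close>

lemma pmf_multi_model_simple:
  assumes n: "1 \<le> n" and H: "H \<in> simple_hypergraphs h n m"
  shows "pmf (multi_model h n m) H = fact m * (fact h * (1 / n) ^ h) ^ m"
proof -
  obtain E where E: "H = \<lparr>verts = {1..n}, edges = E\<rparr>" "size E = m" "uniform_on h {1..n} E"
    "\<forall>e. count E e \<le> 1" "\<forall>e\<in>#E. \<forall>v. count e v \<le> 1"
    using H by (rule simple_hypergraphsD)
  have edge: "pmf (edge_pmf h n) e = fact h * (1 / n) ^ h" if "e \<in># E" for e
    unfolding edge_pmf_def
  proof (rule pmf_mset_replicate_pmf)
    show "size e = h" using E(3) that by (simp add: uniform_on_def)
    show "pmf (pmf_of_set {1..n}) x = 1 / n" if "x \<in># e" for x
    proof -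
      have "x \<in> {1..n}" using E(3) \<open>e \<in># E\<close> that unfolding uniform_on_def by blast
      then show ?thesis using n by (subst pmf_of_set) auto
    qed
  qed (use E(5) that in blast)
  have "multi_model h n m = map_pmf (\<lambda>E. \<lparr>verts = {1..n}, edges = E\<rparr>) (map_pmf mset (replicate_pmf m (edge_pmf h n)))"
    by (simp add: multi_model_eq pmf.map_comp o_def)
  then have "pmf (multi_model h n m) H = pmf (map_pmf mset (replicate_pmf m (edge_pmf h n))) E"
    unfolding E(1) by (simp only:) (rule pmf_map_inj', simp add: inj_on_def)
  also have "\<dots> = fact m * (fact h * (1 / n) ^ h) ^ m"
    by (rule pmf_mset_replicate_pmf[OF E(2) E(4)[rule_format] edge])
  finally show ?thesis .
qed

text \<open>Repetition-free sampling is used twice: a vertex repeats within an edge with probability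
  at most \<open>h\<^sup>2 / n\<close>, and then the \<open>m\<close> edges have to be distinct. For
  \<open>m\<close> linear in \<open>n\<close> the base is \<open>1 - O(1 / n)\<close>, so its power
  stays bounded away from 0.\<close>

lemma prob_multi_model_simple_ge:
  fixes h n m :: nat
  assumes n: "1 \<le> n" and h: "2 \<le> h" and small: "(real h)\<^sup>2 / n + m * (fact h / (real n)\<^sup>2) \<le> 1"
  shows "(1 - (real h)\<^sup>2 / n - m * (fact h / (real n)\<^sup>2)) ^ m \<le>
    measure_pmf.prob (multi_model h n m) (simple_hypergraphs h n m)"
proof -
  define G where "G e \<longleftrightarrow> size e = h \<and> set_mset e \<subseteq> {1..n} \<and> (\<forall>v. count e v \<le> 1)" for e
  have "h * (1 / n) \<le> (real h)\<^sup>2 / n" using h by (simp add: power2_eq_square divide_right_mono)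
  also have "\<dots> \<le> (real h)\<^sup>2 / n + m * (fact h / (real n)\<^sup>2)" by simp
  finally have hn: "h * (1 / n) \<le> 1" using small by linarith
  have "1 - (real h)\<^sup>2 / n \<le> measure_pmf.prob (edge_pmf h n) {e. G e}"
  proof -
    have "1 - (real h)\<^sup>2 / n = 1 + real h * (- (h * (1 / n)))" by (simp add: power2_eq_square)
    also have "\<dots> \<le> (1 + - (h * (1 / n))) ^ h" using hn by (intro Bernoulli_inequality) simp
    also have "\<dots> = (1 - 0 - real h * (1 / n)) ^ h" by simp
    also have "\<dots> \<le> measure_pmf.prob (replicate_pmf h (pmf_of_set {1..n})) {xs. distinct xs \<and> (\<forall>x\<in>set xs. True)}"
    proof (rule prob_distinct_ge)
      show "pmf (pmf_of_set {1..n}) x \<le> 1 / n" for x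
        using n by (subst pmf_of_set) (auto simp: indicator_def)
    qed (use n hn in auto)
    also have "\<dots> \<le> measure_pmf.prob (replicate_pmf h (pmf_of_set {1..n})) (mset -` {e. G e})"
    proof (rule prob_mono_supp)
      fix xs assume "xs \<in> set_pmf (replicate_pmf h (pmf_of_set {1..n}))" "xs \<in> {xs. distinct xs \<and> (\<forall>x\<in>set xs. True)}"
      then show "xs \<in> mset -` {e. G e}"
        using n by (auto simp: G_def set_replicate_pmf distinct_count_atmost_1)
    qed
    also have "\<dots> = measure_pmf.prob (edge_pmf h n) {e. G e}" by (simp add: edge_pmf_def)
    finally show ?thesis .
  qed
  moreover have "pmf (edge_pmf h n) e \<le> fact h / (real n)\<^sup>2" if "G e" for e
  proof -
    have "pmf (edge_pmf h n) e = fact h * (1 / n) ^ h"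
      unfolding edge_pmf_def
    proof (rule pmf_mset_replicate_pmf)
      show "pmf (pmf_of_set {1..n}) x = 1 / n" if "x \<in># e" for x
      proof -
        have "x \<in> {1..n}" using \<open>G e\<close> that unfolding G_def by blast
        then show ?thesis using n by (subst pmf_of_set) auto
      qed
    qed (use that in \<open>auto simp: G_def\<close>)
    \<comment> \<open>By \<open>h \<ge> 2\<close> a given edge has probability of order at most
      \<open>1 / n\<^sup>2\<close>, so repeating one of linearly many edges costs only
      \<open>O(1 / n)\<close> per draw.\<close>
    also have "\<dots> \<le> fact h * (1 / n)\<^sup>2" using n h by (intro mult_left_mono power_decreasing) auto
    finally show ?thesis by (simp add: power_one_over)
  qed
  ultimately have "(1 - (real h)\<^sup>2 / n - m * (fact h / (real n)\<^sup>2)) ^ m \<le>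
      measure_pmf.prob (replicate_pmf m (edge_pmf h n)) {es. distinct es \<and> (\<forall>e\<in>set es. G e)}"
    using finite_set_edge_pmf[OF n] small by (intro prob_distinct_ge) auto
  also have "\<dots> \<le> measure_pmf.prob (replicate_pmf m (edge_pmf h n))
      ((\<lambda>es. \<lparr>verts = {1..n}, edges = mset es\<rparr>) -` simple_hypergraphs h n m)"
  proof (rule prob_mono_supp)
    fix es assume "es \<in> set_pmf (replicate_pmf m (edge_pmf h n))" "es \<in> {es. distinct es \<and> (\<forall>e\<in>set es. G e)}"
    moreover from this have "length es = m" using replicate_edge_support(1)[OF n] by blast
    ultimately show "es \<in> (\<lambda>es. \<lparr>verts = {1..n}, edges = mset es\<rparr>) -` simple_hypergraphs h n m"
      by (auto simp: simple_hypergraphs_def G_def distinct_count_atmost_1)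
  qed
  also have "\<dots> = measure_pmf.prob (multi_model h n m) (simple_hypergraphs h n m)"
    by (simp add: multi_model_eq)
  finally show ?thesis .
qed

text \<open>The simple model is the multihypergraph model conditioned on a set of probability at
  least \<open>\<gamma>\<close>, and conditioning enlarges probabilities by at most the factor
  \<open>1 / \<gamma>\<close>.\<close>

lemma prob_simple_model_le:
  assumes n: "1 \<le> n" and ne: "simple_hypergraphs h n m \<noteq> {}"
    and \<gamma>: "0 < \<gamma>" "\<gamma> \<le> measure_pmf.prob (multi_model h n m) (simple_hypergraphs h n m)"
  shows "measure_pmf.prob (simple_model h n m) B \<le> measure_pmf.prob (multi_model h n m) B / \<gamma>"
proof -
  let ?S = "simple_hypergraphs h n m" and ?\<kappa> = "fact m * (fact h * (1 / n) ^ h) ^ m :: real"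
  note fin = finite_simple_hypergraphs[of h n m]
  have eq: "measure_pmf.prob (multi_model h n m) A = card A * ?\<kappa>" if "A \<subseteq> ?S" for A
  proof -
    have "measure_pmf.prob (multi_model h n m) A = (\<Sum>H\<in>A. pmf (multi_model h n m) H)"
      using finite_subset[OF that fin] by (rule measure_measure_pmf_finite)
    also have "\<dots> = (\<Sum>H\<in>A. ?\<kappa>)" using that by (intro sum.cong refl pmf_multi_model_simple[OF n]) auto
    finally show ?thesis by simp
  qed
  have "measure_pmf.prob (simple_model h n m) B * \<gamma> \<le> measure_pmf.prob (simple_model h n m) B * (card ?S * ?\<kappa>)"
    using \<gamma>(2) unfolding eq[OF order_refl] by (intro mult_left_mono) auto
  also have "\<dots> = card (?S \<inter> B) * ?\<kappa>"
    unfolding simple_model_def using ne fin by (simp add: measure_pmf_of_set)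
  also have "\<dots> = measure_pmf.prob (multi_model h n m) (?S \<inter> B)" by (rule eq[symmetric]) auto
  also have "\<dots> \<le> measure_pmf.prob (multi_model h n m) B" by (intro measure_pmf.finite_measure_mono) auto
  finally show ?thesis using \<gamma>(1) by (simp add: field_simps)
qed

lemma exp_le_one_minus:
  fixes x :: real
  assumes "0 \<le> x" "x \<le> 1 / 2"
  shows "exp (- (2 * x)) \<le> 1 - x"
proof -
  have "1 \<le> (1 - x) * (1 + 2 * x)"
    using mult_nonneg_nonneg[of x "1 - 2 * x"] assms by (simp add: algebra_simps)
  also have "\<dots> \<le> (1 - x) * exp (2 * x)" using assms by (intro mult_left_mono exp_ge_add_one_self) auto
  finally show ?thesis by (simp add: exp_minus field_simps)
qed

lemma simple_model_contiguous:
  fixes h w k :: nat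
  assumes w: "0 < w" and h: "2 \<le> h"
  shows "\<exists>\<gamma>>0. \<forall>\<^sub>F n in sequentially. \<forall>m B. w * m \<le> k * n \<longrightarrow> simple_hypergraphs h n m \<noteq> {} \<longrightarrow>
    measure_pmf.prob (simple_model h n m) B \<le> measure_pmf.prob (multi_model h n m) B / \<gamma>"
proof -
  \<comment> \<open>\<open>C / n\<close> bounds the failure probability of one draw, and there are
    at most \<open>k / w * n\<close> draws.\<close>
  define C :: real where "C = (real h)\<^sup>2 + k / w * fact h"
  have C: "0 \<le> C" by (simp add: C_def)
  define \<gamma> where "\<gamma> = exp (- (2 * C * (k / w)))"
  have "\<forall>\<^sub>F n in sequentially. max 1 (2 * C) \<le> real n"
    using filterlim_real_sequentially unfolding filterlim_at_top by blast
  then have "\<forall>\<^sub>F n in sequentially. \<forall>m B. w * m \<le> k * n \<longrightarrow> simple_hypergraphs h n m \<noteq> {} \<longrightarrow>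
    measure_pmf.prob (simple_model h n m) B \<le> measure_pmf.prob (multi_model h n m) B / \<gamma>"
  proof (eventually_elim, intro allI impI)
    fix n m B assume "max 1 (2 * C) \<le> real n" and wm: "w * m \<le> k * n" and ne: "simple_hypergraphs h n m \<noteq> {}"
    then have n: "1 \<le> n" "2 * C \<le> n" by auto
    have "real (w * m) \<le> real (k * n)" using wm by (simp only: of_nat_le_iff)
    then have m: "real m \<le> k / w * n" using w by (simp add: field_simps)
    have x: "0 \<le> C / n" "C / n \<le> 1 / 2" using n C by (auto simp: field_simps)
    have "m * (fact h / (real n)\<^sup>2) \<le> k / w * n * (fact h / (real n)\<^sup>2)"
      using m by (intro mult_right_mono) auto
    also have "\<dots> = k / w * fact h / n" using n by (simp add: power2_eq_square)
    finally have le: "(real h)\<^sup>2 / n + m * (fact h / (real n)\<^sup>2) \<le> C / n"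
      by (simp add: C_def add_divide_distrib)
    have "\<gamma> \<le> exp (- (2 * (C / n) * m))"
    proof -
      have "2 * (C / n) * m \<le> 2 * (C / n) * (k / w * n)" using m x by (intro mult_left_mono) auto
      also have "\<dots> = 2 * C * (k / w)" using n by simp
      finally show ?thesis by (simp add: \<gamma>_def)
    qed
    also have "\<dots> = exp (- (2 * (C / n))) ^ m" by (simp add: mult_ac flip: exp_of_nat_mult)
    also have "\<dots> \<le> (1 - C / n) ^ m" using x by (intro power_mono exp_le_one_minus) auto
    also have "\<dots> \<le> (1 - (real h)\<^sup>2 / n - m * (fact h / (real n)\<^sup>2)) ^ m"
      using le x by (intro power_mono) linarith+
    also have "\<dots> \<le> measure_pmf.prob (multi_model h n m) (simple_hypergraphs h n m)"
      using le x by (intro prob_multi_model_simple_ge n h) linarith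
    finally show "measure_pmf.prob (simple_model h n m) B \<le> measure_pmf.prob (multi_model h n m) B / \<gamma>"
      by (intro prob_simple_model_le n ne) (simp add: \<gamma>_def)
  qed
  then show ?thesis by (intro exI[of _ \<gamma>]) (simp add: \<gamma>_def)
qed

section \<open>The threshold function in both models\<close>

lemma sharp_thresholdI:
  assumes f: "\<And>n. 0 \<le> f n"
    and tails: "\<And>\<epsilon>. 0 < \<epsilon> \<Longrightarrow> \<epsilon> < 1 \<Longrightarrow> \<exists>D::real. \<forall>\<^sub>F n in sequentially. \<forall>m\<in>A n.
      (real m \<le> (1 - \<epsilon>) * f n \<longrightarrow> measure_pmf.prob (X n m) {H. \<not> P H} \<le> D / n) \<and>
      ((1 + \<epsilon>) * f n \<le> real m \<longrightarrow> measure_pmf.prob (X n m) {H. P H} \<le> D / n)"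
  shows "sharp_threshold A X P f"
  unfolding sharp_threshold_def
proof (intro allI impI)
  fix \<epsilon> \<delta> :: real assume "0 < \<epsilon>" "0 < \<delta>"
  \<comment> \<open>The tails are given for values below 1; as \<open>f\<close> is nonnegative, a
    smaller \<open>\<epsilon>\<close> covers more values of \<open>m\<close> on both sides.\<close>
  define \<epsilon>' where "\<epsilon>' = min \<epsilon> (1 / 2)"
  have \<epsilon>': "0 < \<epsilon>'" "\<epsilon>' < 1" "\<epsilon>' \<le> \<epsilon>" using \<open>0 < \<epsilon>\<close> by (auto simp: \<epsilon>'_def)
  from tails[OF \<epsilon>'(1,2)] obtain D where D: "\<forall>\<^sub>F n in sequentially. \<forall>m\<in>A n.
      (real m \<le> (1 - \<epsilon>') * f n \<longrightarrow> measure_pmf.prob (X n m) {H. \<not> P H} \<le> D / n) \<and>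
      ((1 + \<epsilon>') * f n \<le> real m \<longrightarrow> measure_pmf.prob (X n m) {H. P H} \<le> D / n)" by blast
  have "(\<lambda>n. D / real n) \<longlonglongrightarrow> 0" by (rule lim_const_over_n)
  then have "\<forall>\<^sub>F n in sequentially. D / real n < \<delta>" using \<open>0 < \<delta>\<close> by (rule order_tendstoD)
  with D show "\<forall>\<^sub>F n in sequentially. \<forall>m\<in>A n.
        (real m \<le> (1 - \<epsilon>) * f n \<longrightarrow> measure_pmf.prob (X n m) {H. P H} > 1 - \<delta>) \<and>
        (real m \<ge> (1 + \<epsilon>) * f n \<longrightarrow> measure_pmf.prob (X n m) {H. P H} < \<delta>)"
  proof (eventually_elim, intro ballI conjI impI)
    fix n m assume H: "\<forall>m\<in>A n.
      (real m \<le> (1 - \<epsilon>') * f n \<longrightarrow> measure_pmf.prob (X n m) {H. \<not> P H} \<le> D / n) \<and>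
      ((1 + \<epsilon>') * f n \<le> real m \<longrightarrow> measure_pmf.prob (X n m) {H. P H} \<le> D / n)"
      and \<delta>: "D / real n < \<delta>" and m: "m \<in> A n"
    {
      assume "real m \<le> (1 - \<epsilon>) * f n"
      also have "\<dots> \<le> (1 - \<epsilon>') * f n" using \<epsilon>' f by (intro mult_right_mono) auto
      finally have "measure_pmf.prob (X n m) {H. \<not> P H} \<le> D / n" using H m by blast
      moreover have "measure_pmf.prob (X n m) {H. \<not> P H} = 1 - measure_pmf.prob (X n m) {H. P H}"
        using measure_pmf.prob_compl[of "{H. P H}" "X n m"] by (simp add: Collect_neg_eq Compl_eq_Diff_UNIV)
      ultimately show "measure_pmf.prob (X n m) {H. P H} > 1 - \<delta>" using \<delta> by linarith
    next
      have "(1 + \<epsilon>') * f n \<le> (1 + \<epsilon>) * f n" using \<epsilon>' f by (intro mult_right_mono) auto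
      also assume "(1 + \<epsilon>) * f n \<le> real m"
      finally have "measure_pmf.prob (X n m) {H. P H} \<le> D / n" using H m by blast
      then show "measure_pmf.prob (X n m) {H. P H} < \<delta>" using \<delta> by linarith
    }
  qed
qed

theorem corollary2p4:
  fixes h w :: nat
  assumes "0 < w" and "w < h"
  shows "\<exists>K::nat. \<forall>k>K. \<exists>f :: nat \<Rightarrow> real.
           sharp_threshold (\<lambda>n. UNIV) (multi_model h) (property_T h w k) f \<and>
           sharp_threshold (\<lambda>n. {m. simple_hypergraphs h n m \<noteq> {}}) (simple_model h) (property_T h w k) f"
proof -
  obtain K where K: "\<forall>k>K. \<exists>m\<^sub>0 :: nat \<Rightarrow> nat. \<forall>\<epsilon> :: real. 0 < \<epsilon> \<and> \<epsilon> < 1 \<longrightarrow> (\<exists>D::real. \<forall>\<^sub>F n in sequentially. \<forall>m.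
     (real m \<le> (1 - \<epsilon>) * m\<^sub>0 n \<longrightarrow> w * m \<le> k * n \<and>
        measure_pmf.prob (replicate_pmf m (edge_pmf h n))
          {es. \<not> property_T h w k \<lparr>verts = {1..n}, edges = mset es\<rparr>} \<le> D / n) \<and>
     ((1 + \<epsilon>) * m\<^sub>0 n \<le> real m \<longrightarrow> w * m \<le> k * n \<longrightarrow>
        measure_pmf.prob (replicate_pmf m (edge_pmf h n))
          {es. property_T h w k \<lparr>verts = {1..n}, edges = mset es\<rparr>} \<le> D / n))"
    using multi_tails[OF assms] by (rule exE)
  show ?thesis
  proof (intro exI[of _ K] allI impI)
    fix k assume "K < k"
    \<comment> \<open>The multihypergraph model is the image of the edge sequence, so the bounds
      carry over; the same \<open>m\<^sub>0\<close> will serve both models.\<close>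
    from K[rule_format, OF this] obtain m\<^sub>0 :: "nat \<Rightarrow> nat" where
      m\<^sub>0: "\<forall>\<epsilon> :: real. 0 < \<epsilon> \<and> \<epsilon> < 1 \<longrightarrow> (\<exists>D::real. \<forall>\<^sub>F n in sequentially. \<forall>m.
     (real m \<le> (1 - \<epsilon>) * m\<^sub>0 n \<longrightarrow> w * m \<le> k * n \<and>
        measure_pmf.prob (multi_model h n m) {H. \<not> property_T h w k H} \<le> D / n) \<and>
     ((1 + \<epsilon>) * m\<^sub>0 n \<le> real m \<longrightarrow> w * m \<le> k * n \<longrightarrow>
        measure_pmf.prob (multi_model h n m) {H. property_T h w k H} \<le> D / n))"
      unfolding multi_model_eq measure_map_pmf vimage_def mem_Collect_eq by (rule exE)
    obtain \<gamma> where \<gamma>: "0 < \<gamma>" "\<forall>\<^sub>F n in sequentially. \<forall>m B. w * m \<le> k * n \<longrightarrow> simple_hypergraphs h n m \<noteq> {} \<longrightarrow>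
      measure_pmf.prob (simple_model h n m) B \<le> measure_pmf.prob (multi_model h n m) B / \<gamma>"
      using simple_model_contiguous[of w h k] assms by auto
    \<comment> \<open>For \<open>k * n < w * m\<close> the property fails for every hypergraph of
      either model, which complements the upper tail bound.\<close>
    have many: "\<not> property_T h w k H" if dense: "k * n < w * m" and n: "1 \<le> n"
      and H: "H \<in> set_pmf (multi_model h n m) \<or> H \<in> simple_hypergraphs h n m" for H n m
    proof -
      obtain E where E: "H = \<lparr>verts = {1..n}, edges = E\<rparr>" "uniform_on h {1..n} E" "size E = m"
        using H
      proof
        assume "H \<in> set_pmf (multi_model h n m)"
        then obtain es where "H = \<lparr>verts = {1..n}, edges = mset es\<rparr>" "es \<in> set_pmf (replicate_pmf m (edge_pmf h n))"
          by (auto simp: multi_model_eq)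
        with replicate_edge_support[OF n this(2)] show thesis by (intro that) auto
      next
        assume "H \<in> simple_hypergraphs h n m"
        then show thesis by (rule simple_hypergraphsD) (rule that)
      qed
      then show ?thesis
        using not_property_T_if_many_edges[OF finite_atLeastAtMost E(2) assms, of k] dense E(1,3) by simp
    qed
    have zero: "measure_pmf.prob X {H. property_T h w k H} = 0"
      if "\<And>H. H \<in> set_pmf X \<Longrightarrow> \<not> property_T h w k H" for X :: "nat multihypergraph pmf"
      using that by (auto simp: measure_pmf_zero_iff)
    have "sharp_threshold (\<lambda>n. UNIV) (multi_model h) (property_T h w k) m\<^sub>0"
    proof (rule sharp_thresholdI)
      fix \<epsilon> :: real assume "0 < \<epsilon>" "\<epsilon> < 1"
      with m\<^sub>0 obtain D where D: "\<forall>\<^sub>F n in sequentially. \<forall>m.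
       (real m \<le> (1 - \<epsilon>) * m\<^sub>0 n \<longrightarrow> w * m \<le> k * n \<and>
          measure_pmf.prob (multi_model h n m) {H. \<not> property_T h w k H} \<le> D / n) \<and>
       ((1 + \<epsilon>) * m\<^sub>0 n \<le> real m \<longrightarrow> w * m \<le> k * n \<longrightarrow>
          measure_pmf.prob (multi_model h n m) {H. property_T h w k H} \<le> D / n)" by blast
      show "\<exists>D::real. \<forall>\<^sub>F n in sequentially. \<forall>m\<in>UNIV.
        (real m \<le> (1 - \<epsilon>) * real (m\<^sub>0 n) \<longrightarrow> measure_pmf.prob (multi_model h n m) {H. \<not> property_T h w k H} \<le> D / n) \<and>
        ((1 + \<epsilon>) * real (m\<^sub>0 n) \<le> real m \<longrightarrow> measure_pmf.prob (multi_model h n m) {H. property_T h w k H} \<le> D / n)"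
        using D eventually_ge_at_top[of 1]
      \<comment> \<open>The absolute value keeps the bound nonnegative where the probability is
        0.\<close>
      proof (intro exI[of _ "\<bar>D\<bar>"], eventually_elim, intro ballI conjI impI)
        fix n m
        assume H: "\<forall>m. (real m \<le> (1 - \<epsilon>) * m\<^sub>0 n \<longrightarrow> w * m \<le> k * n \<and>
            measure_pmf.prob (multi_model h n m) {H. \<not> property_T h w k H} \<le> D / n) \<and>
          ((1 + \<epsilon>) * m\<^sub>0 n \<le> real m \<longrightarrow> w * m \<le> k * n \<longrightarrow>
            measure_pmf.prob (multi_model h n m) {H. property_T h w k H} \<le> D / n)" and n: "1 \<le> n"
        have le: "D / n \<le> \<bar>D\<bar> / n" by (intro divide_right_mono) auto
        show "measure_pmf.prob (multi_model h n m) {H. \<not> property_T h w k H} \<le> \<bar>D\<bar> / n"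
          if "real m \<le> (1 - \<epsilon>) * real (m\<^sub>0 n)"
          using H that le by (meson order_trans)
        show "measure_pmf.prob (multi_model h n m) {H. property_T h w k H} \<le> \<bar>D\<bar> / n"
          if m: "(1 + \<epsilon>) * real (m\<^sub>0 n) \<le> real m"
        proof (cases "w * m \<le> k * n")
          case True
          then show ?thesis using H m le by (meson order_trans)
        next
          case False
          then have "measure_pmf.prob (multi_model h n m) {H. property_T h w k H} = 0"
            using n by (intro zero many) auto
          then show ?thesis by simp
        qed
      qed
    qed simp
    moreover have "sharp_threshold (\<lambda>n. {m. simple_hypergraphs h n m \<noteq> {}}) (simple_model h) (property_T h w k) m\<^sub>0"
    proof (rule sharp_thresholdI)
      fix \<epsilon> :: real assume "0 < \<epsilon>" "\<epsilon> < 1"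
      with m\<^sub>0 obtain D where D: "\<forall>\<^sub>F n in sequentially. \<forall>m.
       (real m \<le> (1 - \<epsilon>) * m\<^sub>0 n \<longrightarrow> w * m \<le> k * n \<and>
          measure_pmf.prob (multi_model h n m) {H. \<not> property_T h w k H} \<le> D / n) \<and>
       ((1 + \<epsilon>) * m\<^sub>0 n \<le> real m \<longrightarrow> w * m \<le> k * n \<longrightarrow>
          measure_pmf.prob (multi_model h n m) {H. property_T h w k H} \<le> D / n)" by blast
      show "\<exists>D::real. \<forall>\<^sub>F n in sequentially. \<forall>m\<in>{m. simple_hypergraphs h n m \<noteq> {}}.
        (real m \<le> (1 - \<epsilon>) * real (m\<^sub>0 n) \<longrightarrow> measure_pmf.prob (simple_model h n m) {H. \<not> property_T h w k H} \<le> D / n) \<and>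
        ((1 + \<epsilon>) * real (m\<^sub>0 n) \<le> real m \<longrightarrow> measure_pmf.prob (simple_model h n m) {H. property_T h w k H} \<le> D / n)"
        using D \<gamma>(2) eventually_ge_at_top[of 1]
      proof (intro exI[of _ "\<bar>D\<bar> / \<gamma>"], eventually_elim, intro ballI conjI impI)
        fix n m
        assume H: "\<forall>m. (real m \<le> (1 - \<epsilon>) * m\<^sub>0 n \<longrightarrow> w * m \<le> k * n \<and>
            measure_pmf.prob (multi_model h n m) {H. \<not> property_T h w k H} \<le> D / n) \<and>
          ((1 + \<epsilon>) * m\<^sub>0 n \<le> real m \<longrightarrow> w * m \<le> k * n \<longrightarrow>
            measure_pmf.prob (multi_model h n m) {H. property_T h w k H} \<le> D / n)" and n: "1 \<le> n"
        and transfer: "\<forall>m B. w * m \<le> k * n \<longrightarrow> simple_hypergraphs h n m \<noteq> {} \<longrightarrow>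
          measure_pmf.prob (simple_model h n m) B \<le> measure_pmf.prob (multi_model h n m) B / \<gamma>"
        and ne: "m \<in> {m. simple_hypergraphs h n m \<noteq> {}}"
        \<comment> \<open>Within \<open>w * m \<le> k * n\<close> both tails pass to the simple
          model at the cost of the factor \<open>1 / \<gamma>\<close>.\<close>
        have le: "measure_pmf.prob (simple_model h n m) B \<le> \<bar>D\<bar> / \<gamma> / n"
          if "w * m \<le> k * n" "measure_pmf.prob (multi_model h n m) B \<le> D / n" for B
        proof -
          have "measure_pmf.prob (simple_model h n m) B \<le> measure_pmf.prob (multi_model h n m) B / \<gamma>"
            using transfer ne that(1) by blast
          also have "\<dots> \<le> D / n / \<gamma>" using that(2) \<gamma>(1) by (intro divide_right_mono) auto
          also have "\<dots> \<le> \<bar>D\<bar> / n / \<gamma>" using \<gamma>(1) by (intro divide_right_mono) auto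
          finally show ?thesis by (simp add: mult.commute)
        qed
        show "measure_pmf.prob (simple_model h n m) {H. \<not> property_T h w k H} \<le> \<bar>D\<bar> / \<gamma> / n"
          if "real m \<le> (1 - \<epsilon>) * real (m\<^sub>0 n)"
          using H that by (intro le) auto
        show "measure_pmf.prob (simple_model h n m) {H. property_T h w k H} \<le> \<bar>D\<bar> / \<gamma> / n"
          if m: "(1 + \<epsilon>) * real (m\<^sub>0 n) \<le> real m"
        proof (cases "w * m \<le> k * n")
          case True
          then show ?thesis using H m by (intro le) auto
        next
          case False
          have "measure_pmf.prob (simple_model h n m) {H. property_T h w k H} = 0"
          proof (rule zero)
            fix H assume "H \<in> set_pmf (simple_model h n m)"
            then have "H \<in> simple_hypergraphs h n m"
              using ne finite_simple_hypergraphs[of h n m] by (simp add: simple_model_def set_pmf_of_set)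
            then show "\<not> property_T h w k H" using False n by (intro many) auto
          qed
          then show ?thesis using \<gamma>(1) by simp
        qed
      qed
    qed simp
    ultimately show "\<exists>f :: nat \<Rightarrow> real.
           sharp_threshold (\<lambda>n. UNIV) (multi_model h) (property_T h w k) f \<and>
           sharp_threshold (\<lambda>n. {m. simple_hypergraphs h n m \<noteq> {}}) (simple_model h) (property_T h w k) f"
      by blast
  qed
qed

end
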